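(* There exist positive constants $c_0,c_1,C_0,C_1,C_2$ (depending only on the distribution of the entries of the sensing vectors) such that the following holds. Let $a_1,\dots,a_m$ be drawn from the sub-Gaussian sampling model, let $\mathcal A(M)=(a_i^\top M a_i)_{i=1}^m$, and suppose $m>c_1 nr$. Then with probability at least $1-C_0\exp(-c_0 m)$ the following holds simultaneously for all positive semidefinite $\Sigma\in\mathbb{R}^{n\times n}$, all $\epsilon_1\ge0$ and all noise vectors $\eta\in\mathbb{R}^m$ with $\|\eta\|_1\le\epsilon_1$: letting $y=\mathcal A(\Sigma)+\eta$, any minimizer $\hat\Sigma$ of $$\min_{M}\ \operatorname{Tr}(M)\quad\text{subject to}\quad M\succeq0,\ \ \|y-\mathcal A(M)\|_1\le\epsilon_1$$ satisfies $$\|\hat\Sigma-\Sigma\|_{\mathrm F}\le C_1\frac{\|\Sigma-\Sigma_r\|_*}{\sqrt r}+C_2\frac{\epsilon_1}{m}.$$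
   Context: Sub-Gaussian sampling model: the sensing vectors $a_1,a_2,\dots\in\mathbb{R}^n$ are i.i.d. copies of a random vector $z=(z_1,\dots,z_n)^\top$ whose entries $z_j$ are i.i.d. sub-Gaussian random variables with $\mathbb{E}[z_j]=0$, $\mathbb{E}[z_j^2]=1$ and $\mu_4:=\mathbb{E}[z_j^4]>1$. $\Sigma_r$ denotes a best rank-$r$ approximation of $\Sigma$ in Frobenius norm. $\|\cdot\|_*$ is the nuclear norm, $\|\cdot\|_{\mathrm F}$ the Frobenius norm, and $\|v\|_1$ the $\ell_1$ norm of a vector. *)

theory Defs
  imports "HOL-Probability.Probability" "Jordan_Normal_Form.DL_Rank"
begin

definition mtrace :: "real mat \<Rightarrow> real" where
  "mtrace A = (\<Sum>i<dim_row A. A $$ (i, i))"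

definition psd_mat :: "nat \<Rightarrow> real mat \<Rightarrow> bool" where
  "psd_mat n A \<longleftrightarrow> A \<in> carrier_mat n n \<and> transpose_mat A = A \<and>
     (\<forall>x \<in> carrier_vec n. 0 \<le> scalar_prod x (mult_mat_vec A x))"

definition frob_norm :: "real mat \<Rightarrow> real" where
  "frob_norm A = sqrt (\<Sum>i<dim_row A. \<Sum>j<dim_col A. (A $$ (i, j))\<^sup>2)"

text \<open>|A| = (A^T A)^(1/2), the unique PSD square root; nuclear norm = trace of |A|
  (= sum of singular values).\<close>
definition mat_abs :: "real mat \<Rightarrow> real mat" where
  "mat_abs A = (THE B. psd_mat (dim_col A) B \<and> B * B = transpose_mat A * A)"

definition nuc_norm :: "real mat \<Rightarrow> real" where
  "nuc_norm A = mtrace (mat_abs A)"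

definition mat_rank :: "real mat \<Rightarrow> nat" where
  "mat_rank A = vec_space.rank (dim_row A) A"

definition best_rank_approx :: "nat \<Rightarrow> real mat \<Rightarrow> real mat \<Rightarrow> bool" where
  "best_rank_approx r S Sr \<longleftrightarrow>
     Sr \<in> carrier_mat (dim_row S) (dim_col S) \<and> mat_rank Sr \<le> r \<and>
     (\<forall>M \<in> carrier_mat (dim_row S) (dim_col S).
        mat_rank M \<le> r \<longrightarrow> frob_norm (S - Sr) \<le> frob_norm (S - M))"

definition l1_norm :: "real vec \<Rightarrow> real" where
  "l1_norm v = (\<Sum>i<dim_vec v. \<bar>vec_index v i\<bar>)"

definition sens_vec :: "(nat \<times> nat \<Rightarrow> real) \<Rightarrow> nat \<Rightarrow> nat \<Rightarrow> real vec" where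
  "sens_vec a n i = vec n (\<lambda>j. a (i, j))"

definition sens_op :: "(nat \<times> nat \<Rightarrow> real) \<Rightarrow> nat \<Rightarrow> nat \<Rightarrow> real mat \<Rightarrow> real vec" where
  "sens_op a m n M = vec m (\<lambda>i. scalar_prod (sens_vec a n i) (mult_mat_vec M (sens_vec a n i)))"

definition is_minimizer ::
  "(nat \<times> nat \<Rightarrow> real) \<Rightarrow> nat \<Rightarrow> nat \<Rightarrow> real vec \<Rightarrow> real \<Rightarrow> real mat \<Rightarrow> bool" where
  "is_minimizer a m n y eps Sh \<longleftrightarrow>
     (psd_mat n Sh \<and> l1_norm (y - sens_op a m n Sh) \<le> eps) \<and>
     (\<forall>M. psd_mat n M \<and> l1_norm (y - sens_op a m n M) \<le> eps \<longrightarrow> mtrace Sh \<le> mtrace M)"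

text \<open>Sub-Gaussian (psi_2 norm finite): E exp(X^2/K^2) \<le> 2 for some K > 0.\<close>
definition sub_gaussian :: "real measure \<Rightarrow> bool" where
  "sub_gaussian D \<longleftrightarrow> (\<exists>K>0. (\<integral>\<^sup>+ x. ennreal (exp (x\<^sup>2 / K\<^sup>2)) \<partial>D) \<le> 2)"

definition entry_distribution :: "real measure \<Rightarrow> bool" where
  "entry_distribution D \<longleftrightarrow> prob_space D \<and> sets D = sets borel \<and> sub_gaussian D \<and>
     integrable D (\<lambda>x. x) \<and> (\<integral>x. x \<partial>D) = 0 \<and>
     integrable D (\<lambda>x. x\<^sup>2) \<and> (\<integral>x. x\<^sup>2 \<partial>D) = 1 \<and>
     integrable D (\<lambda>x. x ^ 4) \<and> (\<integral>x. x ^ 4 \<partial>D) > 1"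

definition sample_space :: "real measure \<Rightarrow> nat \<Rightarrow> nat \<Rightarrow> (nat \<times> nat \<Rightarrow> real) measure" where
  "sample_space D m n = PiM ({..<m} \<times> {..<n}) (\<lambda>_. D)"

definition recovery_event ::
  "nat \<Rightarrow> nat \<Rightarrow> nat \<Rightarrow> real \<Rightarrow> real \<Rightarrow> (nat \<times> nat \<Rightarrow> real) set" where
  "recovery_event m n r C1 C2 = {a.
     \<forall>Sig eps eta Sh Sr.
       psd_mat n Sig \<longrightarrow> 0 \<le> eps \<longrightarrow> eta \<in> carrier_vec m \<longrightarrow> l1_norm eta \<le> eps \<longrightarrow>
       is_minimizer a m n (sens_op a m n Sig + eta) eps Sh \<longrightarrow>
       best_rank_approx r Sig Sr \<longrightarrow>
       frob_norm (Sh - Sig) \<le> C1 * nuc_norm (Sig - Sr) / sqrt (real r) + C2 * eps / real m}"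

end

theory Submission
  imports Defs
begin

text \<open>
  Write \<open>H\<close> for the difference between the minimiser and the true covariance. Since the minimiser has
  the smaller trace and both matrices are positive semidefinite, \<open>H\<close> pairs with every symmetric
  contraction to at most \<open>3 * sqrt r * \<parallel>H\<parallel>\<close> (Frobenius norm) plus twice the nuclear norm of the tail.
  So either the tail dominates and there is nothing to prove, or \<open>H\<close> has nuclear norm of order
  \<open>sqrt r * \<parallel>H\<parallel>\<close>, and it suffices to bound \<open>\<Sum>i. \<bar>a\<^sub>i\<^sup>T H a\<^sub>i\<bar>\<close> from below by a multiple of \<open>m * \<parallel>H\<parallel>\<close>
  uniformly over all such \<open>H\<close>.

  This is Mendelson's small-ball method. Replace the absolute value by its truncation \<open>\<psi>\<close>. The fourth
  moment of \<open>a\<^sup>T H a\<close> is bounded by the square of its second moment, which dominates \<open>\<parallel>H\<parallel>\<^sup>2\<close> because the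
  fourth moment of the entries exceeds \<open>1\<close>; hence \<open>\<psi> (a\<^sup>T H a)\<close> has expectation bounded below.
  The largest deviation of \<open>\<Sum>i. \<psi> (a\<^sub>i\<^sup>T H a\<^sub>i)\<close> below its mean concentrates at rate \<open>exp (- c m)\<close> because
  \<open>\<psi>\<close> is bounded, and symmetrisation and contraction bound its expectation by \<open>sqrt r\<close> times the
  expected operator norm of \<open>\<Sum>i. \<epsilon>\<^sub>i a\<^sub>i a\<^sub>i\<^sup>T\<close>, which a net argument shows to be of order \<open>sqrt (n m)\<close>.
\<close>

section \<open>Quadratic forms and the spectral theorem\<close>

text \<open>Vectors and square matrices of size \<open>n\<close> are functions of which only the values at indices below
  \<open>n\<close> matter.\<close>

definition dot :: "nat \<Rightarrow> (nat \<Rightarrow> real) \<Rightarrow> (nat \<Rightarrow> real) \<Rightarrow> real" where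
  "dot n x y = (\<Sum>i<n. x i * y i)"

definition matvec :: "nat \<Rightarrow> (nat \<Rightarrow> nat \<Rightarrow> real) \<Rightarrow> (nat \<Rightarrow> real) \<Rightarrow> nat \<Rightarrow> real" where
  "matvec n A x = (\<lambda>i. dot n (A i) x)"

definition quad_form :: "nat \<Rightarrow> (nat \<Rightarrow> nat \<Rightarrow> real) \<Rightarrow> (nat \<Rightarrow> real) \<Rightarrow> real" where
  "quad_form n A x = dot n x (matvec n A x)"

definition frob_inner :: "nat \<Rightarrow> (nat \<Rightarrow> nat \<Rightarrow> real) \<Rightarrow> (nat \<Rightarrow> nat \<Rightarrow> real) \<Rightarrow> real" where
  "frob_inner n A B = (\<Sum>i<n. dot n (A i) (B i))"

definition trace_on :: "nat \<Rightarrow> (nat \<Rightarrow> nat \<Rightarrow> real) \<Rightarrow> real" where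
  "trace_on n A = (\<Sum>i<n. A i i)"

definition symm_on :: "nat \<Rightarrow> (nat \<Rightarrow> nat \<Rightarrow> real) \<Rightarrow> bool" where
  "symm_on n A \<longleftrightarrow> (\<forall>i<n. \<forall>j<n. A i j = A j i)"

definition psd_on :: "nat \<Rightarrow> (nat \<Rightarrow> nat \<Rightarrow> real) \<Rightarrow> bool" where
  "psd_on n A \<longleftrightarrow> symm_on n A \<and> (\<forall>x. 0 \<le> quad_form n A x)"

definition orthonormal :: "nat \<Rightarrow> nat set \<Rightarrow> (nat \<Rightarrow> nat \<Rightarrow> real) \<Rightarrow> bool" where
  "orthonormal n I u \<longleftrightarrow> (\<forall>a\<in>I. \<forall>b\<in>I. dot n (u a) (u b) = (if a = b then 1 else 0))"

definition proj :: "nat \<Rightarrow> nat set \<Rightarrow> (nat \<Rightarrow> nat \<Rightarrow> real) \<Rightarrow> (nat \<Rightarrow> real) \<Rightarrow> nat \<Rightarrow> real" where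
  "proj n I u x = (\<lambda>i. \<Sum>a\<in>I. dot n (u a) x * u a i)"

definition eigenbasis ::
  "nat \<Rightarrow> (nat \<Rightarrow> nat \<Rightarrow> real) \<Rightarrow> (nat \<Rightarrow> nat \<Rightarrow> real) \<Rightarrow> (nat \<Rightarrow> real) \<Rightarrow> bool" where
  "eigenbasis n A u \<mu> \<longleftrightarrow>
    orthonormal n {..<n} u \<and> (\<forall>a<n. \<forall>i<n. matvec n A (u a) i = \<mu> a * u a i)"

lemma dot_commute: "dot n x y = dot n y x"
  by (simp add: dot_def mult.commute)

lemma dot_cong: "(\<And>i. i < n \<Longrightarrow> x i = x' i) \<Longrightarrow> (\<And>i. i < n \<Longrightarrow> y i = y' i) \<Longrightarrow> dot n x y = dot n x' y'"
  by (simp add: dot_def)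

lemma dot_add_right: "dot n x (\<lambda>i. y i + z i) = dot n x y + dot n x z"
  by (simp add: dot_def algebra_simps sum.distrib)

lemma dot_diff_right: "dot n x (\<lambda>i. y i - z i) = dot n x y - dot n x z"
  by (simp add: dot_def algebra_simps sum_subtractf)

lemma dot_scale_right: "dot n x (\<lambda>i. c * y i) = c * dot n x y"
  by (simp add: dot_def algebra_simps sum_distrib_left)

lemma dot_sum_right: "dot n x (\<lambda>i. \<Sum>a\<in>I. f a i) = (\<Sum>a\<in>I. dot n x (f a))"
  unfolding dot_def sum_distrib_left by (rule sum.swap)

lemma dot_add_left: "dot n (\<lambda>i. y i + z i) x = dot n y x + dot n z x"
  by (metis dot_commute dot_add_right)

lemma dot_diff_left: "dot n (\<lambda>i. y i - z i) x = dot n y x - dot n z x"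
  by (metis dot_commute dot_diff_right)

lemma dot_scale_left: "dot n (\<lambda>i. c * y i) x = c * dot n y x"
  by (metis dot_commute dot_scale_right)

lemma dot_sum_left: "dot n (\<lambda>i. \<Sum>a\<in>I. f a i) x = (\<Sum>a\<in>I. dot n (f a) x)"
  by (subst dot_commute, subst dot_sum_right) (simp add: dot_commute)

lemmas dot_linear = dot_add_right dot_diff_right dot_scale_right dot_sum_right
  dot_add_left dot_diff_left dot_scale_left dot_sum_left

lemma dot_self_nonneg [simp]: "0 \<le> dot n x x"
  by (simp add: dot_def sum_nonneg)

lemma dot_self_eq_0_iff: "dot n x x = 0 \<longleftrightarrow> (\<forall>i<n. x i = 0)"
  unfolding dot_def by (subst sum_nonneg_eq_0_iff) auto

lemma dot_self_pos_iff: "0 < dot n x x \<longleftrightarrow> dot n x x \<noteq> 0"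
  using dot_self_nonneg[of n x] by linarith

lemma square_coord_le_dot_self:
  assumes "i < n"
  shows "(x i)\<^sup>2 \<le> dot n x x"
  unfolding dot_def power2_eq_square using assms by (intro member_le_sum) auto

lemma abs_dot_le: "\<bar>dot n x y\<bar> \<le> sqrt (dot n x x) * sqrt (dot n y y)"
proof -
  have "(dot n x y)\<^sup>2 \<le> dot n x x * dot n y y"
    using Cauchy_Schwarz_ineq_sum[of x y "{..<n}"] by (simp add: dot_def power2_eq_square)
  from real_sqrt_le_mono[OF this] show ?thesis by (simp add: real_sqrt_mult)
qed

lemma dot_fun_upd: "k \<le> n \<Longrightarrow> dot k u (x(n := z)) = dot k u x"
  by (intro dot_cong) auto

lemma dot_Suc_fun_upd: "dot (Suc n) u (x(n := z)) = dot n u x + u n * z"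
  by (simp add: dot_def)

lemma matvec_add: "matvec n A (\<lambda>i. x i + y i) = (\<lambda>i. matvec n A x i + matvec n A y i)"
  by (simp add: matvec_def dot_linear)

lemma matvec_diff: "matvec n A (\<lambda>i. x i - y i) = (\<lambda>i. matvec n A x i - matvec n A y i)"
  by (simp add: matvec_def dot_linear)

lemma matvec_scale: "matvec n A (\<lambda>i. c * x i) = (\<lambda>i. c * matvec n A x i)"
  by (simp add: matvec_def dot_linear)

lemma matvec_sum: "matvec n A (\<lambda>i. \<Sum>a\<in>I. f a i) = (\<lambda>i. \<Sum>a\<in>I. matvec n A (f a) i)"
  by (simp add: matvec_def dot_linear)

lemma matvec_cong: "(\<And>i. i < n \<Longrightarrow> x i = y i) \<Longrightarrow> matvec n A x = matvec n A y"
  by (simp add: matvec_def dot_def)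

lemma matvec_scale_matrix: "matvec n (\<lambda>i j. c * A i j) x = (\<lambda>i. c * matvec n A x i)"
  by (simp add: matvec_def dot_linear)

lemma matvec_diff_matrix: "matvec n (\<lambda>i j. A i j - B i j) x = (\<lambda>i. matvec n A x i - matvec n B x i)"
  by (simp add: matvec_def dot_linear)

lemma dot_matvec_transpose: "dot n x (matvec n A y) = dot n (matvec n (\<lambda>i j. A j i) x) y"
proof -
  have "dot n x (matvec n A y) = (\<Sum>i<n. \<Sum>j<n. x i * (A i j * y j))"
    by (simp add: dot_def matvec_def sum_distrib_left)
  also have "\<dots> = (\<Sum>j<n. \<Sum>i<n. x i * (A i j * y j))" by (rule sum.swap)
  also have "\<dots> = dot n (matvec n (\<lambda>i j. A j i) x) y"
    unfolding dot_def matvec_def sum_distrib_right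
    by (intro sum.cong refl) (simp add: algebra_simps)
  finally show ?thesis .
qed

lemma dot_matvec_symm:
  assumes "symm_on n A"
  shows "dot n x (matvec n A y) = dot n (matvec n A x) y"
  unfolding dot_matvec_transpose
  using assms by (intro dot_cong refl) (simp add: matvec_def dot_def symm_on_def)

lemma quad_form_add:
  assumes "symm_on n A"
  shows "quad_form n A (\<lambda>i. x i + y i) =
    quad_form n A x + 2 * dot n x (matvec n A y) + quad_form n A y"
  using dot_matvec_symm[OF assms, of y x] dot_commute[of n "matvec n A y" x]
  by (simp add: quad_form_def matvec_add dot_linear)

lemma quad_form_scale: "quad_form n A (\<lambda>i. c * x i) = c\<^sup>2 * quad_form n A x"
  by (simp add: quad_form_def matvec_scale dot_linear power2_eq_square)

lemma quad_form_scale_matrix: "quad_form n (\<lambda>i j. c * A i j) x = c * quad_form n A x"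
  by (simp add: quad_form_def matvec_scale_matrix dot_linear)

lemma quad_form_diff_matrix:
  "quad_form n (\<lambda>i j. A i j - B i j) x = quad_form n A x - quad_form n B x"
  by (simp add: quad_form_def matvec_diff_matrix dot_linear)

lemma quad_form_cong: "(\<And>i. i < n \<Longrightarrow> x i = y i) \<Longrightarrow> quad_form n A x = quad_form n A y"
  unfolding quad_form_def by (intro dot_cong) (simp_all add: matvec_cong[of n x y])

lemma quad_form_cong_matrix:
  "(\<And>i j. i < n \<Longrightarrow> j < n \<Longrightarrow> A i j = B i j) \<Longrightarrow> quad_form n A x = quad_form n B x"
  unfolding quad_form_def matvec_def by (intro dot_cong) auto

lemma quad_form_eq_0: "dot n x x = 0 \<Longrightarrow> quad_form n A x = 0"
  by (simp add: quad_form_def dot_self_eq_0_iff) (simp add: dot_def)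

lemma quad_form_eq_sum: "quad_form n A x = (\<Sum>i<n. x i * dot n (A i) x)"
  by (simp add: quad_form_def matvec_def dot_def)

lemma quad_form_sum:
  "quad_form n W (\<lambda>i. \<Sum>a\<in>I. c a * u a i) = (\<Sum>a\<in>I. \<Sum>b\<in>I. c a * c b * dot n (u a) (matvec n W (u b)))"
  unfolding quad_form_def matvec_sum matvec_scale dot_sum_left dot_sum_right dot_scale_left
    dot_scale_right
  by (simp add: sum_distrib_left mult_ac)

lemma frob_inner_scale_right: "frob_inner n A (\<lambda>i j. c * B i j) = c * frob_inner n A B"
  by (simp add: frob_inner_def dot_linear sum_distrib_left)

lemma frob_inner_scale_left: "frob_inner n (\<lambda>i j. c * A i j) B = c * frob_inner n A B"
  by (simp add: frob_inner_def dot_linear sum_distrib_left)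

lemma orthonormal_subset: "orthonormal n I u \<Longrightarrow> J \<subseteq> I \<Longrightarrow> orthonormal n J u"
  unfolding orthonormal_def by blast

lemma dot_orthonormal_sum:
  assumes "orthonormal n I u" "finite I" "b \<in> I"
  shows "dot n (u b) (\<lambda>i. \<Sum>a\<in>I. c a * u a i) = c b"
proof -
  have "dot n (u b) (\<lambda>i. \<Sum>a\<in>I. c a * u a i) = (\<Sum>a\<in>I. c a * dot n (u b) (u a))"
    by (simp add: dot_linear)
  also have "\<dots> = (\<Sum>a\<in>I. if a = b then c a else 0)"
    using assms by (intro sum.cong refl) (auto simp: orthonormal_def)
  finally show ?thesis using assms by simp
qed

lemma dot_self_orthonormal_sum:
  assumes "orthonormal n I u" "finite I"
  shows "dot n (\<lambda>i. \<Sum>a\<in>I. c a * u a i) (\<lambda>i. \<Sum>a\<in>I. c a * u a i) = (\<Sum>a\<in>I. (c a)\<^sup>2)"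
proof -
  have "dot n (\<lambda>i. \<Sum>a\<in>I. c a * u a i) (\<lambda>i. \<Sum>a\<in>I. c a * u a i) =
     (\<Sum>b\<in>I. c b * dot n (u b) (\<lambda>i. \<Sum>a\<in>I. c a * u a i))"
    by (subst dot_sum_left) (simp add: dot_scale_left)
  also have "\<dots> = (\<Sum>b\<in>I. c b * c b)"
    using assms by (intro sum.cong refl) (simp add: dot_orthonormal_sum)
  finally show ?thesis by (simp add: power2_eq_square)
qed

lemma dot_proj: "dot n x (proj n I u x) = (\<Sum>a\<in>I. (dot n (u a) x)\<^sup>2)"
  by (simp add: proj_def dot_linear dot_commute[of n x] power2_eq_square)

lemma dot_self_proj:
  "orthonormal n I u \<Longrightarrow> finite I \<Longrightarrow>
    dot n (proj n I u x) (proj n I u x) = (\<Sum>a\<in>I. (dot n (u a) x)\<^sup>2)"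
  unfolding proj_def by (rule dot_self_orthonormal_sum)

lemma dot_self_residual:
  assumes "orthonormal n I u" "finite I"
  shows "dot n (\<lambda>i. x i - proj n I u x i) (\<lambda>i. x i - proj n I u x i) =
    dot n x x - (\<Sum>a\<in>I. (dot n (u a) x)\<^sup>2)"
  using dot_self_proj[OF assms] dot_commute[of n "proj n I u x" x]
  by (simp add: dot_linear dot_proj)

lemma Bessel:
  assumes "orthonormal n I u" "finite I"
  shows "(\<Sum>a\<in>I. (dot n (u a) x)\<^sup>2) \<le> dot n x x"
  using dot_self_residual[OF assms, of x] dot_self_nonneg[of n "\<lambda>i. x i - proj n I u x i"]
  by linarith

abbreviation unit_fun :: "nat \<Rightarrow> nat \<Rightarrow> real" where
  "unit_fun i \<equiv> (\<lambda>j. if j = i then 1 else 0)"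

lemma dot_unit_fun: "i < n \<Longrightarrow> dot n x (unit_fun i) = x i"
  by (simp add: dot_def if_distrib cong: if_cong)

lemma sum_squares_orthonormal:
  assumes "orthonormal n I u" "finite I"
  shows "(\<Sum>i<n. \<Sum>a\<in>I. (u a i)\<^sup>2) = real (card I)"
proof -
  have "(\<Sum>i<n. \<Sum>a\<in>I. (u a i)\<^sup>2) = (\<Sum>a\<in>I. dot n (u a) (u a))"
    unfolding dot_def by (subst sum.swap) (simp add: power2_eq_square)
  also have "\<dots> = (\<Sum>a\<in>I. 1)"
    using assms by (intro sum.cong refl) (auto simp: orthonormal_def)
  finally show ?thesis by simp
qed

text \<open>Summing Bessel's inequality over the standard basis gives \<open>n \<le> n\<close>, so it is an equality
  for every standard basis vector.\<close>
lemma orthonormal_basis_expansion: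
  assumes basis: "orthonormal n {..<n} u" and "i < n"
  shows "x i = (\<Sum>a<n. dot n (u a) x * u a i)"
proof -
  have row_le: "(\<Sum>a<n. (u a k)\<^sup>2) \<le> 1" if "k < n" for k
    using Bessel[OF basis, of "unit_fun k"] that by (simp add: dot_unit_fun)
  have "(\<Sum>k<n. 1 - (\<Sum>a<n. (u a k)\<^sup>2)) = 0"
    using sum_squares_orthonormal[OF basis] by (simp add: sum_subtractf)
  then have row: "(\<Sum>a<n. (u a k)\<^sup>2) = 1" if "k < n" for k
    using row_le that by (subst (asm) sum_nonneg_eq_0_iff) auto
  have residual: "proj n {..<n} u (unit_fun k) i = unit_fun k i" if "k < n" for k
  proof -
    let ?r = "\<lambda>i. unit_fun k i - proj n {..<n} u (unit_fun k) i"
    have "dot n ?r ?r = 0"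
      using row that by (subst dot_self_residual[OF basis]) (auto simp: dot_unit_fun)
    then have "?r i = 0" using \<open>i < n\<close> unfolding dot_self_eq_0_iff by blast
    then show ?thesis by simp
  qed
  have "(\<Sum>a<n. dot n (u a) x * u a i) = (\<Sum>k<n. x k * proj n {..<n} u (unit_fun k) i)"
    unfolding dot_def[of n _ x] sum_distrib_right
    by (subst sum.swap) (auto simp: proj_def dot_unit_fun sum_distrib_left mult_ac intro!: sum.cong)
  also have "\<dots> = dot n x (unit_fun i)" unfolding dot_def by (intro sum.cong) (auto simp: residual)
  finally show ?thesis using \<open>i < n\<close> by (simp add: dot_unit_fun)
qed

lemma quad_form_basis_expansion:
  assumes "orthonormal n {..<n} y"
  shows "quad_form n A x = (\<Sum>j<n. dot n (y j) x * dot n x (matvec n A (y j)))"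
proof -
  have "matvec n A x = matvec n A (\<lambda>i. \<Sum>j<n. dot n (y j) x * y j i)"
    by (rule matvec_cong) (rule orthonormal_basis_expansion[OF assms])
  then show ?thesis
    by (simp add: quad_form_def matvec_sum matvec_scale dot_sum_right dot_scale_right)
qed

lemma Parseval:
  assumes "orthonormal n {..<n} u"
  shows "dot n x y = (\<Sum>a<n. dot n (u a) x * dot n (u a) y)"
proof -
  have "dot n x y = dot n x (\<lambda>i. \<Sum>a<n. dot n (u a) y * u a i)"
    by (intro dot_cong refl) (rule orthonormal_basis_expansion[OF assms])
  also have "\<dots> = (\<Sum>a<n. dot n (u a) x * dot n (u a) y)"
    unfolding dot_sum_right dot_scale_right by (simp add: dot_commute[of n x] mult.commute)
  finally show ?thesis .
qed

lemma frob_inner_Parseval: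
  assumes "orthonormal n {..<n} u"
  shows "frob_inner n A B = (\<Sum>b<n. dot n (matvec n A (u b)) (matvec n B (u b)))"
proof -
  have "frob_inner n A B = (\<Sum>i<n. \<Sum>b<n. dot n (u b) (A i) * dot n (u b) (B i))"
    unfolding frob_inner_def by (intro sum.cong refl Parseval[OF assms])
  also have "\<dots> = (\<Sum>b<n. \<Sum>i<n. dot n (u b) (A i) * dot n (u b) (B i))" by (rule sum.swap)
  also have "\<dots> = (\<Sum>b<n. dot n (matvec n A (u b)) (matvec n B (u b)))"
    unfolding dot_def[of n "matvec n A _"] by (simp add: matvec_def dot_commute[of n "u _"])
  finally show ?thesis .
qed

lemma frob_inner_Parseval_entries:
  assumes "orthonormal n {..<n} u"
  shows "frob_inner n A B =
    (\<Sum>b<n. \<Sum>a<n. dot n (u a) (matvec n A (u b)) * dot n (u a) (matvec n B (u b)))"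
  unfolding frob_inner_Parseval[OF assms] by (intro sum.cong refl Parseval[OF assms])

lemma trace_on_orthonormal:
  assumes "orthonormal n {..<n} u"
  shows "trace_on n A = (\<Sum>a<n. quad_form n A (u a))"
proof -
  have "trace_on n A = frob_inner n A unit_fun"
    by (simp add: trace_on_def frob_inner_def dot_unit_fun)
  also have "\<dots> = (\<Sum>a<n. dot n (matvec n A (u a)) (u a))"
    unfolding frob_inner_Parseval[OF assms]
    by (intro sum.cong refl dot_cong)
       (simp_all add: matvec_def dot_unit_fun dot_commute[of n "unit_fun _"])
  finally show ?thesis by (simp add: quad_form_def dot_commute)
qed

lemma matvec_eq_on_basis:
  assumes basis: "orthonormal n {..<n} u"
    and eq: "\<And>a i. a < n \<Longrightarrow> i < n \<Longrightarrow> matvec n A (u a) i = matvec n B (u a) i"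
    and "i < n" "j < n"
  shows "A i j = B i j"
proof -
  have "M i j = (\<Sum>a<n. matvec n M (u a) i * u a j)" for M :: "nat \<Rightarrow> nat \<Rightarrow> real"
    using orthonormal_basis_expansion[OF basis \<open>j < n\<close>, of "M i"]
    by (simp add: matvec_def dot_commute)
  from this[of A] this[of B] show ?thesis using eq \<open>i < n\<close> by simp
qed

lemma exists_unit_orthogonal:
  assumes orthonormal: "orthonormal n {..<k} u" and "k < n"
  obtains x where "dot n x x = 1" "\<And>a. a < k \<Longrightarrow> dot n (u a) x = 0" "\<And>i. n \<le> i \<Longrightarrow> x i = 0"
proof -
  have "\<exists>i<n. (\<Sum>a<k. (u a i)\<^sup>2) < 1"
  proof (rule ccontr)
    assume "\<not> ?thesis"
    then have "(\<Sum>i<n. 1) \<le> (\<Sum>i<n. \<Sum>a<k. (u a i)\<^sup>2)" by (intro sum_mono) auto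
    then show False using sum_squares_orthonormal[OF orthonormal] \<open>k < n\<close> by simp
  qed
  then obtain i where deficient: "i < n" "(\<Sum>a<k. (u a i)\<^sup>2) < 1" by blast
  define y where "y = (\<lambda>j. unit_fun i j - proj n {..<k} u (unit_fun i) j)"
  have y_pos: "0 < dot n y y"
    unfolding y_def
    using deficient by (subst dot_self_residual[OF orthonormal]) (auto simp: dot_unit_fun)
  have y_orth: "dot n (u a) y = 0" if "a < k" for a
    unfolding y_def
    using that by (simp add: dot_diff_right proj_def dot_orthonormal_sum[OF orthonormal])
  define x where "x = (\<lambda>j. if j < n then 1 / sqrt (dot n y y) * y j else 0)"
  have dot_x: "dot n z x = 1 / sqrt (dot n y y) * dot n z y" for z
    unfolding dot_scale_right[symmetric] by (rule dot_cong) (auto simp: x_def)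
  have "dot n x x = 1"
    using y_pos by (simp add: dot_x dot_commute[of n x y])
  then show thesis using that[of x] dot_x y_orth by (simp add: x_def)
qed

lemma continuous_on_dot [continuous_intros]:
  assumes "continuous_on S f" "continuous_on S g"
  shows "continuous_on S (\<lambda>x. dot n (f x) (g x))"
proof -
  have "continuous_on S (\<lambda>x. f x i)" "continuous_on S (\<lambda>x. g x i)" for i
    using assms by (auto intro: continuous_on_product_then_coordinatewise)
  then show ?thesis unfolding dot_def by (intro continuous_intros)
qed

lemma continuous_on_quad_form [continuous_intros]:
  assumes "continuous_on S f"
  shows "continuous_on S (\<lambda>x. quad_form n A (f x))"
  unfolding quad_form_def matvec_def
  by (intro continuous_on_dot[OF assms] continuous_on_coordinatewise_then_product
      continuous_on_dot[OF continuous_on_const assms])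

lemma compact_unit_sphere_orthogonal:
  "compact {x. dot n x x = 1 \<and> (\<forall>a<k. dot n (u a) x = 0) \<and> (\<forall>i\<ge>n. x i = 0)}" (is "compact ?S")
proof -
  let ?box = "{x :: nat \<Rightarrow> real. \<forall>i. x i \<in> {-1..1}}"
  have "compactin (product_topology (\<lambda>_. euclidean) UNIV) (PiE UNIV (\<lambda>_::nat. {-1..1::real}))"
    unfolding compactin_PiE by simp
  then have "compact ?box" by (simp add: euclidean_product_topology PiE_def Pi_def)
  moreover have "?S =
      {x. dot n x x = 1} \<inter> (\<Inter>a\<in>{..<k}. {x. dot n (u a) x = 0}) \<inter> (\<Inter>i\<in>{n..}. {x. x i = 0})"
    by auto
  then have "closed ?S"
    by (auto intro!: closed_Int closed_INT closed_Collect_eq continuous_intros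
        continuous_on_product_coordinates)
  ultimately have "compact (?box \<inter> ?S)" by (rule compact_Int_closed)
  moreover have "?box \<inter> ?S = ?S"
  proof -
    have "\<bar>x i\<bar> \<le> 1" if "dot n x x = 1" "\<forall>i\<ge>n. x i = 0" for x :: "nat \<Rightarrow> real" and i
      using that square_coord_le_dot_self[of i n x] by (cases "i < n") (auto simp: abs_square_le_1)
    then show ?thesis by (fastforce simp: abs_le_iff)
  qed
  ultimately show ?thesis by simp
qed

lemma Rayleigh_maximiser:
  assumes orthonormal: "orthonormal n {..<k} u" and "k < n"
  obtains x where "dot n x x = 1" "\<And>a. a < k \<Longrightarrow> dot n (u a) x = 0"
    "\<And>y. (\<And>a. a < k \<Longrightarrow> dot n (u a) y = 0) \<Longrightarrow> quad_form n A y \<le> quad_form n A x * dot n y y"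
proof -
  let ?S = "{x. dot n x x = 1 \<and> (\<forall>a<k. dot n (u a) x = 0) \<and> (\<forall>i\<ge>n. x i = 0)}"
  have "?S \<noteq> {}" by (rule exists_unit_orthogonal[OF assms]) blast
  then have "\<exists>x\<in>?S. \<forall>y\<in>?S. quad_form n A y \<le> quad_form n A x"
    by (intro continuous_attains_sup compact_unit_sphere_orthogonal continuous_intros)
  then obtain x where in_sphere: "x \<in> ?S" and sup: "\<And>y. y \<in> ?S \<Longrightarrow> quad_form n A y \<le> quad_form n A x"
    by blast
  have "quad_form n A y \<le> quad_form n A x * dot n y y"
    if orthogonal: "\<And>a. a < k \<Longrightarrow> dot n (u a) y = 0" for y
  proof (cases "dot n y y = 0")
    case True
    then show ?thesis by (simp add: quad_form_eq_0)
  next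
    case False
    define c where "c = 1 / sqrt (dot n y y)"
    have normalised: "c\<^sup>2 * dot n y y = 1" using False by (simp add: c_def power_divide)
    define z where "z = (\<lambda>i. if i < n then c * y i else 0)"
    have dot_z: "dot n w z = c * dot n w y" for w
      unfolding dot_scale_right[symmetric] by (rule dot_cong) (auto simp: z_def)
    have "dot n z z = 1"
      using normalised by (simp add: dot_z dot_commute[of n z y] power2_eq_square)
    moreover have "\<forall>i\<ge>n. z i = 0" by (simp add: z_def)
    ultimately have "z \<in> ?S" using orthogonal by (simp add: dot_z)
    moreover have "quad_form n A z = c\<^sup>2 * quad_form n A y"
      unfolding quad_form_scale[symmetric] by (rule quad_form_cong) (simp add: z_def)
    ultimately have "c\<^sup>2 * quad_form n A y \<le> quad_form n A x" using sup[of z] by simp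
    then have "dot n y y * (c\<^sup>2 * quad_form n A y) \<le> dot n y y * quad_form n A x"
      by (intro mult_left_mono) auto
    moreover have "dot n y y * (c\<^sup>2 * quad_form n A y) = (c\<^sup>2 * dot n y y) * quad_form n A y"
      by (simp only: mult_ac)
    ultimately show ?thesis
      by (simp only: normalised mult_1_left mult.commute[of "quad_form n A x"])
  qed
  with in_sphere show thesis by (intro that) auto
qed

lemma linear_le_square_imp_zero:
  fixes b c :: real
  assumes "\<And>t. t * b \<le> t\<^sup>2 * c"
  shows "b = 0"
proof (rule ccontr)
  assume "b \<noteq> 0"
  define t where "t = b / (\<bar>c\<bar> + 1)"
  have "t * b \<le> t\<^sup>2 * c" by (rule assms)
  also have "\<dots> \<le> t\<^sup>2 * \<bar>c\<bar>" by (intro mult_left_mono) auto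
  also have "\<dots> < t\<^sup>2 * (\<bar>c\<bar> + 1)" using \<open>b \<noteq> 0\<close> by (intro mult_strict_left_mono) (auto simp: t_def)
  also have "\<dots> = t * b" by (simp add: t_def power2_eq_square)
  finally show False by simp
qed

lemma Rayleigh_maximiser_eigenvector:
  assumes symm: "symm_on n A" and eig: "\<And>a i. a < k \<Longrightarrow> i < n \<Longrightarrow> matvec n A (u a) i = \<mu> a * u a i"
    and unit: "dot n x x = 1" "\<And>a. a < k \<Longrightarrow> dot n (u a) x = 0"
    and max: "\<And>y. (\<And>a. a < k \<Longrightarrow> dot n (u a) y = 0) \<Longrightarrow> quad_form n A y \<le> quad_form n A x * dot n y y"
    and "i < n"
  shows "matvec n A x i = quad_form n A x * x i"
proof -
  define l where "l = quad_form n A x"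
  define d where "d = (\<lambda>i. matvec n A x i - l * x i)"
  have u_orth_d: "dot n (u a) d = 0" if "a < k" for a
  proof -
    have "dot n (u a) (matvec n A x) = dot n (\<lambda>i. \<mu> a * u a i) x"
      unfolding dot_matvec_symm[OF symm] using eig[OF that] by (intro dot_cong) auto
    then show ?thesis using unit(2)[OF that] by (simp add: d_def dot_linear)
  qed
  have x_orth_d: "dot n x d = 0" by (simp add: d_def dot_linear unit l_def quad_form_def)
  have x_A_d: "dot n x (matvec n A d) = dot n d d"
    using x_orth_d
    by (simp add: dot_matvec_symm[OF symm] d_def dot_linear dot_commute[of n "\<lambda>i. _ i - _ i"])
  have "t * (2 * dot n d d) \<le> t\<^sup>2 * (l * dot n d d - quad_form n A d)" for t
  proof -
    have "quad_form n A (\<lambda>i. x i + t * d i) \<le> l * dot n (\<lambda>i. x i + t * d i) (\<lambda>i. x i + t * d i)"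
      unfolding l_def by (rule max) (simp add: dot_linear unit u_orth_d)
    also have "\<dots> = l + t\<^sup>2 * (l * dot n d d)"
      using x_orth_d
      by (simp add: dot_linear unit dot_commute[of n d x] power2_eq_square algebra_simps)
    finally show ?thesis
      by (simp add: quad_form_add[OF symm] quad_form_scale matvec_scale dot_linear x_A_d l_def
          algebra_simps)
  qed
  then have "dot n d d = 0" using linear_le_square_imp_zero by fastforce
  then show ?thesis using \<open>i < n\<close> by (simp add: dot_self_eq_0_iff d_def l_def)
qed

text \<open>A maximiser of the Rayleigh quotient on the orthogonal complement of the eigenvectors found
  so far is the next eigenvector.\<close>
lemma symmetric_eigenvectors_upto:
  assumes symm: "symm_on n A" and "k \<le> n"
  shows "\<exists>u \<mu>. orthonormal n {..<k} u \<and> (\<forall>a<k. \<forall>i<n. matvec n A (u a) i = \<mu> a * u a i)"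
  using \<open>k \<le> n\<close>
proof (induction k)
  case 0
  show ?case by (simp add: orthonormal_def)
next
  case (Suc k)
  then obtain u \<mu> where orthonormal: "orthonormal n {..<k} u"
    and eig: "\<And>a i. a < k \<Longrightarrow> i < n \<Longrightarrow> matvec n A (u a) i = \<mu> a * u a i" by auto
  obtain x where maximiser: "dot n x x = 1" "\<And>a. a < k \<Longrightarrow> dot n (u a) x = 0"
    and max: "\<And>y. (\<And>a. a < k \<Longrightarrow> dot n (u a) y = 0) \<Longrightarrow> quad_form n A y \<le> quad_form n A x * dot n y y"
    by (rule Rayleigh_maximiser[OF orthonormal, where A = A]) (use Suc.prems in auto)
  have "orthonormal n {..<Suc k} (u(k := x))"
    using orthonormal maximiser dot_commute[of n x "u _"]
    by (auto simp: orthonormal_def less_Suc_eq)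
  moreover have "matvec n A x i = quad_form n A x * x i" if "i < n" for i
    using symm eig maximiser max that by (rule Rayleigh_maximiser_eigenvector)
  then have "\<forall>a<Suc k. \<forall>i<n. matvec n A ((u(k := x)) a) i =
      (\<mu>(k := quad_form n A x)) a * (u(k := x)) a i"
    using eig by (auto simp: less_Suc_eq)
  ultimately show ?case by blast
qed

theorem symmetric_eigenbasis:
  assumes "symm_on n A"
  obtains u \<mu> where "eigenbasis n A u \<mu>"
  using symmetric_eigenvectors_upto[OF assms order_refl] unfolding eigenbasis_def by blast

lemma eigenbasis_orthonormal: "eigenbasis n A u \<mu> \<Longrightarrow> orthonormal n {..<n} u"
  by (simp add: eigenbasis_def)

lemma eigenbasis_dot_matvec:
  assumes "symm_on n A" "eigenbasis n A u \<mu>" "a < n"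
  shows "dot n (u a) (matvec n A x) = \<mu> a * dot n (u a) x"
proof -
  have "dot n (u a) (matvec n A x) = dot n (\<lambda>i. \<mu> a * u a i) x"
    unfolding dot_matvec_symm[OF assms(1)]
    using assms by (intro dot_cong) (auto simp: eigenbasis_def)
  then show ?thesis by (simp add: dot_scale_left)
qed

lemma eigenbasis_bilinear:
  assumes "symm_on n A" "eigenbasis n A u \<mu>"
  shows "dot n x (matvec n A y) = (\<Sum>a<n. \<mu> a * (dot n (u a) x * dot n (u a) y))"
  unfolding Parseval[OF eigenbasis_orthonormal[OF assms(2)], of x]
  using eigenbasis_dot_matvec[OF assms] by (intro sum.cong) (auto simp: mult_ac)

lemma eigenbasis_quad_form:
  assumes "symm_on n A" "eigenbasis n A u \<mu>"
  shows "quad_form n A x = (\<Sum>a<n. \<mu> a * (dot n (u a) x)\<^sup>2)"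
  by (simp add: quad_form_def eigenbasis_bilinear[OF assms] power2_eq_square)

lemma eigenvalue_eq_quad_form:
  assumes "eigenbasis n A u \<mu>" "a < n"
  shows "\<mu> a = quad_form n A (u a)"
proof -
  have "quad_form n A (u a) = dot n (u a) (\<lambda>i. \<mu> a * u a i)"
    unfolding quad_form_def using assms by (intro dot_cong) (auto simp: eigenbasis_def)
  then show ?thesis using assms by (simp add: dot_scale_right eigenbasis_def orthonormal_def)
qed

lemma psd_on_eigenvalue_nonneg:
  "psd_on n A \<Longrightarrow> eigenbasis n A u \<mu> \<Longrightarrow> a < n \<Longrightarrow> 0 \<le> \<mu> a"
  by (simp add: eigenvalue_eq_quad_form psd_on_def)

subsection \<open>Spectral norm bounds\<close>

definition spectral_bounded :: "nat \<Rightarrow> real \<Rightarrow> (nat \<Rightarrow> nat \<Rightarrow> real) \<Rightarrow> bool" where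
  "spectral_bounded n c W \<longleftrightarrow> symm_on n W \<and> (\<forall>x. \<bar>quad_form n W x\<bar> \<le> c * dot n x x)"

lemma spectral_bounded_mono:
  assumes "spectral_bounded n c W" "c \<le> d"
  shows "spectral_bounded n d W"
  using assms mult_right_mono[OF assms(2) dot_self_nonneg]
  by (auto simp: spectral_bounded_def intro: order_trans)

lemma spectral_bounded_eigenvalue:
  assumes "spectral_bounded n c W" "eigenbasis n W u \<mu>" "a < n"
  shows "\<bar>\<mu> a\<bar> \<le> c"
proof -
  have "\<bar>quad_form n W (u a)\<bar> \<le> c * dot n (u a) (u a)"
    using assms(1) by (auto simp: spectral_bounded_def)
  moreover have "dot n (u a) (u a) = 1"
    using eigenbasis_orthonormal[OF assms(2)] assms(3) by (simp add: orthonormal_def)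
  ultimately show ?thesis using eigenvalue_eq_quad_form[OF assms(2,3)] by simp
qed

lemma spectral_boundedI_eigenvalue:
  assumes "symm_on n W" "eigenbasis n W u \<mu>" "\<And>a. a < n \<Longrightarrow> \<bar>\<mu> a\<bar> \<le> c"
  shows "spectral_bounded n c W"
  unfolding spectral_bounded_def
proof (intro conjI allI)
  fix x
  have "\<bar>quad_form n W x\<bar> \<le> (\<Sum>a<n. \<bar>\<mu> a * (dot n (u a) x)\<^sup>2\<bar>)"
    unfolding eigenbasis_quad_form[OF assms(1,2)] by (rule sum_abs)
  also have "\<dots> \<le> (\<Sum>a<n. c * (dot n (u a) x)\<^sup>2)"
    using assms(3) by (intro sum_mono) (auto simp: abs_mult intro!: mult_right_mono)
  also have "\<dots> = c * dot n x x"
    unfolding Parseval[OF eigenbasis_orthonormal[OF assms(2)], of x x]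
    by (simp add: sum_distrib_left power2_eq_square)
  finally show "\<bar>quad_form n W x\<bar> \<le> c * dot n x x" .
qed fact

lemma spectral_bounded_matvec:
  assumes bounded: "spectral_bounded n c W"
  shows "dot n (matvec n W x) (matvec n W x) \<le> c\<^sup>2 * dot n x x"
proof -
  have symm: "symm_on n W" using bounded by (simp add: spectral_bounded_def)
  obtain u \<mu> where eig: "eigenbasis n W u \<mu>" by (rule symmetric_eigenbasis[OF symm])
  note Parseval_u = Parseval[OF eigenbasis_orthonormal[OF eig]]
  have "dot n (matvec n W x) (matvec n W x) = (\<Sum>a<n. (\<mu> a)\<^sup>2 * (dot n (u a) x)\<^sup>2)"
    unfolding Parseval_u[of "matvec n W x"]
    using eigenbasis_dot_matvec[OF symm eig] by (intro sum.cong) (auto simp: power2_eq_square)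
  also have "\<dots> \<le> (\<Sum>a<n. c\<^sup>2 * (dot n (u a) x)\<^sup>2)"
    using spectral_bounded_eigenvalue[OF bounded eig]
    by (intro sum_mono mult_right_mono)
       (auto simp: abs_le_square_iff[symmetric] intro: order_trans[OF _ abs_ge_self])
  also have "\<dots> = c\<^sup>2 * dot n x x"
    unfolding Parseval_u[of x] by (simp add: sum_distrib_left power2_eq_square)
  finally show ?thesis .
qed

lemma spectral_bounded_bilinear:
  assumes bounded: "spectral_bounded n c W" and "0 \<le> c"
  shows "\<bar>dot n x (matvec n W y)\<bar> \<le> c * (sqrt (dot n x x) * sqrt (dot n y y))"
proof -
  have "\<bar>dot n x (matvec n W y)\<bar> \<le> sqrt (dot n x x) * sqrt (dot n (matvec n W y) (matvec n W y))"
    by (rule abs_dot_le)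
  also have "\<dots> \<le> sqrt (dot n x x) * sqrt (c\<^sup>2 * dot n y y)"
    by (intro mult_left_mono real_sqrt_le_mono spectral_bounded_matvec[OF bounded]) simp
  also have "\<dots> = c * (sqrt (dot n x x) * sqrt (dot n y y))"
    using \<open>0 \<le> c\<close> by (simp add: real_sqrt_mult)
  finally show ?thesis .
qed

lemma quad_form_diff_le:
  assumes bounded: "spectral_bounded n c W" and "0 \<le> c"
    and "dot n x x \<le> 1" "dot n y y \<le> 1" "dot n (\<lambda>i. x i - y i) (\<lambda>i. x i - y i) \<le> d\<^sup>2" "0 \<le> d"
  shows "\<bar>quad_form n W x - quad_form n W y\<bar> \<le> 2 * c * d"
proof -
  have "symm_on n W" using bounded by (simp add: spectral_bounded_def)
  from dot_matvec_symm[OF this, of x y]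
  have "quad_form n W x - quad_form n W y = dot n (\<lambda>i. x i - y i) (matvec n W (\<lambda>i. x i + y i))"
    by (simp add: quad_form_def matvec_add dot_linear dot_commute)
  also have "\<bar>\<dots>\<bar> \<le> c * (sqrt (dot n (\<lambda>i. x i - y i) (\<lambda>i. x i - y i)) *
      sqrt (dot n (\<lambda>i. x i + y i) (\<lambda>i. x i + y i)))"
    by (rule spectral_bounded_bilinear[OF bounded \<open>0 \<le> c\<close>])
  also have "\<dots> \<le> c * (d * 2)"
  proof (intro mult_left_mono mult_mono)
    show "sqrt (dot n (\<lambda>i. x i - y i) (\<lambda>i. x i - y i)) \<le> d" using assms(6,5) by (rule real_le_lsqrt)
    have "\<bar>dot n x y\<bar> \<le> sqrt (dot n x x) * sqrt (dot n y y)" by (rule abs_dot_le)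
    also have "\<dots> \<le> 1 * 1" using assms(3,4) by (intro mult_mono) auto
    finally have "dot n (\<lambda>i. x i + y i) (\<lambda>i. x i + y i) \<le> 2\<^sup>2"
      using assms(3,4) by (simp add: dot_linear dot_commute[of n y x])
    then show "sqrt (dot n (\<lambda>i. x i + y i) (\<lambda>i. x i + y i)) \<le> 2" by (intro real_le_lsqrt) auto
  qed (use assms in auto)
  finally show ?thesis by (simp add: mult_ac)
qed

section \<open>The nuclear norm\<close>

abbreviation entries :: "real mat \<Rightarrow> nat \<Rightarrow> nat \<Rightarrow> real" where
  "entries A \<equiv> (\<lambda>i j. A $$ (i, j))"

definition spectral_sum :: "nat \<Rightarrow> (nat \<Rightarrow> nat \<Rightarrow> real) \<Rightarrow> (nat \<Rightarrow> real) \<Rightarrow> nat \<Rightarrow> nat \<Rightarrow> real" where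
  "spectral_sum n u c = (\<lambda>i j. \<Sum>a<n. c a * u a i * u a j)"

lemma mult_mat_vec_index:
  "A \<in> carrier_mat n n \<Longrightarrow> i < n \<Longrightarrow> (A *\<^sub>v vec n x) $ i = matvec n (entries A) x i"
  by (auto simp: matvec_def dot_def scalar_prod_def lessThan_atLeast0 intro!: sum.cong)

lemma scalar_prod_mult_mat_vec:
  assumes "A \<in> carrier_mat n n"
  shows "scalar_prod (vec n x) (A *\<^sub>v vec n x) = quad_form n (entries A) x"
  using assms mult_mat_vec_index[OF assms]
  by (auto simp: quad_form_def dot_def scalar_prod_def lessThan_atLeast0
      simp del: index_mult_mat_vec
      intro!: sum.cong)

lemma transpose_mat_eq_iff_symm_on:
  assumes "A \<in> carrier_mat n n"
  shows "transpose_mat A = A \<longleftrightarrow> symm_on n (entries A)"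
proof
  assume "transpose_mat A = A"
  then show "symm_on n (entries A)"
    using assms unfolding symm_on_def by (metis carrier_matD index_transpose_mat(1))
next
  assume "symm_on n (entries A)"
  then show "transpose_mat A = A" using assms by (intro eq_matI) (auto simp: symm_on_def)
qed

lemma psd_mat_iff_psd_on: "psd_mat n A \<longleftrightarrow> A \<in> carrier_mat n n \<and> psd_on n (entries A)"
proof (cases "A \<in> carrier_mat n n")
  case True
  have "(\<forall>x \<in> carrier_vec n. 0 \<le> scalar_prod x (A *\<^sub>v x)) \<longleftrightarrow> (\<forall>x. 0 \<le> quad_form n (entries A) x)"
  proof safe
    fix x assume "\<forall>x \<in> carrier_vec n. 0 \<le> scalar_prod x (A *\<^sub>v x)"
    then show "0 \<le> quad_form n (entries A) x" by (simp flip: scalar_prod_mult_mat_vec[OF True])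
  next
    fix x :: "real vec" assume "\<forall>x. 0 \<le> quad_form n (entries A) x" "x \<in> carrier_vec n"
    moreover from this have "x = vec n (vec_index x)" by auto
    ultimately show "0 \<le> scalar_prod x (A *\<^sub>v x)" by (metis scalar_prod_mult_mat_vec[OF True])
  qed
  then show ?thesis using True by (simp add: psd_mat_def psd_on_def transpose_mat_eq_iff_symm_on)
qed (simp add: psd_mat_def)

lemma matvec_entries_mult:
  assumes "A \<in> carrier_mat n n" "B \<in> carrier_mat n n" "i < n"
  shows "matvec n (entries (A * B)) x i = matvec n (entries A) (matvec n (entries B) x) i"
proof -
  have "matvec n (entries (A * B)) x i = ((A * B) *\<^sub>v vec n x) $ i"
    using assms by (intro mult_mat_vec_index[symmetric]) auto
  also have "\<dots> = (A *\<^sub>v (B *\<^sub>v vec n x)) $ i"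
    using assms by (subst assoc_mult_mat_vec) auto
  also have "B *\<^sub>v vec n x = vec n (matvec n (entries B) x)"
    using assms mult_mat_vec_index[OF assms(2)]
    by (intro eq_vecI) (auto simp del: index_mult_mat_vec)
  also have "(A *\<^sub>v vec n (matvec n (entries B) x)) $ i =
      matvec n (entries A) (matvec n (entries B) x) i"
    using assms by (intro mult_mat_vec_index)
  finally show ?thesis .
qed

lemma matvec_entries_mat:
  "i < n \<Longrightarrow> matvec n (entries (mat n n (\<lambda>(i, j). A i j))) x i = matvec n A x i"
  by (simp add: matvec_def dot_def)

lemma quad_form_entries_mat: "quad_form n (entries (mat n n (\<lambda>(i, j). A i j))) x = quad_form n A x"
  by (rule quad_form_cong_matrix) simp

lemma symm_on_spectral_sum: "symm_on n (spectral_sum n u c)"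
  by (simp add: symm_on_def spectral_sum_def mult_ac)

lemma matvec_spectral_sum:
  "matvec n (spectral_sum n u c) x = (\<lambda>i. \<Sum>a<n. (c a * dot n (u a) x) * u a i)"
proof
  fix i
  have row: "spectral_sum n u c i = (\<lambda>j. \<Sum>a<n. (c a * u a i) * u a j)"
    by (simp add: spectral_sum_def)
  show "matvec n (spectral_sum n u c) x i = (\<Sum>a<n. (c a * dot n (u a) x) * u a i)"
    unfolding matvec_def row dot_sum_left dot_scale_left by (simp add: mult_ac)
qed

lemma eigenbasis_spectral_sum:
  assumes basis: "orthonormal n {..<n} u"
  shows "eigenbasis n (spectral_sum n u c) u c"
proof -
  have "matvec n (spectral_sum n u c) (u a) i = (\<Sum>b<n. if b = a then c b * u b i else 0)"
    if "a < n" for a i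
    unfolding matvec_spectral_sum
    using basis that by (intro sum.cong refl) (auto simp: orthonormal_def)
  then show ?thesis using basis by (simp add: eigenbasis_def)
qed

lemma psd_on_spectral_sum:
  assumes "orthonormal n {..<n} u" "\<And>a. a < n \<Longrightarrow> 0 \<le> c a"
  shows "psd_on n (spectral_sum n u c)"
  unfolding psd_on_def
  using assms symm_on_spectral_sum
  by (auto simp: eigenbasis_quad_form[OF symm_on_spectral_sum eigenbasis_spectral_sum]
      intro!: sum_nonneg)

lemma psd_square_root_eigenvector:
  assumes psd: "psd_on n C" and sq: "\<And>i. i < n \<Longrightarrow> matvec n C (matvec n C y) i = \<mu>\<^sup>2 * y i"
    and "0 \<le> \<mu>" "i < n"
  shows "matvec n C y i = \<mu> * y i"
proof (cases "\<mu> = 0")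
  case True
  have "dot n (matvec n C y) (matvec n C y) = dot n y (matvec n C (matvec n C y))"
    using psd by (simp add: dot_matvec_symm psd_on_def)
  also have "\<dots> = 0" using sq True by (simp add: dot_def)
  finally show ?thesis using True \<open>i < n\<close> by (simp add: dot_self_eq_0_iff)
next
  case False
  define z where "z = (\<lambda>i. matvec n C y i - \<mu> * y i)"
  have "matvec n C z i = - \<mu> * z i" if "i < n" for i
    unfolding z_def matvec_diff matvec_scale using sq[OF that]
    by (simp add: power2_eq_square algebra_simps)
  then have "quad_form n C z = dot n z (\<lambda>i. - \<mu> * z i)"
    unfolding quad_form_def by (intro dot_cong) auto
  then have "0 \<le> - \<mu> * dot n z z" using psd unfolding psd_on_def by (metis dot_scale_right)
  then have "dot n z z \<le> 0" using \<open>0 \<le> \<mu>\<close> False by (simp add: mult_le_0_iff)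
  then have "dot n z z = 0" using dot_self_nonneg[of n z] by linarith
  then show ?thesis using \<open>i < n\<close> by (simp add: dot_self_eq_0_iff z_def)
qed

lemma psd_mat_square_root_unique:
  assumes psd_B: "psd_mat n B" and psd_C: "psd_mat n C" and eq: "C * C = B * B"
  shows "C = B"
proof -
  have carrier: "B \<in> carrier_mat n n" "C \<in> carrier_mat n n"
    using psd_B psd_C by (auto simp: psd_mat_def)
  have psd: "psd_on n (entries B)" "psd_on n (entries C)"
    using psd_B psd_C by (simp_all add: psd_mat_iff_psd_on)
  obtain u \<mu> where eig: "eigenbasis n (entries B) u \<mu>"
    using psd(1) symmetric_eigenbasis unfolding psd_on_def by blast
  have "matvec n (entries C) (u a) i = matvec n (entries B) (u a) i" if "a < n" "i < n" for a i
  proof -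
    have B_u: "matvec n (entries B) (u a) k = \<mu> a * u a k" if "k < n" for k
      using eig \<open>a < n\<close> that by (simp add: eigenbasis_def)
    have "matvec n (entries C) (u a) i = \<mu> a * u a i"
    proof (rule psd_square_root_eigenvector[OF psd(2)])
      show "0 \<le> \<mu> a" by (rule psd_on_eigenvalue_nonneg[OF psd(1) eig \<open>a < n\<close>])
      show "i < n" by fact
      fix k assume "k < n"
      have "matvec n (entries C) (matvec n (entries C) (u a)) k =
          matvec n (entries B) (matvec n (entries B) (u a)) k"
        using matvec_entries_mult[OF carrier(2,2) \<open>k < n\<close>]
          matvec_entries_mult[OF carrier(1,1) \<open>k < n\<close>] eq by simp
      also have "\<dots> = matvec n (entries B) (\<lambda>i. \<mu> a * u a i) k"
        by (rule fun_cong[OF matvec_cong]) (rule B_u)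
      finally show "matvec n (entries C) (matvec n (entries C) (u a)) k = (\<mu> a)\<^sup>2 * u a k"
        using B_u[OF \<open>k < n\<close>] by (simp add: matvec_scale power2_eq_square)
    qed
    then show ?thesis using B_u that by simp
  qed
  then have "entries C i j = entries B i j" if "i < n" "j < n" for i j
    using matvec_eq_on_basis[OF eigenbasis_orthonormal[OF eig], of "entries C" "entries B" i j]
      that by auto
  then show ?thesis using carrier by (intro eq_matI) auto
qed

lemma psd_mat_square_root_exists:
  assumes psd_G: "psd_mat n G"
  obtains B where "psd_mat n B" "B * B = G"
proof -
  have carrier: "G \<in> carrier_mat n n" and psd: "psd_on n (entries G)"
    using psd_G by (auto simp: psd_mat_iff_psd_on)
  obtain u \<mu> where eig: "eigenbasis n (entries G) u \<mu>"
    using psd symmetric_eigenbasis unfolding psd_on_def by blast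
  note basis = eigenbasis_orthonormal[OF eig] and nonneg = psd_on_eigenvalue_nonneg[OF psd eig]
  let ?R = "spectral_sum n u (\<lambda>a. sqrt (\<mu> a))"
  define B where "B = mat n n (\<lambda>(i, j). ?R i j)"
  have carrier_B: "B \<in> carrier_mat n n" by (simp add: B_def)
  have "psd_on n ?R" using nonneg by (intro psd_on_spectral_sum basis) auto
  then have "psd_mat n B"
    unfolding psd_mat_iff_psd_on psd_on_def B_def quad_form_entries_mat by (simp add: symm_on_def)
  moreover have "B * B = G"
  proof (rule eq_matI)
    have B_u: "matvec n (entries B) (u a) k = sqrt (\<mu> a) * u a k" if "a < n" "k < n" for a k
      using eigenbasis_spectral_sum[OF basis] that
      by (simp add: B_def matvec_entries_mat eigenbasis_def)
    have "matvec n (entries (B * B)) (u a) k = matvec n (entries G) (u a) k"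
      if "a < n" "k < n" for a k
    proof -
      have "matvec n (entries (B * B)) (u a) k = matvec n (entries B) (\<lambda>i. sqrt (\<mu> a) * u a i) k"
        unfolding matvec_entries_mult[OF carrier_B carrier_B \<open>k < n\<close>]
        by (rule fun_cong[OF matvec_cong]) (rule B_u[OF \<open>a < n\<close>])
      also have "\<dots> = \<mu> a * u a k"
        using B_u[OF that] nonneg[OF \<open>a < n\<close>] by (simp add: matvec_scale)
      finally show ?thesis using eig that by (simp add: eigenbasis_def)
    qed
    then show "(B * B) $$ (i, j) = G $$ (i, j)" if "i < dim_row G" "j < dim_col G" for i j
      using matvec_eq_on_basis[OF basis, of "entries (B * B)" "entries G" i j] that carrier by auto
  qed (use carrier_B carrier in auto)
  ultimately show thesis by (rule that)
qed

lemma quad_form_gram: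
  assumes "N \<in> carrier_mat n n"
  shows "quad_form n (entries (transpose_mat N * N)) x =
    dot n (matvec n (entries N) x) (matvec n (entries N) x)"
proof -
  have "quad_form n (entries (transpose_mat N * N)) x =
      dot n x (matvec n (entries (transpose_mat N)) (matvec n (entries N) x))"
    unfolding quad_form_def using assms by (intro dot_cong refl matvec_entries_mult) auto
  also have "\<dots> = dot n (matvec n (\<lambda>i j. transpose_mat N $$ (j, i)) x) (matvec n (entries N) x)"
    by (rule dot_matvec_transpose)
  also have "\<dots> = dot n (matvec n (entries N) x) (matvec n (entries N) x)"
    using assms by (intro dot_cong) (auto simp: matvec_def dot_def)
  finally show ?thesis .
qed

lemma psd_mat_gram:
  assumes "N \<in> carrier_mat n n"
  shows "psd_mat n (transpose_mat N * N)"
proof -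
  have "transpose_mat (transpose_mat N * N) = transpose_mat N * N"
    using assms by (simp add: transpose_mult[of _ n n _ n])
  then have "symm_on n (entries (transpose_mat N * N))"
    using assms by (subst transpose_mat_eq_iff_symm_on[symmetric]) auto
  then show ?thesis using assms by (auto simp: psd_mat_iff_psd_on psd_on_def quad_form_gram)
qed

lemma mat_abs_properties:
  assumes "N \<in> carrier_mat n n"
  shows "psd_mat n (mat_abs N)" "mat_abs N * mat_abs N = transpose_mat N * N"
proof -
  obtain B where "psd_mat n B" "B * B = transpose_mat N * N"
    by (rule psd_mat_square_root_exists[OF psd_mat_gram[OF assms]])
  then have "\<exists>!B. psd_mat n B \<and> B * B = transpose_mat N * N"
    using psd_mat_square_root_unique by metis
  from theI'[OF this] have "psd_mat n (mat_abs N) \<and> mat_abs N * mat_abs N = transpose_mat N * N"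
    using assms by (simp add: mat_abs_def)
  then show "psd_mat n (mat_abs N)" "mat_abs N * mat_abs N = transpose_mat N * N" by auto
qed

lemma nuc_norm_eq_sum_singular_values:
  assumes carrier_N: "N \<in> carrier_mat n n"
  obtains y \<sigma> where "orthonormal n {..<n} y" "\<And>j. j < n \<Longrightarrow> 0 \<le> \<sigma> j" "nuc_norm N = (\<Sum>j<n. \<sigma> j)"
    "\<And>j. j < n \<Longrightarrow> dot n (matvec n (entries N) (y j)) (matvec n (entries N) (y j)) = (\<sigma> j)\<^sup>2"
proof -
  note abs = mat_abs_properties[OF carrier_N]
  have carrier: "mat_abs N \<in> carrier_mat n n" and psd: "psd_on n (entries (mat_abs N))"
    using abs(1) by (simp_all add: psd_mat_iff_psd_on)
  then have symm: "symm_on n (entries (mat_abs N))" by (simp add: psd_on_def)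
  obtain y \<sigma> where eig: "eigenbasis n (entries (mat_abs N)) y \<sigma>"
    by (rule symmetric_eigenbasis[OF symm])
  note basis = eigenbasis_orthonormal[OF eig]
  have "nuc_norm N = trace_on n (entries (mat_abs N))"
    using carrier by (simp add: nuc_norm_def mtrace_def trace_on_def)
  also have "\<dots> = (\<Sum>j<n. \<sigma> j)"
    unfolding trace_on_orthonormal[OF basis]
    by (intro sum.cong) (auto simp: eigenvalue_eq_quad_form[OF eig])
  finally have "nuc_norm N = (\<Sum>j<n. \<sigma> j)" .
  moreover have "dot n (matvec n (entries N) (y j)) (matvec n (entries N) (y j)) = (\<sigma> j)\<^sup>2"
    if "j < n" for j
  proof -
    have "transpose_mat (mat_abs N) = mat_abs N"
      using symm carrier by (simp add: transpose_mat_eq_iff_symm_on)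
    then have "quad_form n (entries (transpose_mat N * N)) (y j) =
        dot n (matvec n (entries (mat_abs N)) (y j)) (matvec n (entries (mat_abs N)) (y j))"
      using quad_form_gram[OF carrier] abs(2) by simp
    also have "\<dots> = dot n (\<lambda>i. \<sigma> j * y j i) (\<lambda>i. \<sigma> j * y j i)"
      using eig that by (intro dot_cong) (auto simp: eigenbasis_def)
    finally show ?thesis
      using basis that
      by (simp add: quad_form_gram[OF carrier_N] dot_linear orthonormal_def power2_eq_square)
  qed
  ultimately show thesis using that[OF basis] psd_on_eigenvalue_nonneg[OF psd eig] by blast
qed

lemma sum_quad_form_le_nuc_norm:
  assumes carrier: "N \<in> carrier_mat n n" and orthonormal: "orthonormal n I u" "finite I"
  shows "(\<Sum>a\<in>I. quad_form n (entries N) (u a)) \<le> nuc_norm N"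
proof -
  let ?N = "matvec n (entries N)"
  obtain y \<sigma> where right_basis: "orthonormal n {..<n} y" and singular: "\<And>j. j < n \<Longrightarrow> 0 \<le> \<sigma> j"
    and nuc: "nuc_norm N = (\<Sum>j<n. \<sigma> j)"
    and norm: "\<And>j. j < n \<Longrightarrow> dot n (?N (y j)) (?N (y j)) = (\<sigma> j)\<^sup>2"
    by (rule nuc_norm_eq_sum_singular_values[OF carrier], rule that)
  have "(\<Sum>a\<in>I. quad_form n (entries N) (u a)) =
      (\<Sum>j<n. \<Sum>a\<in>I. dot n (y j) (u a) * dot n (u a) (?N (y j)))"
    unfolding quad_form_basis_expansion[OF right_basis] by (rule sum.swap)
  also have "\<dots> \<le> (\<Sum>j<n. \<sigma> j)"
  proof (rule sum_mono)
    fix j assume "j \<in> {..<n}"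
    let ?s = "\<Sum>a\<in>I. dot n (y j) (u a) * dot n (u a) (?N (y j))"
    have "?s\<^sup>2 \<le> (\<Sum>a\<in>I. (dot n (u a) (y j))\<^sup>2) * (\<Sum>a\<in>I. (dot n (u a) (?N (y j)))\<^sup>2)"
      unfolding dot_commute[of n "y j"] by (rule Cauchy_Schwarz_ineq_sum)
    also have "\<dots> \<le> 1 * (\<sigma> j)\<^sup>2"
      using Bessel[OF orthonormal, of "y j"] Bessel[OF orthonormal, of "?N (y j)"] norm[of j]
        right_basis \<open>j \<in> {..<n}\<close>
      by (intro mult_mono) (auto simp: orthonormal_def sum_nonneg)
    finally show "?s \<le> \<sigma> j" using singular[of j] \<open>j \<in> {..<n}\<close> by (auto intro: power2_le_imp_le)
  qed
  finally show ?thesis by (simp add: nuc)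
qed

lemma nuc_norm_nonneg: "N \<in> carrier_mat n n \<Longrightarrow> 0 \<le> nuc_norm N"
  using sum_quad_form_le_nuc_norm[of N n "{}"] by (simp add: orthonormal_def)

section \<open>The error of the minimiser\<close>

lemma lin_indpt_orthonormal:
  assumes orthonormal: "orthonormal n I u" and "finite I"
  shows "inj_on (\<lambda>a. vec n (u a)) I"
      "module.lin_indpt class_ring (module_vec TYPE(real) n) ((\<lambda>a. vec n (u a)) ` I)"
proof -
  interpret vec_space "TYPE(real)" n .
  let ?f = "\<lambda>a. vec n (u a)"
  have dot_f: "dot n (u b) (vec_index (?f a)) = (if a = b then 1 else 0)" if "a \<in> I" "b \<in> I" for a b
  proof -
    have "dot n (u b) (vec_index (?f a)) = dot n (u b) (u a)" by (rule dot_cong) auto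
    then show ?thesis using orthonormal that by (auto simp: orthonormal_def)
  qed
  show inj: "inj_on ?f I"
    by (rule inj_onI) (metis dot_f zero_neq_one)
  show "lin_indpt (?f ` I)"
  proof (rule finite_lin_indpt2)
    fix c :: "real vec \<Rightarrow> real" assume "lincomb c (?f ` I) = 0\<^sub>v n"
    show "\<forall>v\<in>?f ` I. c v = 0"
    proof (clarify)
      fix b assume "b \<in> I"
      have coord: "lincomb c (?f ` I) $ i = (\<Sum>a\<in>I. c (?f a) * ?f a $ i)" if "i < n" for i
        using that by (subst lincomb_index) (auto simp: sum.reindex[OF inj])
      have "0 = dot n (u b) (vec_index (lincomb c (?f ` I)))"
        using \<open>lincomb c _ = _\<close> by (simp add: dot_def)
      also have "\<dots> = dot n (u b) (\<lambda>i. \<Sum>a\<in>I. c (?f a) * vec_index (?f a) i)"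
        by (intro dot_cong refl coord)
      also have "\<dots> = (\<Sum>a\<in>I. if a = b then c (?f a) else 0)"
        unfolding dot_sum_right dot_scale_right
        using \<open>b \<in> I\<close> by (intro sum.cong refl) (simp add: dot_f)
      finally show "c (?f b) = 0" using \<open>b \<in> I\<close> \<open>finite I\<close> by simp
    qed
  qed (use \<open>finite I\<close> in auto)
qed

lemma card_orthonormal_le_rank:
  assumes carrier: "S \<in> carrier_mat n k" and orthonormal: "orthonormal n I u" "finite I"
    and range: "\<And>a. a \<in> I \<Longrightarrow> \<exists>w\<in>carrier_vec k. vec n (u a) = S *\<^sub>v w"
  shows "card I \<le> mat_rank S"
proof -
  interpret vec_space "TYPE(real)" n .
  let ?f = "\<lambda>a. vec n (u a)" and ?C = "span (set (cols S))"
  have cols: "set (cols S) \<subseteq> carrier_vec n" using cols_dim[of S] carrier by auto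
  have in_span: "?f ` I \<subseteq> ?C"
    using carrier col_space_eq[OF carrier] by (auto simp: col_space_def) (metis range)
  have "\<not> module.lin_dep class_ring (vs ?C) (?f ` I)"
    using span_li_not_depend(2)[of "?f ` I" ?C] in_span lin_indpt_orthonormal(2)[OF orthonormal]
      span_is_submodule[OF cols] by auto
  then have "card (?f ` I) \<le> vectorspace.dim class_ring (vs ?C)"
    using in_span
    by (intro vectorspace.li_le_dim(2)[OF subspace_is_vs[OF span_is_subspace[OF cols]]
          fin_dim_span_cols[OF carrier]]) auto
  then show ?thesis
    using carrier
    by (simp add: card_image[OF lin_indpt_orthonormal(1)[OF orthonormal]] mat_rank_def rank_def)
qed

lemma gram_eigenvector_in_range:
  assumes carrier: "S \<in> carrier_mat n n" and "\<mu> \<noteq> 0"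
    and eigen: "\<And>i. i < n \<Longrightarrow> matvec n (entries (S * transpose_mat S)) x i = \<mu> * x i"
  shows "\<exists>w\<in>carrier_vec n. vec n x = S *\<^sub>v w"
proof -
  let ?w = "\<lambda>j. inverse \<mu> * matvec n (entries (transpose_mat S)) x j"
  have "vec n x = S *\<^sub>v vec n ?w"
  proof (rule eq_vecI)
    fix i assume "i < dim_vec (S *\<^sub>v vec n ?w)"
    then have "i < n" using carrier by simp
    moreover from this
    have "(S *\<^sub>v vec n ?w) $ i = inverse \<mu> * matvec n (entries (S * transpose_mat S)) x i"
      using carrier mult_mat_vec_index[OF carrier]
        matvec_entries_mult[OF carrier, of "transpose_mat S"]
      by (simp only: matvec_scale transpose_carrier_mat)
    ultimately show "vec n x $ i = (S *\<^sub>v vec n ?w) $ i" using eigen \<open>\<mu> \<noteq> 0\<close> by simp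
  qed (use carrier in simp)
  then show ?thesis by (metis vec_carrier)
qed

lemma quad_form_eq_0_of_gram:
  assumes carrier: "S \<in> carrier_mat n n"
    and gram: "quad_form n (entries (S * transpose_mat S)) x = 0"
  shows "quad_form n (entries S) x = 0"
proof -
  have "dot n (matvec n (entries (transpose_mat S)) x) (matvec n (entries (transpose_mat S)) x) = 0"
    using quad_form_gram[of "transpose_mat S" n x] carrier gram by simp
  then have "matvec n (entries (transpose_mat S)) x i = 0" if "i < n" for i
    using that by (simp add: dot_self_eq_0_iff)
  then have "matvec n (\<lambda>i j. S $$ (j, i)) x i = 0" if "i < n" for i
    using carrier that by (simp add: matvec_def dot_def)
  then show ?thesis unfolding quad_form_def dot_matvec_transpose by (simp add: dot_def)
qed

text \<open>The basis diagonalises \<open>S S\<^sup>T\<close>, and \<open>A\<close> collects the indices of the nonzero eigenvalues.\<close>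
lemma low_rank_null_basis:
  assumes carrier: "S \<in> carrier_mat n n"
  obtains u A where "orthonormal n {..<n} u" "A \<subseteq> {..<n}" "card A \<le> mat_rank S"
    "\<And>a. a \<in> {..<n} - A \<Longrightarrow> quad_form n (entries S) (u a) = 0"
proof -
  let ?G = "S * transpose_mat S"
  have "psd_mat n ?G" using psd_mat_gram[of "transpose_mat S" n] carrier by simp
  then obtain u \<mu> where eig: "eigenbasis n (entries ?G) u \<mu>"
    using symmetric_eigenbasis unfolding psd_mat_iff_psd_on psd_on_def by blast
  note basis = eigenbasis_orthonormal[OF eig]
  define A where "A = {a \<in> {..<n}. \<mu> a \<noteq> 0}"
  have null: "quad_form n (entries S) (u a) = 0" if "a \<in> {..<n} - A" for a
    using eigenvalue_eq_quad_form[OF eig, of a] that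
    by (intro quad_form_eq_0_of_gram[OF carrier]) (simp add: A_def)
  have "\<exists>w\<in>carrier_vec n. vec n (u a) = S *\<^sub>v w" if "a \<in> A" for a
    using eig that
    by (intro gram_eigenvector_in_range[OF carrier, of "\<mu> a"]) (auto simp: eigenbasis_def A_def)
  moreover have "orthonormal n A u" "finite A"
    using orthonormal_subset[OF basis, of A] by (auto simp: A_def)
  ultimately have "card A \<le> mat_rank S" using card_orthonormal_le_rank[OF carrier] by blast
  moreover have "A \<subseteq> {..<n}" by (auto simp: A_def)
  ultimately show thesis using that[OF basis] null by blast
qed

text \<open>By the duality of the spectral and the nuclear norm, this says that a symmetric \<open>H\<close> has nuclear
  norm at most \<open>\<kappa>\<close>.\<close>
definition nuclear_bounded :: "nat \<Rightarrow> real \<Rightarrow> (nat \<Rightarrow> nat \<Rightarrow> real) \<Rightarrow> bool" where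
  "nuclear_bounded n \<kappa> H \<longleftrightarrow> (\<forall>W. spectral_bounded n 1 W \<longrightarrow> frob_inner n W H \<le> \<kappa>)"

lemma nuclear_bounded_scale:
  assumes "nuclear_bounded n \<kappa> H" "0 \<le> c"
  shows "nuclear_bounded n (c * \<kappa>) (\<lambda>i j. c * H i j)"
  using assms by (simp add: nuclear_bounded_def frob_inner_scale_right mult_left_mono)

lemma nuclear_bounded_mono: "nuclear_bounded n \<kappa> H \<Longrightarrow> \<kappa> \<le> \<kappa>' \<Longrightarrow> nuclear_bounded n \<kappa>' H"
  by (meson nuclear_bounded_def order_trans)

lemma frob_inner_le_nuclear_spectral:
  assumes nuclear: "nuclear_bounded n \<kappa> H" and spectral: "spectral_bounded n \<beta> B" and "0 < \<beta>"
  shows "frob_inner n B H \<le> \<kappa> * \<beta>"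
proof -
  have "spectral_bounded n 1 (\<lambda>i j. inverse \<beta> * B i j)"
    unfolding spectral_bounded_def
  proof (intro conjI allI)
    show "symm_on n (\<lambda>i j. inverse \<beta> * B i j)"
      using spectral by (simp add: spectral_bounded_def symm_on_def)
    fix x
    have "\<bar>quad_form n B x\<bar> \<le> \<beta> * dot n x x" using spectral by (simp add: spectral_bounded_def)
    then show "\<bar>quad_form n (\<lambda>i j. inverse \<beta> * B i j) x\<bar> \<le> 1 * dot n x x"
      unfolding quad_form_scale_matrix using \<open>0 < \<beta>\<close> by (simp add: abs_mult field_simps)
  qed
  then have "inverse \<beta> * frob_inner n B H \<le> \<kappa>"
    using nuclear by (simp add: nuclear_bounded_def frob_inner_scale_left[symmetric])
  then show ?thesis using \<open>0 < \<beta>\<close> by (simp add: field_simps)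
qed

lemma psd_contraction_le_trace:
  assumes psd: "psd_on n S" and contraction: "spectral_bounded n 1 W"
    and orthonormal: "orthonormal n I u" "finite I"
  shows "\<bar>\<Sum>a\<in>I. \<Sum>b\<in>I. dot n (u a) (matvec n W (u b)) * dot n (u a) (matvec n S (u b))\<bar> \<le>
    (\<Sum>a\<in>I. quad_form n S (u a))"
proof -
  have symm: "symm_on n S" using psd by (simp add: psd_on_def)
  obtain y \<mu> where eig: "eigenbasis n S y \<mu>" by (rule symmetric_eigenbasis[OF symm])
  define p where "p = (\<lambda>j a. dot n (y j) (u a))"
  define q where "q = (\<lambda>j i. \<Sum>a\<in>I. p j a * u a i)"
  have "(\<Sum>a\<in>I. \<Sum>b\<in>I. dot n (u a) (matvec n W (u b)) * dot n (u a) (matvec n S (u b))) =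
      (\<Sum>a\<in>I. \<Sum>b\<in>I. \<Sum>j<n. \<mu> j * (p j a * p j b * dot n (u a) (matvec n W (u b))))"
    unfolding eigenbasis_bilinear[OF symm eig] p_def by (simp add: sum_distrib_left mult_ac)
  also have "\<dots> = (\<Sum>a\<in>I. \<Sum>j<n. \<Sum>b\<in>I. \<mu> j * (p j a * p j b * dot n (u a) (matvec n W (u b))))"
    by (rule sum.cong[OF refl], rule sum.swap)
  also have "\<dots> = (\<Sum>j<n. \<Sum>a\<in>I. \<Sum>b\<in>I. \<mu> j * (p j a * p j b * dot n (u a) (matvec n W (u b))))"
    by (rule sum.swap)
  also have "\<dots> = (\<Sum>j<n. \<mu> j * quad_form n W (q j))"
    by (simp add: q_def quad_form_sum sum_distrib_left)
  finally have "\<bar>\<Sum>a\<in>I. \<Sum>b\<in>I. dot n (u a) (matvec n W (u b)) * dot n (u a) (matvec n S (u b))\<bar> \<le>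
      (\<Sum>j<n. \<bar>\<mu> j * quad_form n W (q j)\<bar>)" by (simp only: sum_abs)
  also have "\<dots> \<le> (\<Sum>j<n. \<mu> j * dot n (q j) (q j))"
    using psd_on_eigenvalue_nonneg[OF psd eig] contraction
    by (intro sum_mono) (auto simp: abs_mult spectral_bounded_def intro!: mult_left_mono)
  also have "\<dots> = (\<Sum>j<n. \<Sum>a\<in>I. \<mu> j * (p j a)\<^sup>2)"
    unfolding q_def dot_self_orthonormal_sum[OF orthonormal] by (simp add: sum_distrib_left)
  also have "\<dots> = (\<Sum>a\<in>I. quad_form n S (u a))"
    unfolding eigenbasis_quad_form[OF symm eig] p_def by (rule sum.swap)
  finally show ?thesis .
qed

lemma sum_mult_le_sqrt_mult_sqrt:
  fixes w h :: "'a \<Rightarrow> real"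
  assumes "(\<Sum>p\<in>P. (w p)\<^sup>2) \<le> c" "(\<Sum>p\<in>P. (h p)\<^sup>2) \<le> d"
  shows "(\<Sum>p\<in>P. w p * h p) \<le> sqrt c * sqrt d"
proof -
  have "(\<Sum>p\<in>P. w p * h p)\<^sup>2 \<le> (\<Sum>p\<in>P. (w p)\<^sup>2) * (\<Sum>p\<in>P. (h p)\<^sup>2)" by (rule Cauchy_Schwarz_ineq_sum)
  also have "\<dots> \<le> c * d"
    using assms order_trans[OF sum_nonneg assms(1)] by (intro mult_mono) (auto simp: sum_nonneg)
  finally have "\<bar>\<Sum>p\<in>P. w p * h p\<bar> \<le> sqrt (c * d)" using real_le_rsqrt by fastforce
  then show ?thesis by (simp add: real_sqrt_mult)
qed

lemma sum_squares_entries_le_frob: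
  assumes basis: "orthonormal n {..<n} u" and "P \<subseteq> {..<n} \<times> {..<n}"
  shows "(\<Sum>(a, b)\<in>P. (dot n (u a) (matvec n H (u b)))\<^sup>2) \<le> frob_inner n H H"
proof -
  have "(\<Sum>(a, b)\<in>P. (dot n (u a) (matvec n H (u b)))\<^sup>2) \<le>
      (\<Sum>(a, b)\<in>{..<n} \<times> {..<n}. (dot n (u a) (matvec n H (u b)))\<^sup>2)"
    using assms by (intro sum_mono2) auto
  also have "\<dots> = frob_inner n H H"
    unfolding frob_inner_Parseval_entries[OF basis]
    by (subst sum.swap) (simp add: sum.cartesian_product power2_eq_square)
  finally show ?thesis .
qed

lemma sum_squares_contraction_cross:
  assumes contraction: "spectral_bounded n 1 W" and basis: "orthonormal n {..<n} u"
    and subset: "A \<subseteq> {..<n}"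
  shows "(\<Sum>(a, b)\<in>A \<times> {..<n} \<union> {..<n} \<times> A. (dot n (u a) (matvec n W (u b)))\<^sup>2) \<le> 2 * real (card A)"
proof -
  let ?w = "\<lambda>a b. dot n (u a) (matvec n W (u b))"
  have symm: "?w a b = ?w b a" for a b
    using contraction dot_matvec_symm[of n W "u a" "u b"]
    by (simp add: spectral_bounded_def dot_commute)
  have column: "(\<Sum>a<n. (?w a b)\<^sup>2) \<le> 1" if "b < n" for b
    using Bessel[OF basis, of "matvec n W (u b)"] spectral_bounded_matvec[OF contraction, of "u b"]
      basis that
    by (simp add: orthonormal_def)
  have finite: "finite A" using subset finite_subset by blast
  have "(\<Sum>(a, b)\<in>A \<times> {..<n} \<union> {..<n} \<times> A. (?w a b)\<^sup>2) \<le>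
      (\<Sum>(a, b)\<in>A \<times> {..<n}. (?w a b)\<^sup>2) + (\<Sum>(a, b)\<in>{..<n} \<times> A. (?w a b)\<^sup>2)"
    using finite by (subst sum_Un) (auto intro!: sum_nonneg)
  also have "\<dots> = 2 * (\<Sum>b\<in>A. \<Sum>a<n. (?w a b)\<^sup>2)"
    using sum.swap[of "\<lambda>a b. (?w a b)\<^sup>2" A "{..<n}"]
    by (simp add: sum.cartesian_product[symmetric] symm)
  also have "\<dots> \<le> 2 * (\<Sum>b\<in>A. 1)" using subset column by (intro mult_left_mono sum_mono) auto
  finally show ?thesis by simp
qed

text \<open>A contraction pairs with the part of \<open>S' - S\<close> outside the block \<open>J \<times> J\<close> by Cauchy--Schwarz and
  with the block itself through the traces of the two positive semidefinite compressions.\<close>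
lemma frob_inner_psd_diff_le:
  assumes psd: "psd_on n S" "psd_on n S'" and contraction: "spectral_bounded n 1 W"
    and basis: "orthonormal n {..<n} u" and subset: "A \<subseteq> {..<n}"
  defines "H \<equiv> (\<lambda>i j. S' i j - S i j)" and "J \<equiv> {..<n} - A"
  shows "frob_inner n W H \<le> sqrt (2 * real (card A)) * sqrt (frob_inner n H H) +
    (\<Sum>a\<in>J. quad_form n S' (u a)) + (\<Sum>a\<in>J. quad_form n S (u a))"
proof -
  define w where "w = (\<lambda>(a, b). dot n (u a) (matvec n W (u b)))"
  define h where "h = (\<lambda>(a, b). dot n (u a) (matvec n H (u b)))"
  let ?P = "A \<times> {..<n} \<union> {..<n} \<times> A"
  have "?P \<subseteq> {..<n} \<times> {..<n}" "finite ?P" "finite J" and complement: "orthonormal n J u"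
    using subset finite_subset[OF subset] orthonormal_subset[OF basis] by (auto simp: J_def)
  have "frob_inner n W H = (\<Sum>p\<in>{..<n} \<times> {..<n}. w p * h p)"
    unfolding frob_inner_Parseval_entries[OF basis]
    by (subst sum.swap) (simp add: sum.cartesian_product w_def h_def case_prod_unfold)
  also have "{..<n} \<times> {..<n} = ?P \<union> J \<times> J" using subset by (auto simp: J_def)
  also have "(\<Sum>p\<in>?P \<union> J \<times> J. w p * h p) = (\<Sum>p\<in>?P. w p * h p) + (\<Sum>p\<in>J \<times> J. w p * h p)"
    using \<open>finite ?P\<close> \<open>finite J\<close> by (intro sum.union_disjoint) (auto simp: J_def)
  also have "(\<Sum>p\<in>?P. w p * h p) \<le> sqrt (2 * real (card A)) * sqrt (frob_inner n H H)"
    using sum_squares_contraction_cross[OF contraction basis subset]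
      sum_squares_entries_le_frob[OF basis \<open>?P \<subseteq> _\<close>, of H]
    by (intro sum_mult_le_sqrt_mult_sqrt) (simp_all add: w_def h_def case_prod_unfold)
  also have "(\<Sum>p\<in>J \<times> J. w p * h p) =
      (\<Sum>a\<in>J. \<Sum>b\<in>J. dot n (u a) (matvec n W (u b)) * dot n (u a) (matvec n S' (u b))) -
      (\<Sum>a\<in>J. \<Sum>b\<in>J. dot n (u a) (matvec n W (u b)) * dot n (u a) (matvec n S (u b)))"
    by (simp add: w_def h_def H_def matvec_diff_matrix dot_diff_right right_diff_distrib
        sum.cartesian_product sum_subtractf case_prod_unfold)
  also have "\<dots> \<le> (\<Sum>a\<in>J. quad_form n S' (u a)) + (\<Sum>a\<in>J. quad_form n S (u a))"
    using psd_contraction_le_trace[OF psd(1) contraction complement \<open>finite J\<close>]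
      psd_contraction_le_trace[OF psd(2) contraction complement \<open>finite J\<close>]
    by linarith
  finally show ?thesis by simp
qed

lemma trace_descent_tail:
  assumes trace_le: "trace_on n S' \<le> trace_on n S" and basis: "orthonormal n {..<n} u"
    and subset: "A \<subseteq> {..<n}"
  defines "H \<equiv> (\<lambda>i j. S' i j - S i j)" and "J \<equiv> {..<n} - A"
  shows "(\<Sum>a\<in>J. quad_form n S' (u a)) \<le>
    (\<Sum>a\<in>J. quad_form n S (u a)) + sqrt (real (card A)) * sqrt (frob_inner n H H)"
proof -
  have "(\<Sum>a\<in>A. (- 1) * quad_form n H (u a)) \<le> sqrt (real (card A)) * sqrt (frob_inner n H H)"
  proof (rule sum_mult_le_sqrt_mult_sqrt)
    have "(\<Sum>a\<in>A. (quad_form n H (u a))\<^sup>2) =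
        (\<Sum>(a, b)\<in>(\<lambda>a. (a, a)) ` A. (dot n (u a) (matvec n H (u b)))\<^sup>2)"
      by (subst sum.reindex) (auto simp: quad_form_def intro: inj_onI)
    also have "\<dots> \<le> frob_inner n H H" using subset by (intro sum_squares_entries_le_frob basis) auto
    finally show "(\<Sum>a\<in>A. (quad_form n H (u a))\<^sup>2) \<le> frob_inner n H H" .
  qed simp
  then have "(\<Sum>a\<in>A. quad_form n S (u a)) \<le>
      (\<Sum>a\<in>A. quad_form n S' (u a)) + sqrt (real (card A)) * sqrt (frob_inner n H H)"
    by (simp add: H_def quad_form_diff_matrix sum_subtractf sum_negf)
  moreover have "trace_on n M = (\<Sum>a\<in>J. quad_form n M (u a)) + (\<Sum>a\<in>A. quad_form n M (u a))" for M
    unfolding trace_on_orthonormal[OF basis] J_def using subset by (simp add: sum.subset_diff)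
  ultimately show ?thesis using trace_le by simp
qed

lemma trace_descent_nuclear_bounded:
  assumes psd: "psd_on n S" "psd_on n S'" and trace_le: "trace_on n S' \<le> trace_on n S"
    and basis: "orthonormal n {..<n} u" and subset: "A \<subseteq> {..<n}" "card A \<le> r"
  defines "H \<equiv> (\<lambda>i j. S' i j - S i j)"
  shows "nuclear_bounded n (3 * sqrt (real r) * sqrt (frob_inner n H H) +
    2 * (\<Sum>a\<in>{..<n} - A. quad_form n S (u a))) H"
  unfolding nuclear_bounded_def
proof (intro allI impI)
  fix W assume contraction: "spectral_bounded n 1 W"
  define h where "h = sqrt (frob_inner n H H)"
  have "0 \<le> h" by (simp add: h_def frob_inner_def sum_nonneg)
  have "sqrt (2 * real (card A)) * h \<le> 2 * sqrt (real r) * h"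
    using subset(2) \<open>0 \<le> h\<close> sqrt2_less_2
    by (intro mult_right_mono) (auto simp: real_sqrt_mult intro!: mult_mono)
  moreover have "sqrt (real (card A)) * h \<le> sqrt (real r) * h"
    using subset(2) \<open>0 \<le> h\<close> by (intro mult_right_mono) auto
  ultimately show "frob_inner n W H \<le>
      3 * sqrt (real r) * h + 2 * (\<Sum>a\<in>{..<n} - A. quad_form n S (u a))"
    using frob_inner_psd_diff_le[OF psd contraction basis subset(1)]
      trace_descent_tail[OF trace_le basis subset(1)]
    unfolding H_def[symmetric] h_def[symmetric] by linarith
qed

lemma frob_norm_diff:
  assumes "A \<in> carrier_mat n n" "B \<in> carrier_mat n n"
  defines "H \<equiv> (\<lambda>i j. A $$ (i, j) - B $$ (i, j))"
  shows "frob_norm (A - B) = sqrt (frob_inner n H H)"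
  using assms by (simp add: frob_norm_def frob_inner_def dot_def power2_eq_square)

lemma minimizer_error_nuclear_bounded:
  assumes psd_mats: "psd_mat n S" "psd_mat n S'" and trace_le: "mtrace S' \<le> mtrace S"
    and low_rank: "R \<in> carrier_mat n n" "mat_rank R \<le> r"
  shows "nuclear_bounded n (3 * sqrt (real r) * frob_norm (S' - S) + 2 * nuc_norm (S - R))
    (\<lambda>i j. S' $$ (i, j) - S $$ (i, j))"
proof -
  have carrier: "S \<in> carrier_mat n n" "S' \<in> carrier_mat n n"
    and psd: "psd_on n (entries S)" "psd_on n (entries S')"
    using psd_mats by (auto simp: psd_mat_iff_psd_on)
  obtain u A where basis: "orthonormal n {..<n} u" and subset: "A \<subseteq> {..<n}" "card A \<le> mat_rank R"
    and null: "\<And>a. a \<in> {..<n} - A \<Longrightarrow> quad_form n (entries R) (u a) = 0"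
    by (rule low_rank_null_basis[OF low_rank(1)], rule that)
  have diff: "quad_form n (entries (S - R)) x =
      quad_form n (entries S) x - quad_form n (entries R) x" for x
    unfolding quad_form_diff_matrix[symmetric]
    using carrier low_rank by (intro quad_form_cong_matrix) auto
  have "(\<Sum>a\<in>{..<n} - A. quad_form n (entries S) (u a)) =
      (\<Sum>a\<in>{..<n} - A. quad_form n (entries (S - R)) (u a))"
    by (intro sum.cong refl) (simp only: diff null diff_0_right)
  also have "\<dots> \<le> nuc_norm (S - R)"
    using carrier low_rank orthonormal_subset[OF basis] by (intro sum_quad_form_le_nuc_norm) auto
  finally have tail: "(\<Sum>a\<in>{..<n} - A. quad_form n (entries S) (u a)) \<le> nuc_norm (S - R)" .
  show ?thesis
    unfolding frob_norm_diff[OF carrier(2,1)]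
    by (rule nuclear_bounded_mono[OF trace_descent_nuclear_bounded[OF psd _ basis subset(1), where r = r]])
       (use trace_le carrier subset(2) low_rank(2) tail in \<open>auto simp: mtrace_def trace_on_def\<close>)
qed

section \<open>Concentration and symmetrisation for independent samples\<close>

abbreviation iid :: "'a measure \<Rightarrow> nat \<Rightarrow> (nat \<Rightarrow> 'a) measure" where
  "iid M m \<equiv> PiM {..<m} (\<lambda>_. M)"

context prob_space
begin

lemma prob_space_iid: "prob_space (iid M m)"
  by (rule prob_space_PiM) (rule prob_space_axioms)

lemma distr_iid_Suc:
  "distr (M \<Otimes>\<^sub>M iid M m) (iid M (Suc m)) (\<lambda>(y, w). w(m := y)) = iid M (Suc m)"
  using distr_pair_PiM_eq_PiM[of "{..<m}" "\<lambda>_. M" m] prob_space_axioms by (simp add: lessThan_Suc)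

lemma measurable_iid_update: "(\<lambda>(y, w). w(m := y)) \<in> M \<Otimes>\<^sub>M iid M m \<rightarrow>\<^sub>M iid M (Suc m)"
  unfolding lessThan_Suc by measurable

lemma iid_update_in_space:
  "y \<in> space M \<Longrightarrow> w \<in> space (iid M m) \<Longrightarrow> w(m := y) \<in> space (iid M (Suc m))"
  using measurable_space[OF measurable_iid_update, of "(y, w)"] by (auto simp: space_pair_measure)

lemma measurable_iid_slice:
  assumes "f \<in> borel_measurable (iid M (Suc m))" "y \<in> space M"
  shows "(\<lambda>w. f (w(m := y))) \<in> borel_measurable (iid M m)"
  using measurable_comp[OF measurable_comp[OF measurable_Pair1'[OF assms(2)] measurable_iid_update]
      assms(1)]
  by (simp add: comp_def)

lemma integral_iid_Suc:
  fixes f :: "(nat \<Rightarrow> 'a) \<Rightarrow> real"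
  assumes int: "integrable (iid M (Suc m)) f"
  shows integral_iid_Suc_last_outer:
      "(\<integral>w. f w \<partial>iid M (Suc m)) = (\<integral>y. \<integral>w. f (w(m := y)) \<partial>iid M m \<partial>M)" (is ?outer)
    and integral_iid_Suc_last_inner:
      "(\<integral>w. f w \<partial>iid M (Suc m)) = (\<integral>w. \<integral>y. f (w(m := y)) \<partial>M \<partial>iid M m)" (is ?inner)
    and integrable_iid_Suc_last_outer: "integrable M (\<lambda>y. \<integral>w. f (w(m := y)) \<partial>iid M m)"
      (is ?int_outer)
    and integrable_iid_Suc_last_inner: "integrable (iid M m) (\<lambda>w. \<integral>y. f (w(m := y)) \<partial>M)"
      (is ?int_inner)
proof -
  interpret P: prob_space "iid M m" by (rule prob_space_iid)
  interpret pair_sigma_finite M "iid M m" ..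
  have int_distr: "integrable (distr (M \<Otimes>\<^sub>M iid M m) (iid M (Suc m)) (\<lambda>(y, w). w(m := y))) f"
    using int by (simp only: distr_iid_Suc)
  have pair: "integrable (M \<Otimes>\<^sub>M iid M m) (\<lambda>(y, w). f (w(m := y)))"
    using integrable_distr[OF measurable_iid_update int_distr] by (simp add: case_prod_unfold)
  have eq: "(\<integral>w. f w \<partial>iid M (Suc m)) = (\<integral>z. (case z of (y, w) \<Rightarrow> f (w(m := y))) \<partial>(M \<Otimes>\<^sub>M iid M m))"
    using integral_distr[OF measurable_iid_update[of m], of f] int
    unfolding distr_iid_Suc by (simp add: case_prod_unfold)
  show ?outer unfolding eq using integral_fst[OF pair] by simp
  show ?inner unfolding eq using integral_snd[OF pair] by simp
  show ?int_outer using integrable_fst[OF pair] by simp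
  show ?int_inner using integrable_snd[OF pair] by simp
qed

lemma nn_integral_iid_Suc:
  assumes [measurable]: "f \<in> borel_measurable (iid M (Suc m))"
  shows "(\<integral>\<^sup>+w. f w \<partial>iid M (Suc m)) = (\<integral>\<^sup>+y. \<integral>\<^sup>+w. f (w(m := y)) \<partial>iid M m \<partial>M)"
proof -
  interpret product_sigma_finite "\<lambda>_. M" ..
  show ?thesis
    using assms unfolding lessThan_Suc by (intro product_nn_integral_insert_rev) auto
qed

lemma integrable_iid_component:
  fixes h :: "'a \<Rightarrow> real"
  assumes "integrable M h" "i < m"
  shows "integrable (iid M m) (\<lambda>w. h (w i))"
proof -
  interpret product_prob_space "\<lambda>_. M" "{..<m}" ..
  have "distr (iid M m) M (\<lambda>w. w i) = M" using PiM_component[of i] assms by simp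
  then show ?thesis using assms integrable_distr[of "\<lambda>w. w i" "iid M m" M h] by auto
qed

lemma integrable_iid_sum:
  fixes h :: "'a \<Rightarrow> real"
  assumes "integrable M h" "k \<le> m"
  shows "integrable (iid M m) (\<lambda>w. \<Sum>i<k. h (w i))"
  using assms by (intro Bochner_Integration.integrable_sum integrable_iid_component) auto

lemma nn_integral_iid_exp_sum_le:
  assumes [measurable]: "h \<in> borel_measurable M"
    and le: "(\<integral>\<^sup>+x. ennreal (exp (h x)) \<partial>M) \<le> ennreal (exp b)"
  shows "(\<integral>\<^sup>+w. ennreal (exp (\<Sum>i<m. h (w i))) \<partial>iid M m) \<le> ennreal (exp (real m * b))"
proof -
  interpret product_sigma_finite "\<lambda>_. M" ..
  have "(\<integral>\<^sup>+w. ennreal (exp (\<Sum>i<m. h (w i))) \<partial>iid M m) =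
      (\<integral>\<^sup>+w. (\<Prod>i<m. ennreal (exp (h (w i)))) \<partial>iid M m)"
    by (simp add: exp_sum prod_ennreal)
  also have "\<dots> = (\<integral>\<^sup>+x. ennreal (exp (h x)) \<partial>M) ^ m"
    by (subst product_nn_integral_prod) auto
  also have "\<dots> \<le> ennreal (exp b) ^ m" by (intro power_mono le) auto
  also have "\<dots> = ennreal (exp (real m * b))" by (simp add: ennreal_power exp_of_nat_mult)
  finally show ?thesis .
qed

subsection \<open>McDiarmid's inequality\<close>

lemma Hoeffding_mgf:
  fixes g :: "'a \<Rightarrow> real"
  assumes [measurable]: "g \<in> borel_measurable M" and "0 < l"
    and range: "\<And>y z. y \<in> space M \<Longrightarrow> z \<in> space M \<Longrightarrow> g y - g z \<le> c"
  shows "(\<integral>\<^sup>+y. ennreal (exp (l * (g y - expectation g))) \<partial>M) \<le> ennreal (exp (l\<^sup>2 * c\<^sup>2 / 8))"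
proof -
  define a where "a = (INF y\<in>space M. g y)"
  obtain z0 where z0_in_space: "z0 \<in> space M" using not_empty by blast
  have bdd: "bdd_below (g ` space M)"
    using range[OF z0_in_space] by (auto intro!: bdd_belowI[of _ "g z0 - c"]) (smt (verit))
  have "g y \<in> {a..a + c}" if "y \<in> space M" for y
  proof -
    have "a \<le> g y" unfolding a_def using bdd that by (rule cINF_lower)
    moreover have "g y - c \<le> a"
      unfolding a_def
      using z0_in_space range[OF that] by (intro cINF_greatest) (auto simp: algebra_simps)
    ultimately show ?thesis by simp
  qed
  then interpret interval_bounded_random_variable M g a "a + c"
    by unfold_locales auto
  show ?thesis using Hoeffdings_lemma_nn_integral[OF \<open>0 < l\<close>] by simp
qed

definition bounded_differences :: "nat \<Rightarrow> real \<Rightarrow> ((nat \<Rightarrow> 'a) \<Rightarrow> real) \<Rightarrow> bool" where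
  "bounded_differences m c f \<longleftrightarrow>
    (\<forall>w\<in>space (iid M m). \<forall>i<m. \<forall>y\<in>space M. \<forall>z\<in>space M. f (w(i := y)) - f (w(i := z)) \<le> c)"

lemma bounded_differences_slice:
  assumes "bounded_differences (Suc m) c f" "y \<in> space M"
  shows "bounded_differences m c (\<lambda>w. f (w(m := y)))"
  unfolding bounded_differences_def
proof (intro ballI allI impI)
  fix w i u v assume "w \<in> space (iid M m)" "i < m" "u \<in> space M" "v \<in> space M"
  then have "f ((w(m := y))(i := u)) - f ((w(m := y))(i := v)) \<le> c"
    using assms iid_update_in_space by (simp add: bounded_differences_def)
  then show "f ((w(i := u))(m := y)) - f ((w(i := v))(m := y)) \<le> c"
    using \<open>i < m\<close> by (simp add: fun_upd_twist)
qed

lemma bounded_differences_marginal: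
  assumes diff: "bounded_differences (Suc m) c f"
    and int: "\<And>y. y \<in> space M \<Longrightarrow> integrable (iid M m) (\<lambda>w. f (w(m := y)))"
    and y_in_space: "y \<in> space M" and z_in_space: "z \<in> space M"
  shows "(\<integral>w. f (w(m := y)) \<partial>iid M m) - (\<integral>w. f (w(m := z)) \<partial>iid M m) \<le> c"
proof -
  interpret P: prob_space "iid M m" by (rule prob_space_iid)
  have "(\<integral>w. f (w(m := y)) - f (w(m := z)) \<partial>iid M m) \<le> (\<integral>w. c \<partial>iid M m)"
  proof (rule integral_mono)
    fix w assume "w \<in> space (iid M m)"
    then have "f ((w(m := z))(m := y)) - f ((w(m := z))(m := z)) \<le> c"
      using diff y_in_space z_in_space iid_update_in_space[OF z_in_space]
      unfolding bounded_differences_def by blast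
    then show "f (w(m := y)) - f (w(m := z)) \<le> c" by simp
  qed (use int y_in_space z_in_space in auto)
  then show ?thesis using int y_in_space z_in_space by (simp add: P.prob_space)
qed

lemma nn_integral_exp_recentre:
  assumes [measurable]: "f \<in> borel_measurable N"
  shows "(\<integral>\<^sup>+w. ennreal (exp (l * (f w - \<mu>))) \<partial>N) =
    ennreal (exp (l * (\<nu> - \<mu>))) * (\<integral>\<^sup>+w. ennreal (exp (l * (f w - \<nu>))) \<partial>N)"
proof -
  have "exp (l * (f w - \<mu>)) = exp (l * (\<nu> - \<mu>)) * exp (l * (f w - \<nu>))" for w
    by (simp add: exp_add[symmetric] algebra_simps)
  then show ?thesis by (simp add: ennreal_mult nn_integral_cmult)
qed

lemma nn_integral_exp_iid_Suc_le:
  fixes f :: "(nat \<Rightarrow> 'a) \<Rightarrow> real" and m :: nat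
  defines "g \<equiv> \<lambda>y. \<integral>w. f (w(m := y)) \<partial>iid M m"
  assumes int: "integrable (iid M (Suc m)) f"
    and slice: "\<And>y. y \<in> space M \<Longrightarrow>
      (\<integral>\<^sup>+w. ennreal (exp (l * (f (w(m := y)) - g y))) \<partial>iid M m) \<le> A"
    and marginal: "(\<integral>\<^sup>+y. ennreal (exp (l * (g y - expectation g))) \<partial>M) \<le> B"
  shows "(\<integral>\<^sup>+w. ennreal (exp (l * (f w - (\<integral>w. f w \<partial>iid M (Suc m))))) \<partial>iid M (Suc m)) \<le> B * A"
proof -
  have [measurable]: "f \<in> borel_measurable (iid M (Suc m))" "g \<in> borel_measurable M"
    and mean: "(\<integral>w. f w \<partial>iid M (Suc m)) = expectation g"
    using int integral_iid_Suc[OF int] by (auto simp: g_def)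
  have "(\<integral>\<^sup>+w. ennreal (exp (l * (f w - expectation g))) \<partial>iid M (Suc m)) =
      (\<integral>\<^sup>+y. \<integral>\<^sup>+w. ennreal (exp (l * (f (w(m := y)) - expectation g))) \<partial>iid M m \<partial>M)"
    by (intro nn_integral_iid_Suc) measurable
  also have "\<dots> \<le> (\<integral>\<^sup>+y. ennreal (exp (l * (g y - expectation g))) * A \<partial>M)"
  proof (rule nn_integral_mono)
    fix y assume "y \<in> space M"
    then show "(\<integral>\<^sup>+w. ennreal (exp (l * (f (w(m := y)) - expectation g))) \<partial>iid M m) \<le>
        ennreal (exp (l * (g y - expectation g))) * A"
      by (subst nn_integral_exp_recentre[where \<nu> = "g y"])
        (auto intro!: mult_left_mono slice measurable_iid_slice)
  qed
  also have "\<dots> = (\<integral>\<^sup>+y. ennreal (exp (l * (g y - expectation g))) \<partial>M) * A"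
    by (intro nn_integral_multc) measurable
  also have "\<dots> \<le> B * A" by (intro mult_right_mono marginal) simp
  finally show ?thesis unfolding mean .
qed

lemma McDiarmid_mgf:
  assumes l_pos: "0 < l" and f_measurable: "f \<in> borel_measurable (iid M m)"
    and bound: "\<And>w. w \<in> space (iid M m) \<Longrightarrow> \<bar>f w\<bar> \<le> K"
    and diff: "bounded_differences m c f"
  shows "(\<integral>\<^sup>+w. ennreal (exp (l * (f w - (\<integral>w. f w \<partial>iid M m)))) \<partial>iid M m) \<le>
    ennreal (exp (l\<^sup>2 * (real m * c\<^sup>2) / 8))"
  using f_measurable bound diff
proof (induction m arbitrary: f)
  case 0
  interpret P: prob_space "PiM {} (\<lambda>_::nat. M)" by (rule prob_space_PiM) auto
  interpret product_sigma_finite "\<lambda>_. M" ..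
  have "(\<integral>w. f w \<partial>iid M 0) = (\<integral>w. f (\<lambda>_. undefined) \<partial>iid M 0)"
    by (intro Bochner_Integration.integral_cong refl) (simp add: space_PiM)
  then have "(\<integral>w. f w \<partial>iid M 0) = f (\<lambda>_. undefined)" by (simp add: P.prob_space)
  then show ?case by (simp add: nn_integral_empty)
next
  case (Suc m)
  interpret P: prob_space "iid M m" by (rule prob_space_iid)
  interpret P': prob_space "iid M (Suc m)" by (rule prob_space_iid)
  note slice_measurable = measurable_iid_slice[OF Suc.prems(1)]
  have slice_bound: "\<bar>f (w(m := y))\<bar> \<le> K" if "y \<in> space M" "w \<in> space (iid M m)" for w y
    using Suc.prems(2) iid_update_in_space that by blast
  have int: "integrable (iid M (Suc m)) f"
    using Suc.prems(1,2) by (intro P'.integrable_const_bound[of _ K]) auto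
  have slice_int: "integrable (iid M m) (\<lambda>w. f (w(m := y)))" if "y \<in> space M" for y
    using slice_bound that by (intro P.integrable_const_bound[of _ K] AE_I2 slice_measurable) auto
  have "(\<integral>\<^sup>+w. ennreal (exp (l * (f w - (\<integral>w. f w \<partial>iid M (Suc m))))) \<partial>iid M (Suc m)) \<le>
      ennreal (exp (l\<^sup>2 * c\<^sup>2 / 8)) * ennreal (exp (l\<^sup>2 * (real m * c\<^sup>2) / 8))"
    using integrable_iid_Suc_last_outer[OF int]
    by (intro nn_integral_exp_iid_Suc_le int Suc.IH slice_measurable slice_bound Hoeffding_mgf l_pos
        bounded_differences_slice[OF Suc.prems(3)]
          bounded_differences_marginal[OF Suc.prems(3) slice_int]) auto
  also have "\<dots> = ennreal (exp (l\<^sup>2 * (real (Suc m) * c\<^sup>2) / 8))"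
    by (simp add: ennreal_mult[symmetric] exp_add[symmetric] algebra_simps add_divide_distrib)
  finally show ?case .
qed

theorem McDiarmid:
  assumes c_pos: "0 < c" and t_pos: "0 < t"
    and f_measurable: "f \<in> borel_measurable (iid M m)"
    and bound: "\<And>w. w \<in> space (iid M m) \<Longrightarrow> \<bar>f w\<bar> \<le> K"
    and diff: "bounded_differences m c f"
  shows "measure (iid M m) {w \<in> space (iid M m). (\<integral>w. f w \<partial>iid M m) + t * real m \<le> f w} \<le>
    exp (- 2 * t\<^sup>2 * real m / c\<^sup>2)"
proof -
  interpret P: prob_space "iid M m" by (rule prob_space_iid)
  define \<mu> where "\<mu> = (\<integral>w. f w \<partial>iid M m)"
  define l where "l = 4 * t / c\<^sup>2"
  have l_pos: "0 < l" using t_pos c_pos by (simp add: l_def)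
  let ?A = "{w \<in> space (iid M m). f w - \<mu> \<ge> t * real m}"
  have "emeasure (iid M m) ?A \<le> ennreal (exp (- l * (t * real m))) *
      (\<integral>\<^sup>+w. ennreal (exp (l * (f w - \<mu>))) * indicator (space (iid M m)) w \<partial>iid M m)"
    using f_measurable by (intro Chernoff_ineq_nn_integral_ge l_pos) auto
  also have "(\<integral>\<^sup>+w. ennreal (exp (l * (f w - \<mu>))) * indicator (space (iid M m)) w \<partial>iid M m) =
      (\<integral>\<^sup>+w. ennreal (exp (l * (f w - \<mu>))) \<partial>iid M m)"
    by (intro nn_integral_cong) auto
  also have "ennreal (exp (- l * (t * real m))) * \<dots> \<le>
      ennreal (exp (- l * (t * real m))) * ennreal (exp (l\<^sup>2 * (real m * c\<^sup>2) / 8))"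
    unfolding \<mu>_def by (intro mult_left_mono McDiarmid_mgf[OF l_pos f_measurable bound diff]) auto
  also have "\<dots> = ennreal (exp (- l * (t * real m) + l\<^sup>2 * (real m * c\<^sup>2) / 8))"
    by (simp add: ennreal_mult[symmetric] exp_add[symmetric])
  also have "- l * (t * real m) + l\<^sup>2 * (real m * c\<^sup>2) / 8 = - 2 * t\<^sup>2 * real m / c\<^sup>2"
    using c_pos by (simp add: l_def field_simps power2_eq_square)
  finally have "measure (iid M m) ?A \<le> exp (- 2 * t\<^sup>2 * real m / c\<^sup>2)"
    by (simp add: P.emeasure_eq_measure)
  moreover have "{w \<in> space (iid M m). \<mu> + t * real m \<le> f w} = ?A" by auto
  ultimately show ?thesis by (simp add: \<mu>_def)
qed

end

subsection \<open>Rademacher complexity\<close>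

lemma integrable_Max:
  fixes h :: "'i \<Rightarrow> 'a \<Rightarrow> real"
  assumes "finite F" "F \<noteq> {}" "\<And>H. H \<in> F \<Longrightarrow> integrable M (h H)"
  shows "integrable M (\<lambda>x. MAX H\<in>F. h H x)"
  using assms by (induction F rule: finite_ne_induct) auto

lemma (in pair_prob_space)
  fixes h :: "'a \<Rightarrow> real" and k :: "'b \<Rightarrow> real"
  shows integrable_compose_fst: "integrable M1 h \<Longrightarrow> integrable (M1 \<Otimes>\<^sub>M M2) (\<lambda>z. h (fst z))"
    and integrable_compose_snd: "integrable M2 k \<Longrightarrow> integrable (M1 \<Otimes>\<^sub>M M2) (\<lambda>z. k (snd z))"
  by (intro Fubini_integrable; auto)+

lemma integral_Max_iid_exchange_last:
  fixes a :: "'i \<Rightarrow> 'a \<Rightarrow> real" and b :: "'i \<Rightarrow> 'b \<Rightarrow> real"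
  assumes "prob_space P" "prob_space Q" and finite: "finite F" "F \<noteq> {}"
    and int: "\<And>H. H \<in> F \<Longrightarrow> integrable P (a H)" "\<And>H. H \<in> F \<Longrightarrow> integrable Q (b H)"
    and exchange: "\<And>g. (\<integral>y. (MAX H\<in>F. g H + a H y) \<partial>P) \<le> (\<integral>z. (MAX H\<in>F. g H + b H z) \<partial>Q)"
  shows "(\<integral>w. (MAX H\<in>F. g H + (\<Sum>i<Suc m. a H (w i))) \<partial>iid P (Suc m)) \<le>
      (\<integral>z. \<integral>w. (MAX H\<in>F. g H + b H z + (\<Sum>i<m. a H (w i))) \<partial>iid P m \<partial>Q)"
    and "integrable Q (\<lambda>z. \<integral>w. (MAX H\<in>F. g H + b H z + (\<Sum>i<m. a H (w i))) \<partial>iid P m)"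
proof -
  interpret P: prob_space P by fact
  interpret Q: prob_space Q by fact
  interpret Pm: prob_space "iid P m" by (rule P.prob_space_iid)
  interpret PQ: pair_prob_space "iid P m" Q ..
  let ?A = "\<lambda>H w. \<Sum>i<m. a H (w i)"
  have int_P: "integrable (iid P (Suc m)) (\<lambda>w. MAX H\<in>F. g H + ?A H w + a H (w m))"
    using int(1) by (intro integrable_Max finite Bochner_Integration.integrable_add
        P.integrable_iid_sum P.integrable_iid_component) auto
  have int_PQ: "integrable (iid P m \<Otimes>\<^sub>M Q) (\<lambda>(w, z). MAX H\<in>F. g H + b H z + ?A H w)"
    unfolding case_prod_unfold
    using int
    by (intro integrable_Max finite Bochner_Integration.integrable_add PQ.integrable_compose_fst
        PQ.integrable_compose_snd P.integrable_iid_sum) auto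
  have "(\<integral>w. (MAX H\<in>F. g H + (\<Sum>i<Suc m. a H (w i))) \<partial>iid P (Suc m)) =
      (\<integral>w. \<integral>y. (MAX H\<in>F. g H + ?A H w + a H y) \<partial>P \<partial>iid P m)"
    using P.integral_iid_Suc_last_inner[OF int_P] by (simp add: add.assoc)
  also have "\<dots> \<le> (\<integral>w. \<integral>z. (MAX H\<in>F. g H + ?A H w + b H z) \<partial>Q \<partial>iid P m)"
    using P.integrable_iid_Suc_last_inner[OF int_P] PQ.integrable_fst[OF int_PQ]
    by (intro integral_mono exchange) (simp_all add: ac_simps)
  also have "\<dots> = (\<integral>z. \<integral>w. (MAX H\<in>F. g H + b H z + ?A H w) \<partial>iid P m \<partial>Q)"
    by (subst PQ.Fubini_integral[OF int_PQ]) (simp add: ac_simps)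
  finally show "(\<integral>w. (MAX H\<in>F. g H + (\<Sum>i<Suc m. a H (w i))) \<partial>iid P (Suc m)) \<le>
      (\<integral>z. \<integral>w. (MAX H\<in>F. g H + b H z + ?A H w) \<partial>iid P m \<partial>Q)" .
  show "integrable Q (\<lambda>z. \<integral>w. (MAX H\<in>F. g H + b H z + ?A H w) \<partial>iid P m)"
    using PQ.integrable_snd[OF int_PQ] by simp
qed

lemma integral_Max_iid_sum_mono:
  fixes a :: "'i \<Rightarrow> 'a \<Rightarrow> real" and b :: "'i \<Rightarrow> 'b \<Rightarrow> real"
  assumes prob_P: "prob_space P" and prob_Q: "prob_space Q" and finite: "finite F" "F \<noteq> {}"
    and int: "\<And>H. H \<in> F \<Longrightarrow> integrable P (a H)" "\<And>H. H \<in> F \<Longrightarrow> integrable Q (b H)"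
    and exchange: "\<And>g. (\<integral>y. (MAX H\<in>F. g H + a H y) \<partial>P) \<le> (\<integral>z. (MAX H\<in>F. g H + b H z) \<partial>Q)"
  shows "(\<integral>w. (MAX H\<in>F. g H + (\<Sum>i<m. a H (w i))) \<partial>iid P m) \<le>
    (\<integral>w. (MAX H\<in>F. g H + (\<Sum>i<m. b H (w i))) \<partial>iid Q m)"
proof (induction m arbitrary: g)
  case 0
  show ?case
    using prob_space.prob_space[OF prob_space.prob_space_iid[OF prob_P, of 0]]
      prob_space.prob_space[OF prob_space.prob_space_iid[OF prob_Q, of 0]] by simp
next
  case (Suc m)
  interpret Q: prob_space Q by fact
  note exchange_last = integral_Max_iid_exchange_last[OF prob_P prob_Q finite int exchange]
  have int_Q: "integrable (iid Q (Suc m)) (\<lambda>w. MAX H\<in>F. g H + b H (w m) + (\<Sum>i<m. b H (w i)))"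
    using int(2) by (intro integrable_Max finite Bochner_Integration.integrable_add
        Q.integrable_iid_sum Q.integrable_iid_component) auto
  have "(\<integral>w. (MAX H\<in>F. g H + (\<Sum>i<Suc m. a H (w i))) \<partial>iid P (Suc m)) \<le>
      (\<integral>z. \<integral>w. (MAX H\<in>F. g H + b H z + (\<Sum>i<m. a H (w i))) \<partial>iid P m \<partial>Q)"
    by (rule exchange_last(1))
  also have "\<dots> \<le> (\<integral>z. \<integral>w. (MAX H\<in>F. g H + b H z + (\<Sum>i<m. b H (w i))) \<partial>iid Q m \<partial>Q)"
    using Q.integrable_iid_Suc_last_outer[OF int_Q]
    by (intro integral_mono Suc.IH exchange_last(2)) simp_all
  also have "\<dots> = (\<integral>w. (MAX H\<in>F. g H + (\<Sum>i<Suc m. b H (w i))) \<partial>iid Q (Suc m))"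
    using Q.integral_iid_Suc_last_outer[OF int_Q] by (simp add: ac_simps)
  finally show ?case .
qed

definition rademacher :: "real measure" where
  "rademacher = measure_pmf (pmf_of_set {1, -1})"

abbreviation signed :: "'a measure \<Rightarrow> ('a \<times> real) measure" where
  "signed M \<equiv> M \<Otimes>\<^sub>M rademacher"

lemma prob_space_rademacher: "prob_space rademacher"
  unfolding rademacher_def by (rule prob_space_measure_pmf)

lemma (in prob_space) prob_space_signed: "prob_space (signed M)"
  by (intro prob_space_pair prob_space_axioms prob_space_rademacher)

lemma measurable_snd_signed [measurable]: "snd \<in> borel_measurable (signed M)"
proof -
  have "(\<lambda>x. x) \<in> rademacher \<rightarrow>\<^sub>M borel" by (simp add: rademacher_def)
  then show ?thesis by (rule measurable_compose[OF measurable_snd])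
qed

lemma nn_integral_signed:
  assumes f_measurable: "f \<in> borel_measurable (signed M)"
  shows "(\<integral>\<^sup>+z. f z \<partial>signed M) = (\<integral>\<^sup>+x. (f (x, 1) + f (x, -1)) / 2 \<partial>M)"
proof -
  interpret R: prob_space rademacher by (rule prob_space_rademacher)
  have "(\<integral>\<^sup>+e. g e \<partial>rademacher) = (g 1 + g (-1)) / 2" for g :: "real \<Rightarrow> ennreal"
    unfolding rademacher_def by (subst nn_integral_pmf_of_set) auto
  then show ?thesis using R.nn_integral_fst[OF f_measurable] by simp
qed

lemma integrable_signed_product:
  fixes f :: "'a \<Rightarrow> real"
  assumes "prob_space M" and int: "integrable M f"
  shows "integrable (signed M) (\<lambda>z. snd z * f (fst z))"
proof (rule integrableI_bounded)
  have [measurable]: "f \<in> borel_measurable M" using int by simp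
  show "(\<lambda>z. snd z * f (fst z)) \<in> borel_measurable (signed M)" by measurable
  have "(\<integral>\<^sup>+z. ennreal (norm (snd z * f (fst z))) \<partial>signed M) = (\<integral>\<^sup>+x. ennreal \<bar>f x\<bar> \<partial>M)"
    by (subst nn_integral_signed) (auto simp: ennreal_plus[symmetric] ennreal_divide_numeral
        simp del: ennreal_plus)
  then show "(\<integral>\<^sup>+z. ennreal (norm (snd z * f (fst z))) \<partial>signed M) < \<infinity>"
    using int by (simp add: integrable_iff_bounded)
qed

lemma integral_signed:
  fixes f :: "'a \<times> real \<Rightarrow> real"
  assumes "prob_space M" and int: "integrable (signed M) f"
  shows "(\<integral>z. f z \<partial>signed M) = (\<integral>x. (f (x, 1) + f (x, -1)) / 2 \<partial>M)"
proof -
  interpret M: prob_space M by fact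
  interpret R: prob_space rademacher by (rule prob_space_rademacher)
  interpret pair_sigma_finite M rademacher ..
  have avg: "(\<integral>e. g e \<partial>rademacher) = (g 1 + g (-1)) / 2" for g :: "real \<Rightarrow> real"
    unfolding rademacher_def by (subst integral_pmf_of_set) auto
  show ?thesis using integral_fst'[OF int, symmetric] by (simp only: avg)
qed

definition rademacher_complexity ::
  "'a measure \<Rightarrow> nat \<Rightarrow> ('i \<Rightarrow> 'a \<Rightarrow> real) \<Rightarrow> 'i set \<Rightarrow> real" where
  "rademacher_complexity M m f F =
    (\<integral>w. (MAX H\<in>F. \<Sum>i<m. snd (w i) * f H (fst (w i))) \<partial>iid (signed M) m)"

text \<open>At the two maximisers only the increment of \<open>p\<close> between them enters, so \<open>p\<close> may be replaced by
  any \<open>q\<close> with larger increments.\<close>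
lemma Max_contraction:
  fixes g p q :: "'i \<Rightarrow> real"
  assumes finite: "finite F" "F \<noteq> {}" and lip: "\<And>H K. H \<in> F \<Longrightarrow> K \<in> F \<Longrightarrow> \<bar>p H - p K\<bar> \<le> \<bar>q H - q K\<bar>"
  shows "(MAX H\<in>F. g H + p H) + (MAX H\<in>F. g H - p H) \<le> (MAX H\<in>F. g H + q H) + (MAX H\<in>F. g H - q H)"
proof -
  obtain H where max_plus: "H \<in> F" "(MAX H\<in>F. g H + p H) = g H + p H"
    by (rule obtains_MAX[OF finite])
  obtain K where max_minus: "K \<in> F" "(MAX H\<in>F. g H - p H) = g K - p K"
    by (rule obtains_MAX[OF finite])
  have "g J + q J \<le> (MAX H\<in>F. g H + q H)" "g J - q J \<le> (MAX H\<in>F. g H - q H)" if "J \<in> F" for J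
    using finite that by (auto intro!: Max_ge)
  from this[OF max_plus(1)] this[OF max_minus(1)] lip[OF max_plus(1) max_minus(1)] show ?thesis
    unfolding max_plus(2) max_minus(2) by linarith
qed

context prob_space
begin

lemma integral_Max_symmetrize:
  fixes p :: "'i \<Rightarrow> 'a \<Rightarrow> real"
  assumes finite: "finite F" "F \<noteq> {}" and p_int: "\<And>H. H \<in> F \<Longrightarrow> integrable M (p H)"
  shows "(\<integral>x. (MAX H\<in>F. g H + (expectation (p H) - p H x)) \<partial>M) \<le>
    (\<integral>x. ((MAX H\<in>F. g H + 2 * p H x) + (MAX H\<in>F. g H - 2 * p H x)) / 2 \<partial>M)"
proof -
  let ?U = "\<lambda>x. MAX H\<in>F. g H + 2 * p H x" and ?L = "\<lambda>x. MAX H\<in>F. g H - 2 * p H x"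
  have int: "integrable M ?U" "integrable M ?L" using finite p_int by (auto intro!: integrable_Max)
  have "(MAX H\<in>F. g H + (expectation (p H) - p H x)) \<le> (expectation ?U + ?L x) / 2" for x
  proof -
    obtain H where max: "H \<in> F"
      "(MAX H\<in>F. g H + (expectation (p H) - p H x)) = g H + (expectation (p H) - p H x)"
      by (rule obtains_MAX[OF finite])
    have "(\<integral>x. g H + 2 * p H x \<partial>M) \<le> expectation ?U"
      using finite max(1) p_int int by (intro integral_mono) (auto intro!: Max_ge)
    then have "g H + 2 * expectation (p H) \<le> expectation ?U"
      using max(1) p_int by (simp add: prob_space)
    moreover have "g H - 2 * p H x \<le> ?L x" using finite max(1) by (auto intro!: Max_ge)
    ultimately show ?thesis unfolding max(2) by argo
  qed
  then have "(\<integral>x. (MAX H\<in>F. g H + (expectation (p H) - p H x)) \<partial>M) \<le>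
      (\<integral>x. (expectation ?U + ?L x) / 2 \<partial>M)"
    using finite p_int int by (intro integral_mono integrable_Max) auto
  also have "\<dots> = (\<integral>x. (?U x + ?L x) / 2 \<partial>M)" using int by (simp add: prob_space)
  finally show ?thesis .
qed

lemma integral_Max_symmetrize_contract:
  fixes f :: "'i \<Rightarrow> 'a \<Rightarrow> real" and \<psi> :: "real \<Rightarrow> real"
  assumes finite: "finite F" "F \<noteq> {}"
    and f_int: "\<And>H. H \<in> F \<Longrightarrow> integrable M (f H)" and \<psi>f: "\<And>H. H \<in> F \<Longrightarrow> integrable M (\<lambda>x. \<psi> (f H x))"
    and lip: "\<And>s t. \<bar>\<psi> s - \<psi> t\<bar> \<le> \<bar>s - t\<bar>"
  shows "(\<integral>x. (MAX H\<in>F. g H + ((\<integral>x. \<psi> (f H x) \<partial>M) - \<psi> (f H x))) \<partial>M) \<le>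
    (\<integral>z. (MAX H\<in>F. g H + 2 * (snd z * f H (fst z))) \<partial>signed M)"
proof -
  have int: "integrable M (\<lambda>x. MAX H\<in>F. g H + 2 * p H x)"
      "integrable M (\<lambda>x. MAX H\<in>F. g H - 2 * p H x)"
    if "\<And>H. H \<in> F \<Longrightarrow> integrable M (p H)" for p
    using finite that by (auto intro!: integrable_Max)
  have "(\<integral>x. (MAX H\<in>F. g H + ((\<integral>x. \<psi> (f H x) \<partial>M) - \<psi> (f H x))) \<partial>M) \<le>
      (\<integral>x. ((MAX H\<in>F. g H + 2 * \<psi> (f H x)) + (MAX H\<in>F. g H - 2 * \<psi> (f H x))) / 2 \<partial>M)"
    by (rule integral_Max_symmetrize[OF finite \<psi>f])
  also have "\<dots> \<le> (\<integral>x. ((MAX H\<in>F. g H + 2 * f H x) + (MAX H\<in>F. g H - 2 * f H x)) / 2 \<partial>M)"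
  proof (rule integral_mono)
    fix x
    have "\<bar>2 * \<psi> s - 2 * \<psi> t\<bar> \<le> \<bar>2 * s - 2 * t\<bar>" for s t using lip[of s t] by linarith
    then show "((MAX H\<in>F. g H + 2 * \<psi> (f H x)) + (MAX H\<in>F. g H - 2 * \<psi> (f H x))) / 2 \<le>
        ((MAX H\<in>F. g H + 2 * f H x) + (MAX H\<in>F. g H - 2 * f H x)) / 2"
      by (intro divide_right_mono Max_contraction finite) simp_all
  qed (use int[OF f_int] int[OF \<psi>f] in auto)
  also have "\<dots> = (\<integral>z. (MAX H\<in>F. g H + 2 * (snd z * f H (fst z))) \<partial>signed M)"
  proof (subst integral_signed[OF prob_space_axioms])
    interpret S: prob_space "signed M" by (rule prob_space_signed)
    show "integrable (signed M) (\<lambda>z. MAX H\<in>F. g H + 2 * (snd z * f H (fst z)))"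
      using f_int integrable_signed_product[OF prob_space_axioms]
      by (intro integrable_Max finite) auto
  qed simp
  finally show ?thesis .
qed

lemma expected_Max_deviation_le:
  fixes f :: "'i \<Rightarrow> 'a \<Rightarrow> real" and \<psi> :: "real \<Rightarrow> real"
  assumes finite: "finite F" "F \<noteq> {}"
    and f_int: "\<And>H. H \<in> F \<Longrightarrow> integrable M (f H)" and \<psi>f: "\<And>H. H \<in> F \<Longrightarrow> integrable M (\<lambda>x. \<psi> (f H x))"
    and lip: "\<And>s t. \<bar>\<psi> s - \<psi> t\<bar> \<le> \<bar>s - t\<bar>"
  shows "(\<integral>w. (MAX H\<in>F. \<Sum>i<m. (\<integral>x. \<psi> (f H x) \<partial>M) - \<psi> (f H (w i))) \<partial>iid M m) \<le>
    2 * rademacher_complexity M m f F"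
proof -
  have "(\<integral>w. (MAX H\<in>F. 0 + (\<Sum>i<m. (\<integral>x. \<psi> (f H x) \<partial>M) - \<psi> (f H (w i)))) \<partial>iid M m) \<le>
      (\<integral>w. (MAX H\<in>F. 0 + (\<Sum>i<m. 2 * (snd (w i) * f H (fst (w i))))) \<partial>iid (signed M) m)"
  proof (rule integral_Max_iid_sum_mono[OF prob_space_axioms prob_space_signed finite])
    show "(\<integral>x. (MAX H\<in>F. g H + ((\<integral>x. \<psi> (f H x) \<partial>M) - \<psi> (f H x))) \<partial>M) \<le>
        (\<integral>z. (MAX H\<in>F. g H + 2 * (snd z * f H (fst z))) \<partial>signed M)" for g
      by (rule integral_Max_symmetrize_contract[OF finite f_int \<psi>f lip])
  qed (use f_int \<psi>f integrable_signed_product[OF prob_space_axioms] in auto)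
  moreover have "mono (\<lambda>x::real. 2 * x)" by (simp add: mono_def)
  from mono_Max_commute[OF this] finite
  have "(MAX H\<in>F. \<Sum>i<m. 2 * (snd (w i) * f H (fst (w i)))) =
      2 * (MAX H\<in>F. \<Sum>i<m. snd (w i) * f H (fst (w i)))" for w
    by (simp add: image_image sum_distrib_left)
  ultimately show ?thesis by (simp add: rademacher_complexity_def)
qed

lemma bounded_differences_Max_sum:
  assumes finite: "finite F" "F \<noteq> {}" and diff: "\<And>H y z. H \<in> F \<Longrightarrow> a H y - a H z \<le> c"
  shows "bounded_differences m c (\<lambda>w. MAX H\<in>F. \<Sum>i<m. a H (w i))"
  unfolding bounded_differences_def
proof (intro ballI allI impI)
  fix w i y z assume "i < m"
  have upd: "(\<Sum>j<m. a H ((w(i := u)) j)) = a H u + (\<Sum>j\<in>{..<m} - {i}. a H (w j))" for H u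
    using \<open>i < m\<close> by (subst sum.remove[of _ i]) (auto intro!: sum.cong)
  obtain H where max: "H \<in> F"
    "(MAX H\<in>F. \<Sum>j<m. a H ((w(i := y)) j)) = (\<Sum>j<m. a H ((w(i := y)) j))"
    by (rule obtains_MAX[OF finite])
  have "(\<Sum>j<m. a H ((w(i := z)) j)) \<le> (MAX H\<in>F. \<Sum>j<m. a H ((w(i := z)) j))"
    using finite max(1) by (intro Max_ge) auto
  moreover have "(\<Sum>j<m. a H ((w(i := y)) j)) - (\<Sum>j<m. a H ((w(i := z)) j)) \<le> c"
    unfolding upd using diff[OF max(1)] by simp
  ultimately show "(MAX H\<in>F. \<Sum>j<m. a H ((w(i := y)) j)) - (MAX H\<in>F. \<Sum>j<m. a H ((w(i := z)) j)) \<le> c"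
    unfolding max(2) by linarith
qed

lemma prob_iid_sums_le_Max_ge:
  fixes a :: "'i \<Rightarrow> 'a \<Rightarrow> real"
  assumes finite: "finite F" "F \<noteq> {}" and int: "\<And>H. H \<in> F \<Longrightarrow> integrable M (a H)"
    and bound: "\<And>H x. H \<in> F \<Longrightarrow> \<bar>a H x\<bar> \<le> c" and diff: "\<And>H y z. H \<in> F \<Longrightarrow> a H y - a H z \<le> c"
    and "0 < c" "0 < t"
  shows "1 - exp (- 2 * t\<^sup>2 * real m / c\<^sup>2) \<le> measure (iid M m) {w \<in> space (iid M m).
    \<forall>H\<in>F. (\<Sum>i<m. a H (w i)) \<le> (\<integral>w. (MAX H\<in>F. \<Sum>i<m. a H (w i)) \<partial>iid M m) + t * real m}"
    (is "_ \<le> measure _ ?good")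
proof -
  interpret P: prob_space "iid M m" by (rule prob_space_iid)
  define Z where "Z = (\<lambda>w. MAX H\<in>F. \<Sum>i<m. a H (w i))"
  let ?bad = "{w \<in> space (iid M m). (\<integral>w. Z w \<partial>iid M m) + t * real m \<le> Z w}"
  have sum_int: "integrable (iid M m) (\<lambda>w. \<Sum>i<m. a H (w i))" if "H \<in> F" for H
    using int[OF that] by (rule integrable_iid_sum) simp
  then have Z_int: "integrable (iid M m) Z" unfolding Z_def by (intro integrable_Max finite)
  have "\<bar>Z w\<bar> \<le> real m * c" for w
  proof -
    obtain H where max: "H \<in> F" "Z w = (\<Sum>i<m. a H (w i))"
      unfolding Z_def by (rule obtains_MAX[OF finite])
    have "\<bar>\<Sum>i<m. a H (w i)\<bar> \<le> (\<Sum>i<m. c)"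
      using bound[OF max(1)] by (intro order_trans[OF sum_abs sum_mono])
    then show ?thesis by (simp add: max(2))
  qed
  then have "P.prob ?bad \<le> exp (- 2 * t\<^sup>2 * real m / c\<^sup>2)"
    using Z_int \<open>0 < c\<close> \<open>0 < t\<close> diff
    by (intro McDiarmid[where K = "real m * c"]) (auto simp: Z_def
        intro!: bounded_differences_Max_sum finite)
  moreover have "?bad \<in> P.events" using borel_measurable_integrable[OF Z_int] by measurable
  ultimately have "1 - exp (- 2 * t\<^sup>2 * real m / c\<^sup>2) \<le> P.prob (space (iid M m) - ?bad)"
    by (simp add: P.prob_compl)
  also have "\<dots> \<le> P.prob ?good"
  proof (rule P.finite_measure_mono)
    have "(\<Sum>i<m. a H (w i)) \<le> Z w" if "H \<in> F" for H w
      unfolding Z_def using finite that by (intro Max_ge) auto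
    then have "(\<Sum>i<m. a H (w i)) \<le> (\<integral>w. Z w \<partial>iid M m) + t * real m"
      if "H \<in> F" "Z w < (\<integral>w. Z w \<partial>iid M m) + t * real m" for H w
      using that by (meson le_less_trans less_imp_le)
    then show "space (iid M m) - ?bad \<subseteq> ?good" unfolding Z_def[symmetric] by (auto simp: not_le)
    show "?good \<in> P.events"
      using finite sum_int by (intro sets.sets_Collect_finite_All borel_measurable_le) auto
  qed
  finally show ?thesis .
qed

theorem uniform_lower_deviation:
  fixes f :: "'i \<Rightarrow> 'a \<Rightarrow> real" and \<psi> :: "real \<Rightarrow> real"
  assumes finite: "finite F" "F \<noteq> {}" and f_int: "\<And>H. H \<in> F \<Longrightarrow> integrable M (f H)"
    and lip: "\<And>s t. \<bar>\<psi> s - \<psi> t\<bar> \<le> \<bar>s - t\<bar>"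
    and range: "\<And>t. \<psi> t \<in> {0..b}" and \<psi>_measurable: "\<psi> \<in> borel_measurable borel"
    and "0 < b" "0 < t"
  shows "1 - exp (- 2 * t\<^sup>2 * real m / b\<^sup>2) \<le> measure (iid M m) {w \<in> space (iid M m).
    \<forall>H\<in>F. real m * (\<integral>x. \<psi> (f H x) \<partial>M) - 2 * rademacher_complexity M m f F - t * real m \<le>
        (\<Sum>i<m. \<psi> (f H (w i)))}"
    (is "_ \<le> measure _ ?good")
proof -
  interpret P: prob_space "iid M m" by (rule prob_space_iid)
  define a where "a = (\<lambda>H x. (\<integral>x. \<psi> (f H x) \<partial>M) - \<psi> (f H x))"
  have \<psi>f_int: "integrable M (\<lambda>x. \<psi> (f H x))" if "H \<in> F" for H
    using range \<psi>_measurable f_int[OF that]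
    by (intro integrable_const_bound[of _ b]) (auto intro: measurable_compose)
  have bound: "\<bar>a H x\<bar> \<le> b" if "H \<in> F" for H x
  proof -
    have "(\<integral>x. \<psi> (f H x) \<partial>M) \<in> {0..b}"
      using integral_ge_const[OF \<psi>f_int[OF that], of 0] integral_le_const[OF \<psi>f_int[OF that], of b]
        range by simp
    then show ?thesis using range[of "f H x"] by (simp add: a_def abs_le_iff)
  qed
  have diff: "a H y - a H z \<le> b" for H y z
    using range[of "f H y"] range[of "f H z"] by (simp add: a_def)
  have mean: "(\<integral>w. (MAX H\<in>F. \<Sum>i<m. a H (w i)) \<partial>iid M m) \<le> 2 * rademacher_complexity M m f F"
    unfolding a_def by (intro expected_Max_deviation_le finite f_int \<psi>f_int lip)
  have "1 - exp (- 2 * t\<^sup>2 * real m / b\<^sup>2) \<le> P.prob {w \<in> space (iid M m).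
      \<forall>H\<in>F. (\<Sum>i<m. a H (w i)) \<le> (\<integral>w. (MAX H\<in>F. \<Sum>i<m. a H (w i)) \<partial>iid M m) + t * real m}"
    by (rule prob_iid_sums_le_Max_ge[OF finite _ bound diff \<open>0 < b\<close> \<open>0 < t\<close>])
      (use \<psi>f_int in \<open>simp add: a_def\<close>)
  also have "\<dots> \<le> P.prob ?good"
  proof (rule P.finite_measure_mono)
    have "(\<Sum>i<m. a H (w i)) = real m * (\<integral>x. \<psi> (f H x) \<partial>M) - (\<Sum>i<m. \<psi> (f H (w i)))" for H w
      by (simp add: a_def sum_subtractf)
    with mean show "{w \<in> space (iid M m). \<forall>H\<in>F. (\<Sum>i<m. a H (w i)) \<le>
        (\<integral>w. (MAX H\<in>F. \<Sum>i<m. a H (w i)) \<partial>iid M m) + t * real m} \<subseteq> ?good"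
      by fastforce
    have "integrable (iid M m) (\<lambda>w. \<Sum>i<m. \<psi> (f H (w i)))" if "H \<in> F" for H
      using \<psi>f_int[OF that] by (rule integrable_iid_sum) simp
    then show "?good \<in> P.events"
      using finite by (intro sets.sets_Collect_finite_All borel_measurable_le) auto
  qed
  finally show ?thesis .
qed

end

section \<open>Random variables with finite moments\<close>

definition finite_moments :: "'a measure \<Rightarrow> ('a \<Rightarrow> real) \<Rightarrow> bool" where
  "finite_moments M f \<longleftrightarrow> f \<in> borel_measurable M \<and> (\<forall>k. integrable M (\<lambda>x. f x ^ k))"

lemma finite_moments_measurable: "finite_moments M f \<Longrightarrow> f \<in> borel_measurable M"
  by (simp add: finite_moments_def)

lemma finite_moments_integrable_power: "finite_moments M f \<Longrightarrow> integrable M (\<lambda>x. f x ^ k)"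
  by (simp add: finite_moments_def)

lemma finite_moments_integrable: "finite_moments M f \<Longrightarrow> integrable M f"
  using finite_moments_integrable_power[of M f 1] by simp

lemma finite_moments_add:
  assumes f_moments: "finite_moments M f" and g_moments: "finite_moments M g"
  shows "finite_moments M (\<lambda>x. f x + g x)"
  unfolding finite_moments_def
proof (intro conjI allI)
  note [measurable] = f_moments[THEN finite_moments_measurable]
    g_moments[THEN finite_moments_measurable]
  show "(\<lambda>x. f x + g x) \<in> borel_measurable M" by measurable
  fix k
  show "integrable M (\<lambda>x. (f x + g x) ^ k)"
  proof (rule Bochner_Integration.integrable_bound)
    show "integrable M (\<lambda>x. 2 ^ k * (\<bar>f x ^ k\<bar> + \<bar>g x ^ k\<bar>))"
      using f_moments g_moments by (simp add: finite_moments_def)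
    have "\<bar>(f x + g x) ^ k\<bar> \<le> 2 ^ k * (\<bar>f x ^ k\<bar> + \<bar>g x ^ k\<bar>)" for x
    proof -
      have "\<bar>f x + g x\<bar> ^ k \<le> (2 * max \<bar>f x\<bar> \<bar>g x\<bar>) ^ k" by (intro power_mono) auto
      also have "\<dots> \<le> 2 ^ k * (\<bar>f x\<bar> ^ k + \<bar>g x\<bar> ^ k)"
        by (auto simp: power_mult_distrib max_def)
      finally show ?thesis by (simp add: power_abs)
    qed
    then show "AE x in M. norm ((f x + g x) ^ k) \<le> norm (2 ^ k * (\<bar>f x ^ k\<bar> + \<bar>g x ^ k\<bar>))" by simp
  qed measurable
qed

lemma finite_moments_mult:
  assumes f_moments: "finite_moments M f" and g_moments: "finite_moments M g"
  shows "finite_moments M (\<lambda>x. f x * g x)"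
  unfolding finite_moments_def
proof (intro conjI allI)
  note [measurable] = f_moments[THEN finite_moments_measurable]
    g_moments[THEN finite_moments_measurable]
  show "(\<lambda>x. f x * g x) \<in> borel_measurable M" by measurable
  fix k
  show "integrable M (\<lambda>x. (f x * g x) ^ k)"
  proof (rule Bochner_Integration.integrable_bound)
    show "integrable M (\<lambda>x. f x ^ (2 * k) + g x ^ (2 * k))"
      using f_moments g_moments by (simp add: finite_moments_def)
    have "\<bar>(f x * g x) ^ k\<bar> \<le> f x ^ (2 * k) + g x ^ (2 * k)" for x
    proof -
      have "0 \<le> \<bar>f x ^ k\<bar> * \<bar>g x ^ k\<bar>" by simp
      then have "\<bar>f x ^ k\<bar> * \<bar>g x ^ k\<bar> \<le> (f x ^ k)\<^sup>2 + (g x ^ k)\<^sup>2"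
        using sum_squares_bound[of "\<bar>f x ^ k\<bar>" "\<bar>g x ^ k\<bar>"] unfolding power2_abs by linarith
      then show ?thesis by (simp add: power_mult_distrib abs_mult power_even_eq)
    qed
    then show "AE x in M. norm ((f x * g x) ^ k) \<le> norm (f x ^ (2 * k) + g x ^ (2 * k))"
      by (intro AE_I2) (smt (verit) real_norm_def)
  qed measurable
qed

context prob_space
begin

lemma finite_moments_const: "finite_moments M (\<lambda>_. c)"
  by (simp add: finite_moments_def)

lemma finite_moments_diff:
  assumes "finite_moments M f" "finite_moments M g"
  shows "finite_moments M (\<lambda>x. f x - g x)"
  using finite_moments_add[OF assms(1) finite_moments_mult[OF finite_moments_const[of "-1"] assms(2)]]
  by simp

lemma finite_moments_power:
  assumes "finite_moments M f"
  shows "finite_moments M (\<lambda>x. f x ^ k)"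
  by (induction k) (simp_all add: finite_moments_const finite_moments_mult assms)

lemma finite_moments_sum:
  assumes "\<And>i. i \<in> I \<Longrightarrow> finite_moments M (f i)"
  shows "finite_moments M (\<lambda>x. \<Sum>i\<in>I. f i x)"
  using assms
  by (induction I rule: infinite_finite_induct)
     (simp_all add: finite_moments_const finite_moments_add)

lemmas finite_moments_intros =
  finite_moments_const finite_moments_add finite_moments_diff finite_moments_mult
  finite_moments_power finite_moments_sum

lemma finite_moments_iid_component:
  assumes "finite_moments M h" "i < m"
  shows "finite_moments (iid M m) (\<lambda>w. h (w i))"
  using assms integrable_iid_component[of "\<lambda>x. h x ^ _"]
  by (auto simp: finite_moments_def intro!: measurable_compose[OF measurable_component_singleton])

end

section \<open>Sub-Gaussian random variables\<close>

lemma exp_le_add_exp_square: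
  fixes y :: real
  shows "exp y \<le> y + exp (y\<^sup>2)"
proof -
  have square: "1 + y\<^sup>2 \<le> exp (y\<^sup>2)" by (rule exp_ge_add_one_self)
  consider (nonpos) "y \<le> 0" | (unit) "0 \<le> y" "y \<le> 1" | (large) "1 < y" by linarith
  then show ?thesis
  proof cases
    case nonpos
    obtain t where "exp y = (\<Sum>m<3. y ^ m / fact m) + exp t / fact 3 * y ^ 3"
      using Maclaurin_exp_le[of y 3] by blast
    moreover have "exp t / fact 3 * y ^ 3 \<le> 0"
      using nonpos by (intro mult_nonneg_nonpos) (auto simp: power3_eq_cube mult_nonneg_nonpos)
    ultimately have "exp y \<le> 1 + y + y\<^sup>2 / 2" by (simp add: numeral_3_eq_3 power2_eq_square)
    then show ?thesis using square zero_le_power2[of y] by linarith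
  next
    case unit
    then show ?thesis using exp_bound[of y] square by linarith
  next
    case large
    then have "exp y \<le> exp (y\<^sup>2)" by (simp add: power2_eq_square)
    then show ?thesis using large by linarith
  qed
qed

lemma exp_mult_le_interpolate:
  fixes u \<theta> :: real
  assumes "0 \<le> \<theta>" "\<theta> \<le> 1"
  shows "exp (\<theta> * u) \<le> 1 - \<theta> + \<theta> * exp u"
  using convex_onD[OF convex_on_exp[of 1], of \<theta> 0 u] assms by simp

lemma power_le_fact_exp:
  fixes z :: real
  assumes "0 \<le> z"
  shows "z ^ k \<le> fact k * exp z"
proof -
  have "(\<Sum>n\<in>{k}. z ^ n /\<^sub>R fact n) \<le> (\<Sum>n. z ^ n /\<^sub>R fact n)"
    using assms by (intro sum_le_suminf summable_exp_generic) auto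
  then have "z ^ k / fact k \<le> exp z" by (simp add: exp_def divide_inverse mult.commute)
  then show ?thesis by (simp add: field_simps)
qed

lemma cosh_le_quadratic_exp:
  fixes s s1 z :: real
  assumes "0 < s1" "\<bar>s\<bar> \<le> s1 / 2" "0 \<le> z"
  shows "(exp (s * z) + exp (- s * z)) / 2 \<le> 1 + 4 * (s / s1)\<^sup>2 * exp (s1 * z)"
proof -
  have taylor: "exp x \<le> 1 + x + x\<^sup>2 / 2 * exp \<bar>x\<bar>" for x :: real
  proof -
    obtain t where remainder: "\<bar>t\<bar> \<le> \<bar>x\<bar>" "exp x = (\<Sum>m<2. x ^ m / fact m) + exp t / fact 2 * x\<^sup>2"
      using Maclaurin_exp_le[of x 2] by blast
    have "exp t * x\<^sup>2 \<le> exp \<bar>x\<bar> * x\<^sup>2" using remainder(1) by (intro mult_right_mono) auto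
    then show ?thesis unfolding remainder(2) by (simp add: numeral_2_eq_2 algebra_simps)
  qed
  define w where "w = s1 * z"
  have w_nonneg: "0 \<le> w" using assms by (simp add: w_def)
  have sz_small: "\<bar>s * z\<bar> \<le> w / 2"
    using assms mult_right_mono[OF assms(2,3)] by (simp add: w_def abs_mult)
  have "(exp (s * z) + exp (- s * z)) / 2 \<le> 1 + (s * z)\<^sup>2 / 2 * exp \<bar>s * z\<bar>"
    using taylor[of "s * z"] taylor[of "- (s * z)"] by simp
  also have "\<dots> \<le> 1 + (s * z)\<^sup>2 / 2 * exp (w / 2)"
    using sz_small by (intro add_left_mono mult_left_mono) auto
  also have "(s * z)\<^sup>2 / 2 = 4 * (s / s1)\<^sup>2 * ((w / 2)\<^sup>2 / 2)"
    using assms by (simp add: w_def field_simps power2_eq_square)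
  also have "1 + 4 * (s / s1)\<^sup>2 * ((w / 2)\<^sup>2 / 2) * exp (w / 2) \<le>
      1 + 4 * (s / s1)\<^sup>2 * exp (w / 2) * exp (w / 2)"
    using exp_lower_Taylor_quadratic[of "w / 2"] w_nonneg
    by (intro add_left_mono mult_right_mono mult_left_mono) auto
  also have "\<dots> = 1 + 4 * (s / s1)\<^sup>2 * exp (s1 * z)"
    by (simp add: w_def mult.assoc exp_add[symmetric])
  finally show ?thesis .
qed

lemma nn_integral_normal_density: "0 < \<sigma> \<Longrightarrow> (\<integral>\<^sup>+g. ennreal (normal_density \<mu> \<sigma> g) \<partial>lborel) = 1"
  by (subst nn_integral_eq_integral) auto

lemma nn_integral_std_normal_exp_linear:
  "(\<integral>\<^sup>+g. ennreal (std_normal_density g * exp (t * g)) \<partial>lborel) = ennreal (exp (t\<^sup>2 / 2))"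
proof -
  have "std_normal_density g * exp (t * g) = exp (t\<^sup>2 / 2) * normal_density t 1 g" for g
    by (simp add: normal_density_def exp_add[symmetric] power2_diff field_simps)
  then show ?thesis by (simp add: ennreal_mult nn_integral_cmult nn_integral_normal_density)
qed

lemma nn_integral_std_normal_exp_square:
  "(\<integral>\<^sup>+g. ennreal (std_normal_density g * exp (g\<^sup>2 / 4)) \<partial>lborel) = ennreal (sqrt 2)"
proof -
  have "std_normal_density g * exp (g\<^sup>2 / 4) = sqrt 2 * normal_density 0 (sqrt 2) g" for g
    by (simp add: normal_density_def exp_add[symmetric] real_sqrt_mult field_simps)
  then show ?thesis by (simp add: ennreal_mult nn_integral_cmult nn_integral_normal_density)
qed

context prob_space
begin

text \<open>Linearise the square: \<open>exp (s V\<^sup>2)\<close> is the expectation of \<open>exp (sqrt (2 s) V g)\<close> over an independent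
  standard normal \<open>g\<close>.\<close>
lemma subgaussian_exp_square:
  fixes V :: "'a \<Rightarrow> real"
  assumes [measurable]: "V \<in> borel_measurable M"
    and mgf: "\<And>t. (\<integral>\<^sup>+x. ennreal (exp (t * V x)) \<partial>M) \<le> ennreal (exp (t\<^sup>2 * \<tau>))"
    and s_bounds: "0 \<le> s" "8 * s * \<tau> \<le> 1"
  shows "(\<integral>\<^sup>+x. ennreal (exp (s * (V x)\<^sup>2)) \<partial>M) \<le> ennreal (sqrt 2)"
proof -
  interpret pair_sigma_finite M lborel ..
  let ?N = "\<lambda>g. ennreal (std_normal_density g)" and ?r = "sqrt (2 * s)"
  have "(\<integral>\<^sup>+x. ennreal (exp (s * (V x)\<^sup>2)) \<partial>M) =
      (\<integral>\<^sup>+x. \<integral>\<^sup>+g. ?N g * ennreal (exp (?r * V x * g)) \<partial>lborel \<partial>M)"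
    using nn_integral_std_normal_exp_linear[of "?r * V _"] s_bounds
    by (simp add: ennreal_mult power_mult_distrib)
  also have "\<dots> = (\<integral>\<^sup>+g. \<integral>\<^sup>+x. ?N g * ennreal (exp ((?r * g) * V x)) \<partial>M \<partial>lborel)"
    by (subst Fubini'[symmetric]) (simp_all add: mult_ac)
  also have "\<dots> = (\<integral>\<^sup>+g. ?N g * (\<integral>\<^sup>+x. ennreal (exp ((?r * g) * V x)) \<partial>M) \<partial>lborel)"
    by (intro nn_integral_cong nn_integral_cmult) measurable
  also have "\<dots> \<le> (\<integral>\<^sup>+g. ennreal (std_normal_density g * exp (g\<^sup>2 / 4)) \<partial>lborel)"
  proof (intro nn_integral_mono)
    fix g
    have "(?r * g)\<^sup>2 * \<tau> = g\<^sup>2 / 4 * (8 * s * \<tau>)" using s_bounds by (simp add: power_mult_distrib)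
    also have "\<dots> \<le> g\<^sup>2 / 4 * 1" using s_bounds by (intro mult_left_mono) auto
    finally have "(\<integral>\<^sup>+x. ennreal (exp ((?r * g) * V x)) \<partial>M) \<le> ennreal (exp (g\<^sup>2 / 4))"
      by (intro order_trans[OF mgf]) (simp add: ennreal_leI)
    then show "?N g * (\<integral>\<^sup>+x. ennreal (exp ((?r * g) * V x)) \<partial>M) \<le>
        ennreal (std_normal_density g * exp (g\<^sup>2 / 4))"
      by (simp add: ennreal_mult mult_left_mono)
  qed
  finally show ?thesis by (simp only: nn_integral_std_normal_exp_square)
qed

lemma subgaussian_fourth_moment:
  fixes V :: "'a \<Rightarrow> real"
  assumes V_measurable [measurable]: "V \<in> borel_measurable M"
    and mgf: "\<And>t. (\<integral>\<^sup>+x. ennreal (exp (t * V x)) \<partial>M) \<le> ennreal (exp (t\<^sup>2 * \<tau>))" and "0 < \<tau>"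
  shows "(\<integral>\<^sup>+x. ennreal (V x ^ 4) \<partial>M) \<le> ennreal (256 * \<tau>\<^sup>2)"
proof -
  define s where "s = 1 / (8 * \<tau>)"
  have s_bounds: "0 \<le> s" "8 * s * \<tau> \<le> 1" using \<open>0 < \<tau>\<close> by (simp_all add: s_def)
  have "V x ^ 4 \<le> 128 * \<tau>\<^sup>2 * exp (s * (V x)\<^sup>2)" for x
    using power_le_fact_exp[of "s * (V x)\<^sup>2" 2] \<open>0 < \<tau>\<close>
    by (simp add: s_def power_divide field_simps fact_numeral)
  then have "(\<integral>\<^sup>+x. ennreal (V x ^ 4) \<partial>M) \<le>
      (\<integral>\<^sup>+x. ennreal (128 * \<tau>\<^sup>2) * ennreal (exp (s * (V x)\<^sup>2)) \<partial>M)"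
    by (intro nn_integral_mono) (simp add: ennreal_mult[symmetric] ennreal_leI)
  also have "\<dots> = ennreal (128 * \<tau>\<^sup>2) * (\<integral>\<^sup>+x. ennreal (exp (s * (V x)\<^sup>2)) \<partial>M)"
    by (intro nn_integral_cmult) measurable
  also have "\<dots> \<le> ennreal (128 * \<tau>\<^sup>2) * ennreal 2"
    using subgaussian_exp_square[OF V_measurable mgf s_bounds] sqrt2_less_2
    by (intro mult_left_mono order_trans[OF subgaussian_exp_square[OF V_measurable mgf s_bounds]]
        ennreal_leI) auto
  also have "\<dots> = ennreal (256 * \<tau>\<^sup>2)" by (subst ennreal_mult[symmetric]) auto
  finally show ?thesis .
qed

end

locale centred_subgaussian = prob_space D for D :: "real measure" +
  fixes K :: real
  assumes sets_eq_borel [measurable_cong]: "sets D = sets borel"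
    and K_pos: "0 < K" and psi2_norm_le: "(\<integral>\<^sup>+x. ennreal (exp (x\<^sup>2 / K\<^sup>2)) \<partial>D) \<le> 2"
    and mean_zero: "expectation (\<lambda>x. x) = 0"
begin

lemma integrable_exp_square: "integrable D (\<lambda>x. exp (x\<^sup>2 / K\<^sup>2))"
  using psi2_norm_le by (intro integrableI_nonneg) (auto simp: le_less_trans)

lemma expectation_exp_square_le: "expectation (\<lambda>x. exp (x\<^sup>2 / K\<^sup>2)) \<le> 2"
proof -
  have "ennreal (expectation (\<lambda>x. exp (x\<^sup>2 / K\<^sup>2))) \<le> ennreal 2"
    using psi2_norm_le
    by (subst nn_integral_eq_integral[symmetric]) (auto simp: integrable_exp_square)
  then show ?thesis by (subst (asm) ennreal_le_iff) simp_all
qed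

lemma finite_moments_id: "finite_moments D (\<lambda>x. x)"
  unfolding finite_moments_def
proof (intro conjI allI)
  fix k
  show "integrable D (\<lambda>x. x ^ k)"
  proof (rule Bochner_Integration.integrable_bound)
    show "integrable D (\<lambda>x. 1 + K ^ (2 * k) * fact k * exp (x\<^sup>2 / K\<^sup>2))"
      using integrable_exp_square by simp
    have "\<bar>x ^ k\<bar> \<le> 1 + K ^ (2 * k) * fact k * exp (x\<^sup>2 / K\<^sup>2)" for x
    proof -
      have "\<bar>x ^ k\<bar> \<le> 1 + (x ^ k)\<^sup>2" using sum_squares_bound[of 1 "\<bar>x ^ k\<bar>"] by simp
      also have "(x ^ k)\<^sup>2 = K ^ (2 * k) * (x\<^sup>2 / K\<^sup>2) ^ k"
        using K_pos by (simp add: power_divide power_mult[symmetric] mult.commute)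
      also have "\<dots> \<le> K ^ (2 * k) * (fact k * exp (x\<^sup>2 / K\<^sup>2))"
        using K_pos by (intro mult_left_mono power_le_fact_exp) auto
      finally show ?thesis by (simp add: mult.assoc)
    qed
    then show "AE x in D. norm (x ^ k) \<le> norm (1 + K ^ (2 * k) * fact k * exp (x\<^sup>2 / K\<^sup>2))"
      by (intro AE_I2) (smt (verit) real_norm_def)
  qed measurable
qed measurable

lemma nn_integral_exp_le_of_majorant:
  assumes "integrable D h" "\<And>x. exp (t * x) \<le> h x" "expectation h \<le> B"
  shows "(\<integral>\<^sup>+x. ennreal (exp (t * x)) \<partial>D) \<le> ennreal B"
proof -
  have "(\<integral>\<^sup>+x. ennreal (exp (t * x)) \<partial>D) \<le> (\<integral>\<^sup>+x. ennreal (h x) \<partial>D)"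
    using assms by (intro nn_integral_mono ennreal_leI) auto
  also have "\<dots> = ennreal (expectation h)"
    using assms by (intro nn_integral_eq_integral AE_I2) (auto intro: order_trans[OF exp_ge_zero])
  also have "\<dots> \<le> ennreal B" using assms by (intro ennreal_leI)
  finally show ?thesis .
qed

lemma mgf_le_small:
  assumes "t\<^sup>2 * K\<^sup>2 \<le> 1"
  shows "(\<integral>\<^sup>+x. ennreal (exp (t * x)) \<partial>D) \<le> ennreal (exp (t\<^sup>2 * K\<^sup>2))"
proof -
  define \<theta> where "\<theta> = t\<^sup>2 * K\<^sup>2"
  let ?h = "\<lambda>x. t * x + (1 - \<theta>) + \<theta> * exp (x\<^sup>2 / K\<^sup>2)"
  have \<theta>_bounds: "0 \<le> \<theta>" "\<theta> \<le> 1" using assms by (simp_all add: \<theta>_def)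
  have id: "integrable D (\<lambda>x. x)" by (rule finite_moments_integrable[OF finite_moments_id])
  show ?thesis
  proof (rule nn_integral_exp_le_of_majorant)
    show "integrable D ?h" using id integrable_exp_square by simp
    have "(t * x)\<^sup>2 = \<theta> * (x\<^sup>2 / K\<^sup>2)" for x
      using K_pos by (simp add: \<theta>_def field_simps power_mult_distrib)
    then show "exp (t * x) \<le> ?h x" for x
      using exp_le_add_exp_square[of "t * x"] exp_mult_le_interpolate[OF \<theta>_bounds, of "x\<^sup>2 / K\<^sup>2"]
      by simp
    have "expectation ?h = 1 - \<theta> + \<theta> * expectation (\<lambda>x. exp (x\<^sup>2 / K\<^sup>2))"
      using id integrable_exp_square by (simp add: prob_space mean_zero)
    also have "\<dots> \<le> 1 - \<theta> + \<theta> * 2"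
      using expectation_exp_square_le \<theta>_bounds by (intro add_left_mono mult_left_mono) auto
    also have "\<dots> \<le> exp \<theta>" using exp_ge_add_one_self[of \<theta>] by linarith
    finally show "expectation ?h \<le> exp (t\<^sup>2 * K\<^sup>2)" by (simp add: \<theta>_def)
  qed
qed

lemma mgf_le_large:
  assumes "1 \<le> t\<^sup>2 * K\<^sup>2"
  shows "(\<integral>\<^sup>+x. ennreal (exp (t * x)) \<partial>D) \<le> ennreal (exp (t\<^sup>2 * K\<^sup>2))"
proof -
  define \<theta> where "\<theta> = t\<^sup>2 * K\<^sup>2"
  let ?h = "\<lambda>x. exp (\<theta> / 2) * (1 / 2 + 1 / 2 * exp (x\<^sup>2 / K\<^sup>2))"
  show ?thesis
  proof (rule nn_integral_exp_le_of_majorant)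
    show "integrable D ?h" using integrable_exp_square by simp
    fix x
    have "2 * (t * x) \<le> \<theta> + x\<^sup>2 / K\<^sup>2"
      using sum_squares_bound[of "t * K" "x / K"] K_pos
      by (simp add: \<theta>_def power_mult_distrib power_divide)
    then have "exp (t * x) \<le> exp (\<theta> / 2 + 1 / 2 * (x\<^sup>2 / K\<^sup>2))" by simp
    also have "\<dots> \<le> ?h x"
      unfolding exp_add
      using exp_mult_le_interpolate[of "1 / 2" "x\<^sup>2 / K\<^sup>2"] by (intro mult_left_mono) auto
    finally show "exp (t * x) \<le> ?h x" .
  next
    have "1 / 2 + 1 / 2 * expectation (\<lambda>x. exp (x\<^sup>2 / K\<^sup>2)) \<le> exp (\<theta> / 2)"
      using expectation_exp_square_le assms exp_ge_add_one_self[of "\<theta> / 2"]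
      unfolding \<theta>_def by linarith
    then have "expectation ?h \<le> exp (\<theta> / 2) * exp (\<theta> / 2)"
      using integrable_exp_square by (simp add: prob_space)
    also have "\<dots> = exp \<theta>" by (simp add: exp_add[symmetric])
    finally show "expectation ?h \<le> exp (t\<^sup>2 * K\<^sup>2)" by (simp only: \<theta>_def)
  qed
qed

lemma mgf_le: "(\<integral>\<^sup>+x. ennreal (exp (t * x)) \<partial>D) \<le> ennreal (exp (t\<^sup>2 * K\<^sup>2))"
  using mgf_le_small mgf_le_large linear by blast

lemma finite_moments_dot_prefix:
  assumes "k \<le> n"
  shows "finite_moments (iid D n) (dot k u)"
proof -
  interpret P: prob_space "iid D n" by (rule prob_space_iid)
  show ?thesis
    unfolding dot_def[abs_def]
    using assms
    by (intro P.finite_moments_intros finite_moments_iid_component finite_moments_id) auto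
qed

lemmas finite_moments_dot = finite_moments_dot_prefix[OF order_refl]

lemma measurable_dot [measurable]: "dot n u \<in> borel_measurable (iid D n)"
  by (rule finite_moments_measurable[OF finite_moments_dot])

lemma dot_mgf_le: "(\<integral>\<^sup>+x. ennreal (exp (t * dot n u x)) \<partial>iid D n) \<le>
    ennreal (exp (t\<^sup>2 * (K\<^sup>2 * dot n u u)))"
proof -
  interpret product_sigma_finite "\<lambda>_. D" ..
  have "(\<integral>\<^sup>+x. ennreal (exp (t * dot n u x)) \<partial>iid D n) =
      (\<integral>\<^sup>+x. (\<Prod>i<n. ennreal (exp ((t * u i) * x i))) \<partial>iid D n)"
    by (intro nn_integral_cong)
       (simp add: prod_ennreal exp_sum[symmetric] dot_def sum_distrib_left mult.assoc)
  also have "\<dots> = (\<Prod>i<n. \<integral>\<^sup>+x. ennreal (exp ((t * u i) * x)) \<partial>D)"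
    by (intro product_nn_integral_prod) auto
  also have "\<dots> \<le> (\<Prod>i<n. ennreal (exp ((t * u i)\<^sup>2 * K\<^sup>2)))"
  proof -
    have prod_le: "(\<Prod>i<n. f i) \<le> (\<Prod>i<n. g i)" if "\<And>i. f i \<le> g i" for f g :: "nat \<Rightarrow> ennreal"
      by (induction n) (auto intro!: mult_mono that)
    show ?thesis by (rule prod_le) (rule mgf_le)
  qed
  also have "\<dots> = ennreal (exp (t\<^sup>2 * (K\<^sup>2 * dot n u u)))"
    by (simp add: prod_ennreal exp_sum[symmetric] dot_def sum_distrib_left power2_eq_square mult_ac)
  finally show ?thesis .
qed

lemma dot_exp_square_le:
  assumes "dot n u u \<le> 1"
  shows "(\<integral>\<^sup>+x. ennreal (exp (1 / (8 * K\<^sup>2) * (dot n u x)\<^sup>2)) \<partial>iid D n) \<le> ennreal 2"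
proof -
  interpret P: prob_space "iid D n" by (rule prob_space_iid)
  have "(\<integral>\<^sup>+x. ennreal (exp (1 / (8 * K\<^sup>2) * (dot n u x)\<^sup>2)) \<partial>iid D n) \<le> ennreal (sqrt 2)"
    using K_pos assms by (intro P.subgaussian_exp_square[OF measurable_dot dot_mgf_le]) auto
  also have "\<dots> \<le> ennreal 2" using sqrt2_less_2 by (intro ennreal_leI) simp
  finally show ?thesis .
qed

lemma expectation_dot_fourth_le: "(\<integral>x. dot n u x ^ 4 \<partial>iid D n) \<le> 256 * K ^ 4 * (dot n u u)\<^sup>2"
proof (cases "dot n u u = 0")
  case True
  then have "dot n u x = 0" for x by (simp add: dot_self_eq_0_iff) (simp add: dot_def)
  then show ?thesis by simp
next
  case False
  interpret P: prob_space "iid D n" by (rule prob_space_iid)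
  have "(\<integral>\<^sup>+x. ennreal (dot n u x ^ 4) \<partial>iid D n) \<le> ennreal (256 * (K\<^sup>2 * dot n u u)\<^sup>2)"
    using K_pos False
    by (intro P.subgaussian_fourth_moment[OF measurable_dot dot_mgf_le])
        (simp add: dot_self_pos_iff)
  then have "ennreal (\<integral>x. dot n u x ^ 4 \<partial>iid D n) \<le> ennreal (256 * (K\<^sup>2 * dot n u u)\<^sup>2)"
    by (subst nn_integral_eq_integral[symmetric])
       (auto intro: finite_moments_integrable_power[OF finite_moments_dot])
  then show ?thesis by (simp add: power_mult_distrib)
qed

end

section \<open>Signed Gram matrices\<close>

definition lattice_points :: "nat \<Rightarrow> (nat \<Rightarrow> int) set" where
  "lattice_points n =
    {z \<in> PiE {..<n} (\<lambda>_. {- int (4 * n)..int (4 * n)}). (\<Sum>i<n. (z i)\<^sup>2) \<le> 16 * int n}"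

definition ball_net :: "nat \<Rightarrow> (nat \<Rightarrow> real) set" where
  "ball_net n = (\<lambda>z i. of_int (z i) / (4 * sqrt (real n))) ` lattice_points n"

definition round_to_zero :: "real \<Rightarrow> int" where
  "round_to_zero t = (if 0 \<le> t then \<lfloor>t\<rfloor> else \<lceil>t\<rceil>)"

lemma finite_lattice_points: "finite (lattice_points n)"
proof (rule finite_subset)
  show "lattice_points n \<subseteq> PiE {..<n} (\<lambda>_. {- int (4 * n)..int (4 * n)})"
    by (auto simp: lattice_points_def)
qed (simp add: finite_PiE)

lemma finite_ball_net: "finite (ball_net n)"
  by (simp add: ball_net_def finite_lattice_points)

lemma sum_half_powers: "(\<Sum>k\<in>{- int R..int R}. (1/2::real) ^ nat \<bar>k\<bar>) = 3 - 2 * (1/2) ^ R"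
proof (induction R)
  case (Suc R)
  have "{- int (Suc R)..int (Suc R)} =
      insert (- int (Suc R)) (insert (int (Suc R)) {- int R..int R})"
    by auto
  then show ?case using Suc by (simp add: nat_add_distrib)
qed simp

lemma lattice_point_weight:
  assumes "z \<in> lattice_points n"
  shows "1 \<le> 2 ^ (16 * n) * (\<Prod>i<n. (1/2::real) ^ nat \<bar>z i\<bar>)"
proof -
  have "\<bar>k\<bar> \<le> k\<^sup>2" for k :: int
  proof (cases "k = 0")
    case False
    then have "\<bar>k\<bar> * 1 \<le> \<bar>k\<bar> * \<bar>k\<bar>" by (intro mult_left_mono) auto
    then show ?thesis by (simp add: power2_eq_square)
  qed simp
  then have "(\<Sum>i<n. \<bar>z i\<bar>) \<le> (\<Sum>i<n. (z i)\<^sup>2)" by (intro sum_mono)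
  also have "\<dots> \<le> 16 * int n" using assms by (simp add: lattice_points_def)
  finally have "int (\<Sum>i<n. nat \<bar>z i\<bar>) \<le> int (16 * n)" by simp
  then have "(\<Sum>i<n. nat \<bar>z i\<bar>) \<le> 16 * n" by (simp only: of_nat_le_iff)
  then have "(1/2::real) ^ (16 * n) \<le> (1/2) ^ (\<Sum>i<n. nat \<bar>z i\<bar>)" by (intro power_decreasing) auto
  then have "2 ^ (16 * n) * (1/2::real) ^ (16 * n) \<le> 2 ^ (16 * n) * (\<Prod>i<n. (1/2) ^ nat \<bar>z i\<bar>)"
    by (intro mult_left_mono) (auto simp: power_sum)
  then show ?thesis by (simp add: power_mult_distrib[symmetric])
qed

text \<open>Each lattice point has weight at least \<open>1\<close> under the product weight
  \<open>2 ^ (16 n) * (\<Prod>i. 2 ^ (- \<bar>z i\<bar>))\<close>, whose total mass factorises.\<close>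
lemma card_ball_net: "real (card (ball_net n)) \<le> exp (18 * real n)"
proof -
  let ?P = "PiE {..<n} (\<lambda>_. {- int (4 * n)..int (4 * n)})"
  have "real (card (ball_net n)) \<le> real (card (lattice_points n))"
    unfolding ball_net_def using card_image_le[OF finite_lattice_points] by simp
  also have "\<dots> = (\<Sum>z\<in>lattice_points n. 1)" by simp
  also have "\<dots> \<le> (\<Sum>z\<in>lattice_points n. 2 ^ (16 * n) * (\<Prod>i<n. (1/2::real) ^ nat \<bar>z i\<bar>))"
    by (intro sum_mono lattice_point_weight)
  also have "\<dots> \<le> (\<Sum>z\<in>?P. 2 ^ (16 * n) * (\<Prod>i<n. (1/2::real) ^ nat \<bar>z i\<bar>))"
  proof (rule sum_mono2)
    show "finite ?P" by (intro finite_PiE) auto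
    show "lattice_points n \<subseteq> ?P" unfolding lattice_points_def by (rule Collect_restrict)
  qed (intro mult_nonneg_nonneg prod_nonneg; simp)
  also have "\<dots> = 2 ^ (16 * n) * (\<Prod>i<n. \<Sum>k\<in>{- int (4 * n)..int (4 * n)}. (1/2::real) ^ nat \<bar>k\<bar>)"
    unfolding sum_distrib_left[symmetric] by (subst prod_sum_PiE) simp_all
  also have "\<dots> = 2 ^ (16 * n) * (3 - 2 * (1/2) ^ (4 * n)) ^ n"
    by (subst sum_half_powers) simp
  also have "\<dots> \<le> 2 ^ (16 * n) * (2 ^ 2) ^ n"
  proof (intro mult_left_mono power_mono)
    have "(1/2::real) ^ (4 * n) \<le> 1" by (rule power_le_one) auto
    then show "0 \<le> 3 - 2 * (1/2::real) ^ (4 * n)" by linarith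
    have "0 \<le> (1/2::real) ^ (4 * n)" by simp
    then have "3 - 2 * (1/2::real) ^ (4 * n) \<le> 4" by linarith
    then show "3 - 2 * (1/2::real) ^ (4 * n) \<le> 2 ^ 2" by simp
  qed simp
  also have "\<dots> = (2::real) ^ (18 * n)"
    by (simp only: power_mult[symmetric] power_add[symmetric]) simp
  also have "\<dots> \<le> exp 1 ^ (18 * n)"
    using exp_ge_add_one_self[of 1] by (intro power_mono) auto
  also have "\<dots> = exp (18 * real n)" by (simp add: exp_of_nat_mult[symmetric])
  finally show ?thesis .
qed

lemma dot_self_lattice_point:
  "dot n (\<lambda>i. of_int (z i) / (4 * sqrt (real n))) (\<lambda>i. of_int (z i) / (4 * sqrt (real n))) =
    of_int (\<Sum>i<n. (z i)\<^sup>2) / (16 * real n)"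
  by (simp add: dot_def sum_divide_distrib power2_eq_square)

lemma ball_net_in_ball:
  assumes "0 < n" "v \<in> ball_net n"
  shows "dot n v v \<le> 1"
proof -
  obtain z where scaled: "z \<in> lattice_points n" "v = (\<lambda>i. of_int (z i) / (4 * sqrt (real n)))"
    using assms by (auto simp: ball_net_def)
  have "real_of_int (\<Sum>i<n. (z i)\<^sup>2) \<le> real_of_int (16 * int n)"
    using scaled(1) unfolding lattice_points_def of_int_le_iff by blast
  then show ?thesis unfolding scaled(2) dot_self_lattice_point using assms by simp
qed

lemma abs_round_to_zero_le: "\<bar>of_int (round_to_zero t)\<bar> \<le> \<bar>t\<bar>"
proof (cases "0 \<le> t")
  case True
  then have "0 \<le> \<lfloor>t\<rfloor>" by simp
  then show ?thesis using True of_int_floor_le[of t] by (simp add: round_to_zero_def)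
next
  case False
  then have "\<lceil>t\<rceil> \<le> 0" by simp
  then show ?thesis using False le_of_int_ceiling[of t] by (simp add: round_to_zero_def)
qed

lemma abs_diff_round_to_zero_le: "\<bar>t - of_int (round_to_zero t)\<bar> \<le> 1"
  by (auto simp: round_to_zero_def abs_le_iff) linarith+

lemma round_to_zero_in_lattice_points:
  assumes n_pos: "0 < n" and in_ball: "dot n u u \<le> 1"
  shows "(\<lambda>i\<in>{..<n}. round_to_zero (4 * sqrt (real n) * u i)) \<in> lattice_points n"
proof -
  define z where "z = (\<lambda>i\<in>{..<n}. round_to_zero (4 * sqrt (real n) * u i))"
  have "(\<Sum>i<n. (of_int (z i))\<^sup>2) \<le> (\<Sum>i<n. (4 * sqrt (real n) * u i)\<^sup>2)"
    using abs_round_to_zero_le by (intro sum_mono) (simp add: z_def abs_le_square_iff)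
  also have "\<dots> = 16 * real n * dot n u u"
    by (simp add: dot_def sum_distrib_left power_mult_distrib power2_eq_square[of "u _"])
  also have "\<dots> \<le> 16 * real n * 1" using in_ball by (intro mult_left_mono) auto
  finally have "real_of_int (\<Sum>i<n. (z i)\<^sup>2) \<le> real_of_int (16 * int n)" by simp
  then have norm: "(\<Sum>i<n. (z i)\<^sup>2) \<le> 16 * int n" by (simp only: of_int_le_iff)
  have "\<bar>z i\<bar> \<le> int (4 * n)" if "i < n" for i
  proof -
    have "(z i)\<^sup>2 \<le> (\<Sum>i<n. (z i)\<^sup>2)" using that by (intro member_le_sum) auto
    also note norm
    also have "16 * int n \<le> (int (4 * n))\<^sup>2" using n_pos by (simp add: power2_eq_square)
    finally show ?thesis using abs_le_square_iff[of "z i" "int (4 * n)"] by simp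
  qed
  then show ?thesis
    unfolding lattice_points_def z_def[symmetric] using norm
    by (auto simp: PiE_iff z_def abs_le_iff minus_le_iff)
qed

lemma ball_net_covers:
  assumes n_pos: "0 < n" and in_ball: "dot n u u \<le> 1"
  obtains v where "v \<in> ball_net n" "dot n (\<lambda>i. u i - v i) (\<lambda>i. u i - v i) \<le> 1 / 16"
proof -
  define z where "z = (\<lambda>i\<in>{..<n}. round_to_zero (4 * sqrt (real n) * u i))"
  define v where "v = (\<lambda>i. of_int (z i) / (4 * sqrt (real n)))"
  have "v \<in> ball_net n"
    using round_to_zero_in_lattice_points[OF assms] unfolding ball_net_def v_def z_def by blast
  moreover have "(u i - v i)\<^sup>2 \<le> 1 / (16 * real n)" if "i < n" for i
  proof -
    let ?t = "4 * sqrt (real n) * u i"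
    have "u i - v i = (?t - of_int (round_to_zero ?t)) / (4 * sqrt (real n))"
      using n_pos that by (simp add: v_def z_def field_simps)
    then have "(u i - v i)\<^sup>2 = (?t - of_int (round_to_zero ?t))\<^sup>2 / (16 * real n)"
      by (simp add: power_divide power_mult_distrib)
    also have "\<dots> \<le> 1 / (16 * real n)"
      using abs_diff_round_to_zero_le by (intro divide_right_mono) (auto simp: abs_square_le_1)
    finally show ?thesis .
  qed
  then have "dot n (\<lambda>i. u i - v i) (\<lambda>i. u i - v i) \<le> (\<Sum>i<n. 1 / (16 * real n))"
    unfolding dot_def power2_eq_square[symmetric] by (intro sum_mono) auto
  then have "dot n (\<lambda>i. u i - v i) (\<lambda>i. u i - v i) \<le> 1 / 16" using n_pos by simp
  ultimately show thesis by (rule that)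
qed

lemma spectral_bounded_of_ball_net:
  assumes n_pos: "0 < n" and symm: "symm_on n B"
    and net: "\<And>v. v \<in> ball_net n \<Longrightarrow> \<bar>quad_form n B v\<bar> \<le> \<beta>"
  shows "spectral_bounded n (2 * \<beta>) B"
proof -
  obtain u \<mu> where eig: "eigenbasis n B u \<mu>" by (rule symmetric_eigenbasis[OF symm])
  define L where "L = (MAX a\<in>{..<n}. \<bar>\<mu> a\<bar>)"
  have L_ge: "\<bar>\<mu> a\<bar> \<le> L" if "a < n" for a unfolding L_def using that by (intro Max_ge) auto
  have "finite {..<n}" "{..<n} \<noteq> {}" using n_pos by auto
  then obtain a where largest: "a < n" "\<bar>\<mu> a\<bar> = L"
    unfolding L_def by (metis obtains_MAX lessThan_iff)
  have bounded_L: "spectral_bounded n L B"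
    using L_ge by (rule spectral_boundedI_eigenvalue[OF symm eig])
  have unit: "dot n (u a) (u a) = 1"
    using eigenbasis_orthonormal[OF eig] largest by (simp add: orthonormal_def)
  then obtain v where near: "v \<in> ball_net n" "dot n (\<lambda>i. u a i - v i) (\<lambda>i. u a i - v i) \<le> 1 / 16"
    using ball_net_covers[OF n_pos, of "u a"] by auto
  have "\<bar>quad_form n B (u a) - quad_form n B v\<bar> \<le> 2 * L * (1 / 4)"
    using largest(2) unit ball_net_in_ball[OF n_pos near(1)] near(2)
    by (intro quad_form_diff_le[OF bounded_L]) (auto simp: power_divide)
  then have "L \<le> 2 * \<beta>"
    using net[OF near(1)] largest eigenvalue_eq_quad_form[OF eig largest(1)] by linarith
  then show ?thesis by (rule spectral_bounded_mono[OF bounded_L])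
qed

definition signed_gram :: "nat \<Rightarrow> (nat \<Rightarrow> (nat \<Rightarrow> real) \<times> real) \<Rightarrow> nat \<Rightarrow> nat \<Rightarrow> real" where
  "signed_gram m w = (\<lambda>j k. \<Sum>i<m. snd (w i) * (fst (w i) j * fst (w i) k))"

lemma symm_on_signed_gram: "symm_on n (signed_gram m w)"
  by (simp add: symm_on_def signed_gram_def mult.commute)

lemma signed_gram_row: "signed_gram m w j = (\<lambda>k. \<Sum>i<m. (snd (w i) * fst (w i) j) * fst (w i) k)"
  by (simp add: signed_gram_def mult.assoc)

lemma frob_inner_signed_gram:
  "frob_inner n (signed_gram m w) H = (\<Sum>i<m. snd (w i) * quad_form n H (fst (w i)))"
proof -
  have "dot n (signed_gram m w j) (H j) =
      (\<Sum>i<m. snd (w i) * (fst (w i) j * matvec n H (fst (w i)) j))" for j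
    unfolding signed_gram_row dot_sum_left dot_scale_left matvec_def
    by (simp add: dot_commute[of n _ "H j"] mult.assoc)
  then have "frob_inner n (signed_gram m w) H =
      (\<Sum>j<n. \<Sum>i<m. snd (w i) * (fst (w i) j * matvec n H (fst (w i)) j))"
    by (simp add: frob_inner_def)
  also have "\<dots> = (\<Sum>i<m. \<Sum>j<n. snd (w i) * (fst (w i) j * matvec n H (fst (w i)) j))"
    by (rule sum.swap)
  finally show ?thesis by (simp add: quad_form_def dot_def[of n _ "matvec n _ _"] sum_distrib_left)
qed

lemma quad_form_signed_gram:
  "quad_form n (signed_gram m w) v = (\<Sum>i<m. snd (w i) * (dot n v (fst (w i)))\<^sup>2)"
proof -
  have "matvec n (signed_gram m w) v = (\<lambda>j. \<Sum>i<m. (snd (w i) * dot n v (fst (w i))) * fst (w i) j)"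
    unfolding matvec_def signed_gram_row dot_sum_left dot_scale_left
    by (simp add: dot_commute[of n _ v] mult_ac)
  then show ?thesis
    by (simp add: quad_form_def dot_sum_right dot_scale_right power2_eq_square mult.assoc)
qed

text \<open>The soft maximum \<open>b \<le> L + exp (b - L)\<close> replaces a maximum over \<open>T\<close> by a sum of exponentials,
  which is linear and hence easy to integrate.\<close>
definition exp_penalty :: "'v set \<Rightarrow> real \<Rightarrow> real \<Rightarrow> ('v \<Rightarrow> real) \<Rightarrow> real" where
  "exp_penalty T s L q = (\<Sum>v\<in>T. exp (s * q v - L) + exp (- s * q v - L))"

lemma exp_penalty_nonneg: "0 \<le> exp_penalty T s L q"
  unfolding exp_penalty_def by (intro sum_nonneg) (simp add: add_nonneg_nonneg)

lemma abs_le_exp_penalty: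
  fixes q :: "'v \<Rightarrow> real"
  assumes "finite T" "v \<in> T" "0 < s"
  shows "\<bar>q v\<bar> \<le> (L + exp_penalty T s L q) / s"
proof -
  have "exp (s * q v - L) + exp (- s * q v - L) \<le> exp_penalty T s L q"
    unfolding exp_penalty_def using assms
    by (intro member_le_sum[of v T "\<lambda>v. exp (s * q v - L) + exp (- s * q v - L)"])
      (auto simp: add_nonneg_nonneg)
  moreover have "s * q v - L + 1 \<le> exp (s * q v - L)" "- s * q v - L + 1 \<le> exp (- s * q v - L)"
    using exp_ge_add_one_self[of "s * q v - L"] exp_ge_add_one_self[of "- s * q v - L"] by linarith+
  ultimately have "s * q v \<le> L + exp_penalty T s L q" "- s * q v \<le> L + exp_penalty T s L q"
    using exp_ge_zero[of "s * q v - L"] exp_ge_zero[of "- s * q v - L"] by linarith+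
  then have "s * \<bar>q v\<bar> \<le> L + exp_penalty T s L q" by (simp add: abs_if)
  then show ?thesis using \<open>0 < s\<close> by (simp add: field_simps)
qed

lemma signed_sum_le_exp_penalty:
  assumes n_pos: "0 < n" and nuclear: "nuclear_bounded n \<kappa> H" and s_pos: "0 < s" and L_pos: "0 < L"
  shows "(\<Sum>i<m. snd (w i) * quad_form n H (fst (w i))) \<le>
    \<kappa> * (2 / s * (L + exp_penalty (ball_net n) s L (quad_form n (signed_gram m w))))"
proof -
  define E where "E = exp_penalty (ball_net n) s L (quad_form n (signed_gram m w))"
  have "0 \<le> E" unfolding E_def by (rule exp_penalty_nonneg)
  have "\<bar>quad_form n (signed_gram m w) v\<bar> \<le> (L + E) / s" if "v \<in> ball_net n" for v
    unfolding E_def by (rule abs_le_exp_penalty[OF finite_ball_net that s_pos])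
  then have "spectral_bounded n (2 * ((L + E) / s)) (signed_gram m w)"
    by (rule spectral_bounded_of_ball_net[OF n_pos symm_on_signed_gram])
  then have "frob_inner n (signed_gram m w) H \<le> \<kappa> * (2 * ((L + E) / s))"
    using s_pos L_pos \<open>0 \<le> E\<close> by (intro frob_inner_le_nuclear_spectral[OF nuclear]) auto
  then show ?thesis by (simp add: frob_inner_signed_gram E_def)
qed

context prob_space
begin

lemma signed_square_mgf:
  fixes V :: "'a \<Rightarrow> real"
  assumes V_measurable [measurable]: "V \<in> borel_measurable M" and "0 < s1" "0 \<le> C" "\<bar>s\<bar> \<le> s1 / 2"
    and square: "(\<integral>\<^sup>+x. ennreal (exp (s1 * (V x)\<^sup>2)) \<partial>M) \<le> ennreal C"
  shows "(\<integral>\<^sup>+z. ennreal (exp (s * (snd z * (V (fst z))\<^sup>2))) \<partial>signed M) \<le>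
      ennreal (exp (4 * C * (s / s1)\<^sup>2))"
proof -
  let ?E = "\<lambda>x. ennreal (exp (s1 * (V x)\<^sup>2))"
  have product: "(\<lambda>z. snd z * (V (fst z))\<^sup>2) \<in> borel_measurable (signed M)"
    by (intro borel_measurable_times borel_measurable_power measurable_snd_signed
        measurable_compose[OF measurable_fst V_measurable])
  have "(\<lambda>t. ennreal (exp (s * t))) \<in> borel_measurable borel" by measurable
  note integrand = measurable_compose[OF product this]
  have "(\<integral>\<^sup>+z. ennreal (exp (s * (snd z * (V (fst z))\<^sup>2))) \<partial>signed M) =
      (\<integral>\<^sup>+x. (ennreal (exp (s * (V x)\<^sup>2)) + ennreal (exp (- s * (V x)\<^sup>2))) / 2 \<partial>M)"
    by (subst nn_integral_signed[OF integrand]) simp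
  also have "\<dots> \<le> (\<integral>\<^sup>+x. 1 + ennreal (4 * (s / s1)\<^sup>2) * ?E x \<partial>M)"
  proof (rule nn_integral_mono)
    fix x
    have "(ennreal (exp (s * (V x)\<^sup>2)) + ennreal (exp (- s * (V x)\<^sup>2))) / 2 =
        ennreal ((exp (s * (V x)\<^sup>2) + exp (- s * (V x)\<^sup>2)) / 2)"
      by (simp add: ennreal_plus[symmetric] divide_ennreal[symmetric] del: ennreal_plus)
    also have "\<dots> \<le> ennreal (1 + 4 * (s / s1)\<^sup>2 * exp (s1 * (V x)\<^sup>2))"
      using assms by (intro ennreal_leI cosh_le_quadratic_exp) auto
    also have "\<dots> = 1 + ennreal (4 * (s / s1)\<^sup>2) * ?E x"
      by (simp add: ennreal_mult[symmetric])
    finally show "(ennreal (exp (s * (V x)\<^sup>2)) + ennreal (exp (- s * (V x)\<^sup>2))) / 2 \<le>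
        1 + ennreal (4 * (s / s1)\<^sup>2) * ?E x" .
  qed
  also have "\<dots> = 1 + ennreal (4 * (s / s1)\<^sup>2) * (\<integral>\<^sup>+x. ?E x \<partial>M)"
    by (subst nn_integral_add) (measurable, simp add: nn_integral_cmult emeasure_space_1)
  also have "\<dots> \<le> 1 + ennreal (4 * (s / s1)\<^sup>2) * ennreal C"
    by (intro add_left_mono mult_left_mono square) auto
  also have "\<dots> = ennreal (1 + 4 * C * (s / s1)\<^sup>2)"
    using \<open>0 \<le> C\<close> by (simp add: ennreal_mult[symmetric] mult_ac)
  also have "\<dots> \<le> ennreal (exp (4 * C * (s / s1)\<^sup>2))"
    by (intro ennreal_leI exp_ge_add_one_self)
  finally show ?thesis .
qed

lemma expectation_exp_shift_le:
  assumes [measurable]: "h \<in> borel_measurable M"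
    and mgf: "(\<integral>\<^sup>+x. ennreal (exp (h x)) \<partial>M) \<le> ennreal (exp B)"
  shows "integrable M (\<lambda>x. exp (h x - L))" "expectation (\<lambda>x. exp (h x - L)) \<le> exp (B - L)"
proof -
  have "integrable M (\<lambda>x. exp (h x))"
    using mgf by (intro integrableI_nonneg) (auto intro: le_less_trans)
  moreover from this have "expectation (\<lambda>x. exp (h x)) \<le> exp B"
    using mgf by (subst (asm) nn_integral_eq_integral) (auto simp: ennreal_le_iff)
  ultimately show "integrable M (\<lambda>x. exp (h x - L))" "expectation (\<lambda>x. exp (h x - L)) \<le> exp (B - L)"
    by (simp_all add: exp_diff divide_right_mono)
qed

lemma expectation_exp_penalty_le:
  fixes q :: "'a \<Rightarrow> 'v \<Rightarrow> real"
  assumes card: "real (card T) \<le> exp A"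
    and q_measurable: "\<And>v. v \<in> T \<Longrightarrow> (\<lambda>x. q x v) \<in> borel_measurable M"
    and mgf: "\<And>v t. v \<in> T \<Longrightarrow> \<bar>t\<bar> = s \<Longrightarrow> (\<integral>\<^sup>+x. ennreal (exp (t * q x v)) \<partial>M) \<le> ennreal (exp B)"
    and level: "L = A + B" and "0 \<le> s"
  shows "integrable M (\<lambda>x. exp_penalty T s L (q x))"
    and "expectation (\<lambda>x. exp_penalty T s L (q x)) \<le> 2"
proof -
  have summand: "integrable M (\<lambda>x. exp (t * q x v - L))"
      "expectation (\<lambda>x. exp (t * q x v - L)) \<le> exp (B - L)"
    if "v \<in> T" "\<bar>t\<bar> = s" for v t
    using expectation_exp_shift_le[OF _ mgf[OF that]] q_measurable[OF that(1)] by auto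
  show "integrable M (\<lambda>x. exp_penalty T s L (q x))"
    unfolding exp_penalty_def using \<open>0 \<le> s\<close>
    by (intro Bochner_Integration.integrable_sum Bochner_Integration.integrable_add summand) auto
  have "expectation (\<lambda>x. exp_penalty T s L (q x)) =
      (\<Sum>v\<in>T. expectation (\<lambda>x. exp (s * q x v - L)) + expectation (\<lambda>x. exp (- s * q x v - L)))"
    unfolding exp_penalty_def using \<open>0 \<le> s\<close> summand(1)[of _ s] summand(1)[of _ "- s"]
    by (simp add: Bochner_Integration.integral_sum)
  also have "\<dots> \<le> (\<Sum>v\<in>T. exp (B - L) + exp (B - L))"
    using \<open>0 \<le> s\<close> by (intro sum_mono add_mono summand) auto
  also have "\<dots> \<le> exp A * (2 * exp (B - L))"
    using mult_right_mono[OF card, of "2 * exp (B - L)"] by simp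
  also have "\<dots> = 2" by (simp add: level exp_add[symmetric])
  finally show "expectation (\<lambda>x. exp_penalty T s L (q x)) \<le> 2" .
qed

end

context centred_subgaussian
begin

lemma finite_moments_quad_form: "finite_moments (iid D n) (quad_form n H)"
proof -
  interpret P: prob_space "iid D n" by (rule prob_space_iid)
  show ?thesis
    unfolding quad_form_eq_sum[abs_def]
    by (intro P.finite_moments_intros finite_moments_iid_component finite_moments_id
        finite_moments_dot) auto
qed

lemma quad_form_signed_gram_mgf:
  assumes in_ball: "dot n v v \<le> 1" and t_small: "\<bar>t\<bar> \<le> 1 / (16 * K\<^sup>2)"
  shows "(\<integral>\<^sup>+w. ennreal (exp (t * quad_form n (signed_gram m w) v)) \<partial>iid (signed (iid D n)) m) \<le>
    ennreal (exp (512 * K ^ 4 * t\<^sup>2 * real m))"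
proof -
  interpret P: prob_space "iid D n" by (rule prob_space_iid)
  interpret S: prob_space "signed (iid D n)" by (rule P.prob_space_signed)
  let ?h = "\<lambda>z. t * (snd z * (dot n v (fst z))\<^sup>2)"
  have "(\<integral>\<^sup>+z. ennreal (exp (?h z)) \<partial>signed (iid D n)) \<le>
      ennreal (exp (4 * 2 * (t / (1 / (8 * K\<^sup>2)))\<^sup>2))"
    using t_small K_pos
    by (intro P.signed_square_mgf[OF measurable_dot _ _ _ dot_exp_square_le[OF in_ball]]) auto
  also have "4 * 2 * (t / (1 / (8 * K\<^sup>2)))\<^sup>2 = 512 * K ^ 4 * t\<^sup>2"
    by (simp add: power_mult_distrib)
  finally have "(\<integral>\<^sup>+w. ennreal (exp (\<Sum>i<m. ?h (w i))) \<partial>iid (signed (iid D n)) m) \<le>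
      ennreal (exp (real m * (512 * K ^ 4 * t\<^sup>2)))"
    by (intro S.nn_integral_iid_exp_sum_le) measurable
  then show ?thesis by (simp add: quad_form_signed_gram sum_distrib_left mult_ac)
qed

lemma expectation_signed_gram_penalty_le:
  assumes n_pos: "0 < n" and "0 \<le> s" and s_small: "s \<le> 1 / (16 * K\<^sup>2)"
    and exponent: "512 * K ^ 4 * s\<^sup>2 * real m \<le> 2 * real n"
  defines "E \<equiv> \<lambda>w. exp_penalty (ball_net n) s (20 * real n) (quad_form n (signed_gram m w))"
  shows "integrable (iid (signed (iid D n)) m) E" and "(\<integral>w. E w \<partial>iid (signed (iid D n)) m) \<le> 2"
proof -
  let ?Q = "signed (iid D n)"
  interpret P: prob_space "iid D n" by (rule prob_space_iid)
  interpret S: prob_space ?Q by (rule P.prob_space_signed)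
  interpret W: prob_space "iid ?Q m" by (rule S.prob_space_iid)
  have measurable: "(\<lambda>w. quad_form n (signed_gram m w) v) \<in> borel_measurable (iid ?Q m)" for v
    unfolding quad_form_signed_gram by measurable
  have "(\<integral>\<^sup>+w. ennreal (exp (t * quad_form n (signed_gram m w) v)) \<partial>iid ?Q m) \<le>
      ennreal (exp (2 * real n))"
    if "v \<in> ball_net n" "\<bar>t\<bar> = s" for v t
  proof -
    have "t\<^sup>2 = s\<^sup>2" using that(2) by (metis power2_abs)
    then have "ennreal (exp (512 * K ^ 4 * t\<^sup>2 * real m)) \<le> ennreal (exp (2 * real n))"
      using exponent by (intro ennreal_leI) simp
    then show ?thesis
      using quad_form_signed_gram_mgf[OF ball_net_in_ball[OF n_pos that(1)], of t m] that(2) s_small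
      by (auto intro: order_trans)
  qed
  note penalty =
    W.expectation_exp_penalty_le[OF card_ball_net measurable this, where L = "20 * real n"]
  show "integrable (iid ?Q m) E" "W.expectation E \<le> 2"
    unfolding E_def using penalty \<open>0 \<le> s\<close> by auto
qed

theorem rademacher_complexity_nuclear_le:
  assumes n_pos: "0 < n" and "n \<le> m" and "0 \<le> \<kappa>" and finite: "finite F" "F \<noteq> {}"
    and nuclear: "\<And>H. H \<in> F \<Longrightarrow> nuclear_bounded n \<kappa> H"
  shows "rademacher_complexity (iid D n) m (quad_form n) F \<le> 704 * K\<^sup>2 * \<kappa> * sqrt (real n * real m)"
proof -
  let ?Q = "signed (iid D n)"
  interpret P: prob_space "iid D n" by (rule prob_space_iid)
  interpret S: prob_space ?Q by (rule P.prob_space_signed)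
  interpret W: prob_space "iid ?Q m" by (rule S.prob_space_iid)
  define \<rho> where "\<rho> = sqrt (real n / real m)"
  have \<rho>_bounds: "0 < \<rho>" "\<rho> \<le> 1" "real m * \<rho>\<^sup>2 = real n"
    using n_pos \<open>n \<le> m\<close> by (simp_all add: \<rho>_def)
  define s where "s = \<rho> / (16 * K\<^sup>2)"
  have s_bounds: "0 < s" "s \<le> 1 / (16 * K\<^sup>2)"
    using \<rho>_bounds K_pos by (simp_all add: s_def divide_right_mono)
  have "512 * K ^ 4 * s\<^sup>2 * real m = 2 * real n"
    using K_pos \<rho>_bounds(3) by (simp add: s_def power_divide power_mult_distrib field_simps)
  define L where "L = 20 * real n"
  have "0 < L" using n_pos by (simp add: L_def)
  define E where "E = (\<lambda>w. exp_penalty (ball_net n) s L (quad_form n (signed_gram m w)))"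
  have penalty: "integrable (iid ?Q m) E" "W.expectation E \<le> 2"
    unfolding E_def L_def
    using expectation_signed_gram_penalty_le[OF n_pos _ s_bounds(2), of m] s_bounds(1)
      \<open>512 * K ^ 4 * s\<^sup>2 * real m = 2 * real n\<close> by auto
  have "rademacher_complexity (iid D n) m (quad_form n) F \<le> (\<integral>w. \<kappa> * (2 / s * (L + E w)) \<partial>iid ?Q m)"
    unfolding rademacher_complexity_def
  proof (rule integral_mono')
    show "integrable (iid ?Q m) (\<lambda>w. \<kappa> * (2 / s * (L + E w)))" using penalty by auto
    show "0 \<le> \<kappa> * (2 / s * (L + E w))" for w
      unfolding E_def using \<open>0 \<le> \<kappa>\<close> s_bounds(1) \<open>0 < L\<close>
      by (intro mult_nonneg_nonneg add_nonneg_nonneg exp_penalty_nonneg) auto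
    show "(MAX H\<in>F. \<Sum>i<m. snd (w i) * quad_form n H (fst (w i))) \<le> \<kappa> * (2 / s * (L + E w))" for w
      unfolding E_def
      using finite signed_sum_le_exp_penalty[OF n_pos nuclear s_bounds(1) \<open>0 < L\<close>] by simp
  qed
  also have "\<dots> = \<kappa> * (2 / s * (L + W.expectation E))" using penalty by (simp add: W.prob_space)
  also have "\<dots> \<le> \<kappa> * (2 / s * (22 * real n))"
    using \<open>0 \<le> \<kappa>\<close> s_bounds penalty n_pos by (intro mult_left_mono) (auto simp: L_def)
  also have "\<dots> = 704 * K\<^sup>2 * \<kappa> * (real n / \<rho>)" by (simp add: s_def field_simps)
  also have "real n / \<rho> = sqrt (real n * real m)"
    using n_pos by (simp add: \<rho>_def real_sqrt_divide real_sqrt_mult field_simps)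
  finally show ?thesis .
qed

end

section \<open>Moments of quadratic forms\<close>

lemma fourth_power_expansion_le:
  fixes A B c z :: real
  shows "(A + (z * B + (z\<^sup>2 - 1) * c)) ^ 4 \<le>
    A ^ 4 + 4 * A ^ 3 * B * z + 4 * A ^ 3 * c * (z\<^sup>2 - 1) +
    16 * A\<^sup>2 * B\<^sup>2 * z\<^sup>2 + 16 * A\<^sup>2 * c\<^sup>2 * (z\<^sup>2 - 1)\<^sup>2 + 24 * B ^ 4 * z ^ 4 +
        24 * c ^ 4 * (z\<^sup>2 - 1) ^ 4"
proof -
  define p where "p = z * B"
  define q where "q = (z\<^sup>2 - 1) * c"
  define V where "V = p + q"
  have square_sum_le: "(x + y)\<^sup>2 \<le> 2 * x\<^sup>2 + 2 * y\<^sup>2" for x y :: real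
    using sum_squares_bound[of x y] by (simp add: power2_sum)
  have V_square_le: "V\<^sup>2 \<le> 2 * p\<^sup>2 + 2 * q\<^sup>2" unfolding V_def by (rule square_sum_le)
  have "V ^ 4 = (V\<^sup>2)\<^sup>2" by simp
  also have "\<dots> \<le> (2 * p\<^sup>2 + 2 * q\<^sup>2)\<^sup>2" using V_square_le by (intro power_mono) auto
  also have "\<dots> \<le> 2 * (2 * p\<^sup>2)\<^sup>2 + 2 * (2 * q\<^sup>2)\<^sup>2" by (rule square_sum_le)
  finally have V_fourth_le: "V ^ 4 \<le> 8 * p ^ 4 + 8 * q ^ 4" by (simp add: power_mult_distrib)
  have "0 \<le> 2 * (V * (A - V))\<^sup>2" by simp
  then have cross: "4 * A * V ^ 3 \<le> 2 * A\<^sup>2 * V\<^sup>2 + 2 * V ^ 4"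
    by (simp add: power2_eq_square power3_eq_cube power4_eq_xxxx algebra_simps)
  have "(A + V) ^ 4 = A ^ 4 + 4 * A ^ 3 * V + 6 * A\<^sup>2 * V\<^sup>2 + 4 * A * V ^ 3 + V ^ 4"
    by (simp add: power2_eq_square power3_eq_cube power4_eq_xxxx algebra_simps)
  also have "\<dots> \<le> A ^ 4 + 4 * A ^ 3 * V + 8 * A\<^sup>2 * V\<^sup>2 + 3 * V ^ 4" using cross by linarith
  also have "\<dots> \<le> A ^ 4 + 4 * A ^ 3 * V + 8 * A\<^sup>2 * (2 * p\<^sup>2 + 2 * q\<^sup>2) +
      3 * (8 * p ^ 4 + 8 * q ^ 4)"
    using V_square_le V_fourth_le by (intro add_mono mult_left_mono order_refl) auto
  also have "\<dots> = A ^ 4 + 4 * A ^ 3 * B * z + 4 * A ^ 3 * c * (z\<^sup>2 - 1) +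
    16 * A\<^sup>2 * B\<^sup>2 * z\<^sup>2 + 16 * A\<^sup>2 * c\<^sup>2 * (z\<^sup>2 - 1)\<^sup>2 + 24 * B ^ 4 * z ^ 4 +
        24 * c ^ 4 * (z\<^sup>2 - 1) ^ 4"
    unfolding V_def p_def q_def by (simp add: power_mult_distrib distrib_left mult_ac)
  finally show ?thesis by (simp add: V_def p_def q_def)
qed

lemma integral_mult_le_sqrt:
  fixes f g :: "'a \<Rightarrow> real"
  assumes f_square_int: "integrable M (\<lambda>x. (f x)\<^sup>2)" and g_square_int: "integrable M (\<lambda>x. (g x)\<^sup>2)"
    and fg_int: "integrable M (\<lambda>x. f x * g x)"
    and [measurable]: "f \<in> borel_measurable M" "g \<in> borel_measurable M"
    and nonneg: "\<And>x. 0 \<le> f x" "\<And>x. 0 \<le> g x"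
  shows "(\<integral>x. f x * g x \<partial>M) \<le> sqrt (\<integral>x. (f x)\<^sup>2 \<partial>M) * sqrt (\<integral>x. (g x)\<^sup>2 \<partial>M)"
proof -
  have "ennreal ((\<integral>x. f x * g x \<partial>M)\<^sup>2) = (\<integral>\<^sup>+x. ennreal (f x) * ennreal (g x) \<partial>M)\<^sup>2"
    using nonneg fg_int by (simp add: ennreal_mult[symmetric] nn_integral_eq_integral ennreal_power)
  also have "\<dots> \<le> (\<integral>\<^sup>+x. (ennreal (f x))\<^sup>2 \<partial>M) * (\<integral>\<^sup>+x. (ennreal (g x))\<^sup>2 \<partial>M)"
    by (rule Cauchy_Schwarz_nn_integral) measurable
  also have "\<dots> = ennreal ((\<integral>x. (f x)\<^sup>2 \<partial>M) * (\<integral>x. (g x)\<^sup>2 \<partial>M))"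
    using nonneg f_square_int g_square_int
    by (simp add: ennreal_power nn_integral_eq_integral ennreal_mult)
  finally have "(\<integral>x. f x * g x \<partial>M)\<^sup>2 \<le> (\<integral>x. (f x)\<^sup>2 \<partial>M) * (\<integral>x. (g x)\<^sup>2 \<partial>M)"
    by (subst (asm) ennreal_le_iff) auto
  then show ?thesis by (simp add: real_le_rsqrt real_sqrt_mult[symmetric])
qed

lemma (in prob_space) truncated_mean_ge:
  fixes X :: "'a \<Rightarrow> real"
  assumes X_moments: "finite_moments M X" and b_ge_1: "1 \<le> b"
    and second: "expectation (\<lambda>x. (X x)\<^sup>2) = 1" and fourth: "expectation (\<lambda>x. X x ^ 4) \<le> b\<^sup>2"
  shows "1 / (2 * b) \<le> expectation (\<lambda>x. min \<bar>X x\<bar> b)"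
proof -
  note [measurable] = finite_moments_measurable[OF X_moments]
    and int = finite_moments_integrable_power[OF X_moments]
  have trunc: "integrable M (\<lambda>x. min \<bar>X x\<bar> b)"
    using b_ge_1 by (intro integrable_const_bound[of _ b]) auto
  have pointwise: "(X x)\<^sup>2 \<le> b * min \<bar>X x\<bar> b + X x ^ 4 / (2 * b\<^sup>2)" for x
  proof (cases "\<bar>X x\<bar> \<le> b")
    case True
    then have "\<bar>X x\<bar> * \<bar>X x\<bar> \<le> b * \<bar>X x\<bar>" by (intro mult_right_mono) auto
    then have "(X x)\<^sup>2 \<le> b * min \<bar>X x\<bar> b" using True by (simp add: power2_eq_square)
    moreover have "0 \<le> X x ^ 4 / (2 * b\<^sup>2)" by simp
    ultimately show ?thesis by linarith
  next
    case False
    have "0 \<le> ((X x)\<^sup>2 - b\<^sup>2)\<^sup>2 / (2 * b\<^sup>2)" by simp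
    also have "\<dots> = X x ^ 4 / (2 * b\<^sup>2) - (X x)\<^sup>2 + b\<^sup>2 / 2"
      using b_ge_1 by (simp add: power2_diff field_simps)
    finally have "(X x)\<^sup>2 \<le> X x ^ 4 / (2 * b\<^sup>2) + b\<^sup>2 / 2" by linarith
    moreover have "b\<^sup>2 / 2 \<le> b * min \<bar>X x\<bar> b" using False b_ge_1 by (simp add: power2_eq_square)
    ultimately show ?thesis by linarith
  qed
  have "1 \<le> (\<integral>x. b * min \<bar>X x\<bar> b + X x ^ 4 / (2 * b\<^sup>2) \<partial>M)"
    unfolding second[symmetric] using int trunc by (intro integral_mono pointwise) auto
  also have "\<dots> = b * expectation (\<lambda>x. min \<bar>X x\<bar> b) + expectation (\<lambda>x. X x ^ 4) / (2 * b\<^sup>2)"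
    using int trunc by simp
  also have "\<dots> \<le> b * expectation (\<lambda>x. min \<bar>X x\<bar> b) + 1 / 2"
    using fourth b_ge_1 by (simp add: divide_le_eq)
  finally have "1 / 2 \<le> b * expectation (\<lambda>x. min \<bar>X x\<bar> b)" by simp
  then show ?thesis using b_ge_1 by (simp add: field_simps)
qed

text \<open>For symmetric \<open>H\<close> this is \<open>\<tau> - tr H + x\<^sup>T H x\<close>, grouped by the largest index so that conditioning
  on the last coordinate exposes a martingale difference.\<close>
definition centred_qf :: "nat \<Rightarrow> real \<Rightarrow> (nat \<Rightarrow> nat \<Rightarrow> real) \<Rightarrow> (nat \<Rightarrow> real) \<Rightarrow> real" where
  "centred_qf n \<tau> H x = \<tau> + (\<Sum>i<n. x i * dot i (\<lambda>j. 2 * H i j) x + ((x i)\<^sup>2 - 1) * H i i)"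

lemma centred_qf_Suc:
  "centred_qf (Suc n) \<tau> H (x(n := z)) =
    centred_qf n \<tau> H x + (z * dot n (\<lambda>j. 2 * H n j) x + (z\<^sup>2 - 1) * H n n)"
  by (simp add: centred_qf_def dot_fun_upd)

lemma quad_form_eq_centred_qf:
  assumes "symm_on n H"
  shows "quad_form n H x = centred_qf n (trace_on n H) H x"
  using assms
proof (induction n)
  case 0
  then show ?case by (simp add: quad_form_def dot_def centred_qf_def trace_on_def)
next
  case (Suc n)
  have symm: "symm_on n H" using Suc.prems by (simp add: symm_on_def)
  have "quad_form (Suc n) H x =
      (\<Sum>i<n. x i * (dot n (H i) x + H i n * x n)) + x n * (dot n (H n) x + H n n * x n)"
    by (simp add: quad_form_eq_sum dot_def)
  also have "(\<Sum>i<n. x i * (dot n (H i) x + H i n * x n)) =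
      quad_form n H x + (\<Sum>i<n. x n * (H n i * x i))"
    using Suc.prems by (simp add: quad_form_eq_sum distrib_left sum.distrib symm_on_def mult_ac)
  also have "(\<Sum>i<n. x n * (H n i * x i)) = x n * dot n (H n) x"
    by (simp add: dot_def sum_distrib_left)
  finally have "quad_form (Suc n) H x =
      quad_form n H x + x n * (2 * dot n (H n) x) + H n n * (x n)\<^sup>2"
    by (simp add: algebra_simps power2_eq_square)
  moreover have expand: "centred_qf (Suc n) \<tau> H x =
      centred_qf n \<tau> H x + (x n * (2 * dot n (H n) x) + ((x n)\<^sup>2 - 1) * H n n)" for \<tau>
    by (simp add: centred_qf_def dot_scale_left)
  moreover have "centred_qf n (trace_on (Suc n) H) H x = quad_form n H x + H n n"
    using Suc.IH[OF symm] by (simp add: centred_qf_def trace_on_def)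
  ultimately show ?case using expand[of "trace_on (Suc n) H"] by (simp add: algebra_simps)
qed

lemma hypercontractive_step_le:
  fixes v b c \<kappa> \<kappa>1 \<rho> \<mu>4 w4 :: real
  assumes nonneg: "0 \<le> v" "0 \<le> b" "0 \<le> \<rho>" "0 \<le> \<kappa>1"
    and \<kappa>_bounds: "64 * \<kappa>1 \<le> \<kappa>" "8 \<le> \<kappa>" "24 * \<mu>4 * \<kappa>1 \<le> \<kappa>" "24 * w4 \<le> \<kappa> * \<rho>\<^sup>2"
  shows "\<kappa> * v\<^sup>2 + 16 * ((sqrt \<kappa> * v) * (sqrt \<kappa>1 * b)) + 16 * c\<^sup>2 * \<rho> * v + 24 * \<mu>4 * (\<kappa>1 * b\<^sup>2) +
      24 * c ^ 4 * w4 \<le>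
    \<kappa> * (v + (b + \<rho> * c\<^sup>2))\<^sup>2"
proof -
  have "sqrt (64 * \<kappa>1) \<le> sqrt \<kappa>" using \<kappa>_bounds(1) by (rule real_sqrt_le_mono)
  then have "2 * sqrt \<kappa> * (8 * sqrt \<kappa>1) \<le> 2 * sqrt \<kappa> * sqrt \<kappa>"
    using \<kappa>_bounds(2) by (intro mult_left_mono) (auto simp: real_sqrt_mult)
  moreover have "2 * sqrt \<kappa> * sqrt \<kappa> = 2 * \<kappa>" using \<kappa>_bounds(2) by simp
  ultimately have "16 * (sqrt \<kappa> * sqrt \<kappa>1) \<le> 2 * \<kappa>" by (simp only: mult_ac)
  then have "16 * (sqrt \<kappa> * sqrt \<kappa>1) * (v * b) \<le> 2 * \<kappa> * (v * b)"
    using nonneg by (intro mult_right_mono) auto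
  then have cross_v_b: "16 * ((sqrt \<kappa> * v) * (sqrt \<kappa>1 * b)) \<le> 2 * \<kappa> * (v * b)"
    by (simp add: mult_ac)
  have "2 * 8 * (v * (\<rho> * c\<^sup>2)) \<le> 2 * \<kappa> * (v * (\<rho> * c\<^sup>2))"
    using \<kappa>_bounds(2) nonneg by (intro mult_right_mono) auto
  then have cross_v_c: "16 * c\<^sup>2 * \<rho> * v \<le> 2 * \<kappa> * (v * (\<rho> * c\<^sup>2))" by (simp add: mult_ac)
  have "(24 * \<mu>4 * \<kappa>1) * b\<^sup>2 \<le> \<kappa> * b\<^sup>2" using \<kappa>_bounds(3) by (intro mult_right_mono) auto
  then have square_b: "24 * \<mu>4 * (\<kappa>1 * b\<^sup>2) \<le> \<kappa> * b\<^sup>2" by (simp add: mult_ac)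
  have "(24 * w4) * c ^ 4 \<le> (\<kappa> * \<rho>\<^sup>2) * c ^ 4" using \<kappa>_bounds(4) by (intro mult_right_mono) auto
  then have square_c: "24 * c ^ 4 * w4 \<le> \<kappa> * (\<rho> * c\<^sup>2)\<^sup>2" by (simp add: power_mult_distrib mult_ac)
  have "0 \<le> 2 * \<kappa> * (b * (\<rho> * c\<^sup>2))" using \<kappa>_bounds(2) nonneg by auto
  moreover have "\<kappa> * (v + (b + \<rho> * c\<^sup>2))\<^sup>2 =
      \<kappa> * v\<^sup>2 + 2 * \<kappa> * (v * b) + 2 * \<kappa> * (v * (\<rho> * c\<^sup>2)) + \<kappa> * b\<^sup>2 +
      \<kappa> * (\<rho> * c\<^sup>2)\<^sup>2 + 2 * \<kappa> * (b * (\<rho> * c\<^sup>2))"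
    by (simp add: power2_eq_square algebra_simps)
  ultimately show ?thesis using cross_v_b cross_v_c square_b square_c by linarith
qed

locale sensing_law = centred_subgaussian +
  assumes unit_variance: "expectation (\<lambda>x. x\<^sup>2) = 1"
    and fourth_moment_gt_1: "1 < expectation (\<lambda>x. x ^ 4)"
begin

definition excess :: real where
  "excess = expectation (\<lambda>x. x ^ 4) - 1"

definition hypercontractive_const :: real where
  "hypercontractive_const = 64 * (256 * K ^ 4) + 8 + 24 * (excess + 1) * (256 * K ^ 4) +
    24 * expectation (\<lambda>x. (x\<^sup>2 - 1) ^ 4) / excess\<^sup>2"

definition qf_var :: "nat \<Rightarrow> real \<Rightarrow> (nat \<Rightarrow> nat \<Rightarrow> real) \<Rightarrow> real" where
  "qf_var n \<tau> H = \<tau>\<^sup>2 + (\<Sum>i<n. dot i (\<lambda>j. 2 * H i j) (\<lambda>j. 2 * H i j) + excess * (H i i)\<^sup>2)"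

lemma excess_pos: "0 < excess"
  using fourth_moment_gt_1 by (simp add: excess_def)

lemma hypercontractive_const_bounds:
  shows "64 * (256 * K ^ 4) \<le> hypercontractive_const" "8 \<le> hypercontractive_const"
    "24 * (excess + 1) * (256 * K ^ 4) \<le> hypercontractive_const"
    "24 * expectation (\<lambda>x. (x\<^sup>2 - 1) ^ 4) \<le> hypercontractive_const * excess\<^sup>2"
proof -
  define w where "w = expectation (\<lambda>x. (x\<^sup>2 - 1) ^ 4)"
  have "0 \<le> w" unfolding w_def by (rule integral_nonneg_AE) simp
  have nonneg: "0 \<le> 256 * K ^ 4" "0 \<le> 24 * (excess + 1) * (256 * K ^ 4)" "0 \<le> 24 * w / excess\<^sup>2"
    using excess_pos \<open>0 \<le> w\<close> by auto
  then show "64 * (256 * K ^ 4) \<le> hypercontractive_const" "8 \<le> hypercontractive_const"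
      "24 * (excess + 1) * (256 * K ^ 4) \<le> hypercontractive_const"
    by (simp_all add: hypercontractive_const_def w_def)
  have "24 * w / excess\<^sup>2 \<le> hypercontractive_const"
    using nonneg by (simp add: hypercontractive_const_def w_def)
  then show "24 * expectation (\<lambda>x. (x\<^sup>2 - 1) ^ 4) \<le> hypercontractive_const * excess\<^sup>2"
    using excess_pos by (simp add: divide_le_eq w_def)
qed

lemma expectation_square_minus_1: "expectation (\<lambda>x. x\<^sup>2 - 1) = 0"
    "expectation (\<lambda>x. (x\<^sup>2 - 1)\<^sup>2) = excess"
proof -
  have int: "integrable D (\<lambda>x. x\<^sup>2)" "integrable D (\<lambda>x. x ^ 4)"
    by (rule finite_moments_integrable_power[OF finite_moments_id])+
  then show "expectation (\<lambda>x. x\<^sup>2 - 1) = 0" by (simp add: prob_space unit_variance)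
  have "(x\<^sup>2 - 1)\<^sup>2 = x ^ 4 - 2 * x\<^sup>2 + 1" for x :: real by (simp add: power2_diff)
  then show "expectation (\<lambda>x. (x\<^sup>2 - 1)\<^sup>2) = excess"
    using int by (simp add: excess_def prob_space unit_variance)
qed

lemma integrable_entry_terms:
  shows "integrable D (\<lambda>x. x)" "integrable D (\<lambda>x. x ^ k)" "integrable D (\<lambda>x. x\<^sup>2 - 1)"
    "integrable D (\<lambda>x. (x\<^sup>2 - 1) ^ k)" "integrable D (\<lambda>x. x * (x\<^sup>2 - 1))"
  by (intro finite_moments_integrable finite_moments_intros finite_moments_id)+

lemma conditional_second_moment:
  "expectation (\<lambda>z. (A + (z * B + (z\<^sup>2 - 1) * c))\<^sup>2) =
    A\<^sup>2 + B\<^sup>2 + 2 * c * expectation (\<lambda>z. z * (z\<^sup>2 - 1)) * B + excess * c\<^sup>2"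
proof -
  have "(A + (z * B + (z\<^sup>2 - 1) * c))\<^sup>2 =
      A\<^sup>2 + 2 * A * B * z + 2 * A * c * (z\<^sup>2 - 1) + B\<^sup>2 * z\<^sup>2 + 2 * B * c * (z * (z\<^sup>2 - 1)) +
          c\<^sup>2 * (z\<^sup>2 - 1)\<^sup>2" for z
    by (simp add: power2_eq_square algebra_simps)
  then show ?thesis
    using integrable_entry_terms
    by (simp add: prob_space mean_zero unit_variance expectation_square_minus_1
        del: Bochner_Integration.integral_diff)
qed

lemma conditional_fourth_moment_le:
  "expectation (\<lambda>z. (A + (z * B + (z\<^sup>2 - 1) * c)) ^ 4) \<le>
    A ^ 4 + 16 * (A\<^sup>2 * B\<^sup>2) + 16 * c\<^sup>2 * excess * A\<^sup>2 + 24 * (excess + 1) * B ^ 4 +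
    24 * c ^ 4 * expectation (\<lambda>z. (z\<^sup>2 - 1) ^ 4)"
proof -
  let ?U = "\<lambda>z. A ^ 4 + 4 * A ^ 3 * B * z + 4 * A ^ 3 * c * (z\<^sup>2 - 1) +
    16 * A\<^sup>2 * B\<^sup>2 * z\<^sup>2 + 16 * A\<^sup>2 * c\<^sup>2 * (z\<^sup>2 - 1)\<^sup>2 + 24 * B ^ 4 * z ^ 4 +
        24 * c ^ 4 * (z\<^sup>2 - 1) ^ 4"
  have "expectation (\<lambda>z. (A + (z * B + (z\<^sup>2 - 1) * c)) ^ 4) \<le> expectation ?U"
    by (intro integral_mono fourth_power_expansion_le finite_moments_integrable
        finite_moments_intros finite_moments_id)
  also have "\<dots> = A ^ 4 + 16 * A\<^sup>2 * B\<^sup>2 + 16 * A\<^sup>2 * c\<^sup>2 * excess +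
      24 * B ^ 4 * expectation (\<lambda>z. z ^ 4) +
      24 * c ^ 4 * expectation (\<lambda>z. (z\<^sup>2 - 1) ^ 4)"
    using integrable_entry_terms
    by (simp add: prob_space mean_zero unit_variance expectation_square_minus_1
        del: Bochner_Integration.integral_diff)
  finally show ?thesis by (simp add: excess_def mult_ac)
qed

lemma expectation_dot: "(\<integral>x. dot n u x \<partial>iid D n) = 0"
proof (induction n)
  case 0
  show ?case by (simp add: dot_def)
next
  case (Suc n)
  have "(\<integral>x. dot (Suc n) u x \<partial>iid D (Suc n)) = (\<integral>x. \<integral>z. dot n u x + u n * z \<partial>D \<partial>iid D n)"
    using integral_iid_Suc_last_inner[OF finite_moments_integrable[OF finite_moments_dot]]
    by (simp add: dot_Suc_fun_upd)
  then show ?case using Suc by (simp add: prob_space mean_zero integrable_entry_terms)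
qed

lemma expectation_dot_square: "(\<integral>x. (dot n u x)\<^sup>2 \<partial>iid D n) = dot n u u"
proof (induction n)
  case 0
  show ?case by (simp add: dot_def)
next
  case (Suc n)
  interpret P: prob_space "iid D n" by (rule prob_space_iid)
  have "(\<integral>x. (dot (Suc n) u x)\<^sup>2 \<partial>iid D (Suc n)) = (\<integral>x. \<integral>z. (dot n u x + u n * z)\<^sup>2 \<partial>D \<partial>iid D n)"
    using integral_iid_Suc_last_inner[OF finite_moments_integrable_power[OF finite_moments_dot]]
    by (simp add: dot_Suc_fun_upd)
  also have "\<dots> = (\<integral>x. (dot n u x)\<^sup>2 + (u n)\<^sup>2 \<partial>iid D n)"
  proof (rule Bochner_Integration.integral_cong[OF refl])
    fix x
    have "(dot n u x + u n * z)\<^sup>2 = (dot n u x)\<^sup>2 + (2 * dot n u x * u n) * z + (u n)\<^sup>2 * z\<^sup>2" for z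
      by (simp add: power2_sum power_mult_distrib algebra_simps)
    then show "expectation (\<lambda>z. (dot n u x + u n * z)\<^sup>2) = (dot n u x)\<^sup>2 + (u n)\<^sup>2"
      by (simp add: prob_space mean_zero unit_variance integrable_entry_terms)
  qed
  also have "\<dots> = dot (Suc n) u u"
    using finite_moments_integrable_power[OF finite_moments_dot[of n u], of 2] Suc
    by (simp add: P.prob_space dot_def power2_eq_square)
  finally show ?case .
qed

lemma finite_moments_centred_qf: "finite_moments (iid D n) (centred_qf n \<tau> H)"
proof -
  interpret P: prob_space "iid D n" by (rule prob_space_iid)
  show ?thesis
    unfolding centred_qf_def[abs_def]
    by (intro P.finite_moments_intros finite_moments_iid_component finite_moments_id
        finite_moments_dot_prefix) auto
qed

lemma centred_qf_second_moment: "(\<integral>x. (centred_qf n \<tau> H x)\<^sup>2 \<partial>iid D n) = qf_var n \<tau> H"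
proof (induction n)
  case 0
  interpret P: prob_space "iid D 0" by (rule prob_space_iid)
  show ?case using P.prob_space by (simp add: centred_qf_def qf_var_def)
next
  case (Suc n)
  interpret P: prob_space "iid D n" by (rule prob_space_iid)
  let ?A = "centred_qf n \<tau> H" and ?B = "dot n (\<lambda>j. 2 * H n j)" and ?c = "H n n"
  have "(\<integral>x. (centred_qf (Suc n) \<tau> H x)\<^sup>2 \<partial>iid D (Suc n)) =
      (\<integral>x. \<integral>z. (?A x + (z * ?B x + (z\<^sup>2 - 1) * ?c))\<^sup>2 \<partial>D \<partial>iid D n)"
    using integral_iid_Suc_last_inner[OF finite_moments_integrable_power[OF finite_moments_centred_qf]]
    by (simp add: centred_qf_Suc)
  also have "\<dots> = (\<integral>x. (?A x)\<^sup>2 + (?B x)\<^sup>2 + 2 * ?c * expectation (\<lambda>z. z * (z\<^sup>2 - 1)) * ?B x +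
      excess * ?c\<^sup>2 \<partial>iid D n)"
    unfolding conditional_second_moment ..
  also have "\<dots> = qf_var n \<tau> H + dot n (\<lambda>j. 2 * H n j) (\<lambda>j. 2 * H n j) + excess * ?c\<^sup>2"
    using finite_moments_integrable_power[OF finite_moments_centred_qf, where k = 2]
      finite_moments_integrable_power[OF finite_moments_dot, where k = 2]
      finite_moments_integrable[OF finite_moments_dot]
    by (simp add: P.prob_space Suc expectation_dot expectation_dot_square)
  finally show ?case by (simp add: qf_var_def)
qed

lemma centred_qf_Suc_fourth_moment_le:
  fixes n :: nat and H :: "nat \<Rightarrow> nat \<Rightarrow> real"
  defines "B \<equiv> dot n (\<lambda>j. 2 * H n j)"
  shows "(\<integral>x. centred_qf (Suc n) \<tau> H x ^ 4 \<partial>iid D (Suc n)) \<le>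
    (\<integral>x. centred_qf n \<tau> H x ^ 4 \<partial>iid D n) + 16 * (\<integral>x. (centred_qf n \<tau> H x)\<^sup>2 * (B x)\<^sup>2 \<partial>iid D n) +
    16 * (H n n)\<^sup>2 * excess * qf_var n \<tau> H + 24 * (excess + 1) * (\<integral>x. B x ^ 4 \<partial>iid D n) +
    24 * H n n ^ 4 * expectation (\<lambda>z. (z\<^sup>2 - 1) ^ 4)"
proof -
  interpret P: prob_space "iid D n" by (rule prob_space_iid)
  let ?A = "centred_qf n \<tau> H" and ?c = "H n n" and ?w = "expectation (\<lambda>z. (z\<^sup>2 - 1) ^ 4)"
  note A_moments = finite_moments_centred_qf[of n \<tau> H]
  note B_moments = finite_moments_dot[of n "\<lambda>j. 2 * H n j", folded B_def]
  note AB_moments = finite_moments_mult[OF P.finite_moments_power[OF A_moments, of 2]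
      P.finite_moments_power[OF B_moments, of 2]]
  have fourth: "integrable (iid D (Suc n)) (\<lambda>x. centred_qf (Suc n) \<tau> H x ^ 4)"
    by (rule finite_moments_integrable_power[OF finite_moments_centred_qf])
  have "(\<integral>x. centred_qf (Suc n) \<tau> H x ^ 4 \<partial>iid D (Suc n)) =
      (\<integral>x. \<integral>z. (?A x + (z * B x + (z\<^sup>2 - 1) * ?c)) ^ 4 \<partial>D \<partial>iid D n)"
    using integral_iid_Suc_last_inner[OF fourth] by (simp add: centred_qf_Suc B_def)
  also have "\<dots> \<le> (\<integral>x. ?A x ^ 4 + 16 * ((?A x)\<^sup>2 * (B x)\<^sup>2) + 16 * ?c\<^sup>2 * excess * (?A x)\<^sup>2 +
      24 * (excess + 1) * B x ^ 4 + 24 * ?c ^ 4 * ?w \<partial>iid D n)"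
  proof (rule integral_mono)
    show "integrable (iid D n) (\<lambda>x. \<integral>z. (?A x + (z * B x + (z\<^sup>2 - 1) * ?c)) ^ 4 \<partial>D)"
      using integrable_iid_Suc_last_inner[OF fourth] by (simp add: centred_qf_Suc B_def)
  qed (intro conditional_fourth_moment_le finite_moments_integrable P.finite_moments_intros
      A_moments B_moments)+
  also have "\<dots> = (\<integral>x. ?A x ^ 4 \<partial>iid D n) + 16 * (\<integral>x. (?A x)\<^sup>2 * (B x)\<^sup>2 \<partial>iid D n) +
      16 * ?c\<^sup>2 * excess * qf_var n \<tau> H + 24 * (excess + 1) * (\<integral>x. B x ^ 4 \<partial>iid D n) +
          24 * ?c ^ 4 * ?w"
    using finite_moments_integrable_power[OF A_moments]
      finite_moments_integrable_power[OF B_moments]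
      finite_moments_integrable[OF AB_moments]
    by (simp add: P.prob_space centred_qf_second_moment)
  finally show ?thesis .
qed

lemma centred_qf_fourth_moment_le:
  "(\<integral>x. centred_qf n \<tau> H x ^ 4 \<partial>iid D n) \<le> hypercontractive_const * (qf_var n \<tau> H)\<^sup>2"
proof (induction n)
  case 0
  interpret P: prob_space "iid D 0" by (rule prob_space_iid)
  have "1 * \<tau> ^ 4 \<le> hypercontractive_const * \<tau> ^ 4"
    using hypercontractive_const_bounds(2) by (intro mult_right_mono) auto
  then show ?case using P.prob_space by (simp add: centred_qf_def qf_var_def)
next
  case (Suc n)
  interpret P: prob_space "iid D n" by (rule prob_space_iid)
  define u v b c where "u = (\<lambda>j. 2 * H n j)" and "v = qf_var n \<tau> H" and "b = dot n u u"
    and "c = H n n"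
  let ?A = "centred_qf n \<tau> H" and ?B = "dot n u" and ?w = "expectation (\<lambda>z. (z\<^sup>2 - 1) ^ 4)"
    and ?\<kappa> = hypercontractive_const and ?\<kappa>1 = "256 * K ^ 4"
  have fourth: "(\<integral>x. ?A x ^ 4 \<partial>iid D n) \<le> ?\<kappa> * v\<^sup>2" "(\<integral>x. ?B x ^ 4 \<partial>iid D n) \<le> ?\<kappa>1 * b\<^sup>2"
    using Suc expectation_dot_fourth_le by (simp_all add: v_def b_def)
  have nonneg: "0 \<le> v" "0 \<le> b"
    unfolding v_def b_def centred_qf_second_moment[symmetric] by simp_all
  have "(\<integral>x. (?A x)\<^sup>2 * (?B x)\<^sup>2 \<partial>iid D n) \<le>
      sqrt (\<integral>x. ((?A x)\<^sup>2)\<^sup>2 \<partial>iid D n) * sqrt (\<integral>x. ((?B x)\<^sup>2)\<^sup>2 \<partial>iid D n)"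
    by (intro integral_mult_le_sqrt finite_moments_integrable finite_moments_measurable
        P.finite_moments_intros finite_moments_centred_qf finite_moments_dot) auto
  also have "\<dots> \<le> (sqrt ?\<kappa> * v) * (sqrt ?\<kappa>1 * b)"
    using real_sqrt_le_mono[OF fourth(1)] real_sqrt_le_mono[OF fourth(2)] nonneg
      hypercontractive_const_bounds(2)
    by (intro mult_mono) (simp_all add: real_sqrt_mult)
  finally have cross: "(\<integral>x. (?A x)\<^sup>2 * (?B x)\<^sup>2 \<partial>iid D n) \<le> (sqrt ?\<kappa> * v) * (sqrt ?\<kappa>1 * b)" .
  have "(\<integral>x. centred_qf (Suc n) \<tau> H x ^ 4 \<partial>iid D (Suc n)) \<le>
      (\<integral>x. ?A x ^ 4 \<partial>iid D n) + 16 * (\<integral>x. (?A x)\<^sup>2 * (?B x)\<^sup>2 \<partial>iid D n) + 16 * c\<^sup>2 * excess * v +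
      24 * (excess + 1) * (\<integral>x. ?B x ^ 4 \<partial>iid D n) + 24 * c ^ 4 * ?w"
    unfolding u_def v_def c_def by (rule centred_qf_Suc_fourth_moment_le)
  also have "\<dots> \<le> ?\<kappa> * v\<^sup>2 + 16 * ((sqrt ?\<kappa> * v) * (sqrt ?\<kappa>1 * b)) + 16 * c\<^sup>2 * excess * v +
      24 * (excess + 1) * (?\<kappa>1 * b\<^sup>2) + 24 * c ^ 4 * ?w"
    using excess_pos by (intro add_mono mult_left_mono fourth cross order_refl) auto
  also have "\<dots> \<le> ?\<kappa> * (v + (b + excess * c\<^sup>2))\<^sup>2"
    using nonneg excess_pos hypercontractive_const_bounds by (intro hypercontractive_step_le) auto
  also have "v + (b + excess * c\<^sup>2) = qf_var (Suc n) \<tau> H"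
    by (simp add: qf_var_def v_def b_def u_def c_def)
  finally show ?case .
qed

theorem quad_form_fourth_moment_le:
  assumes "symm_on n H"
  shows "(\<integral>x. quad_form n H x ^ 4 \<partial>iid D n) \<le>
      hypercontractive_const * (\<integral>x. (quad_form n H x)\<^sup>2 \<partial>iid D n)\<^sup>2"
  unfolding quad_form_eq_centred_qf[OF assms] centred_qf_second_moment
  by (rule centred_qf_fourth_moment_le)

lemma frob_inner_le_qf_var:
  assumes "symm_on n H"
  shows "min 1 excess * frob_inner n H H \<le> qf_var n \<tau> H"
  using assms
proof (induction n)
  case 0
  then show ?case by (simp add: frob_inner_def qf_var_def)
next
  case (Suc n)
  have symm: "symm_on n H" using Suc.prems by (simp add: symm_on_def)
  define h where "h = dot n (H n) (H n)"
  have "frob_inner (Suc n) H H = (\<Sum>i<n. dot n (H i) (H i) + H i n * H i n) + (h + H n n * H n n)"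
    by (simp add: frob_inner_def dot_def h_def)
  also have "(\<Sum>i<n. dot n (H i) (H i) + H i n * H i n) = frob_inner n H H + h"
    using Suc.prems by (simp add: frob_inner_def h_def dot_def[of n "H n"] sum.distrib symm_on_def)
  finally have "min 1 excess * frob_inner (Suc n) H H =
      min 1 excess * frob_inner n H H + min 1 excess * (2 * h) + min 1 excess * (H n n)\<^sup>2"
    by (simp add: algebra_simps power2_eq_square)
  also have "\<dots> \<le> qf_var n \<tau> H + 1 * (4 * h) + excess * (H n n)\<^sup>2"
    using excess_pos
    by (intro add_mono Suc.IH[OF symm] mult_mono mult_right_mono) (auto simp: h_def)
  also have "\<dots> = qf_var (Suc n) \<tau> H"
    by (simp add: qf_var_def h_def dot_linear)
  finally show ?case .
qed

theorem frob_inner_le_quad_form_second_moment: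
  assumes "symm_on n H"
  shows "min 1 excess * frob_inner n H H \<le> (\<integral>x. (quad_form n H x)\<^sup>2 \<partial>iid D n)"
  unfolding quad_form_eq_centred_qf[OF assms] centred_qf_second_moment
  by (rule frob_inner_le_qf_var[OF assms])

lemma quad_form_small_ball:
  assumes "symm_on n H" "(\<integral>x. (quad_form n H x)\<^sup>2 \<partial>iid D n) = 1"
  shows "1 / (2 * sqrt hypercontractive_const) \<le>
      (\<integral>x. min \<bar>quad_form n H x\<bar> (sqrt hypercontractive_const) \<partial>iid D n)"
proof -
  interpret P: prob_space "iid D n" by (rule prob_space_iid)
  show ?thesis
    using quad_form_fourth_moment_le[OF assms(1)] assms(2) hypercontractive_const_bounds(2)
    by (intro P.truncated_mean_ge finite_moments_quad_form) auto
qed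

end

section \<open>Uniform lower bound and recovery\<close>

definition flatten :: "nat \<Rightarrow> nat \<Rightarrow> (nat \<Rightarrow> nat \<Rightarrow> 'a) \<Rightarrow> nat \<times> nat \<Rightarrow> 'a" where
  "flatten m n w = (\<lambda>p\<in>{..<m} \<times> {..<n}. w (fst p) (snd p))"

context prob_space
begin

lemma measurable_flatten:
  "flatten m n \<in> iid (iid M n) m \<rightarrow>\<^sub>M PiM ({..<m} \<times> {..<n}) (\<lambda>_. M)"
  unfolding flatten_def[abs_def]
proof (rule measurable_restrict)
  fix p :: "nat \<times> nat" assume "p \<in> {..<m} \<times> {..<n}"
  then have "(\<lambda>w. w (fst p)) \<in> iid (iid M n) m \<rightarrow>\<^sub>M iid M n" "(\<lambda>x. x (snd p)) \<in> iid M n \<rightarrow>\<^sub>M M"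
    by (auto intro!: measurable_component_singleton)
  then show "(\<lambda>w. w (fst p) (snd p)) \<in> iid (iid M n) m \<rightarrow>\<^sub>M M" by (rule measurable_compose)
qed

lemma flatten_vimage_PiE:
  assumes A_sets: "\<And>p. p \<in> {..<m} \<times> {..<n} \<Longrightarrow> A p \<in> sets M"
  shows "flatten m n -` PiE ({..<m} \<times> {..<n}) A \<inter> space (iid (iid M n) m) =
    PiE {..<m} (\<lambda>i. PiE {..<n} (\<lambda>j. A (i, j)))"
proof -
  have space: "space (iid (iid M n) m) = PiE {..<m} (\<lambda>_. PiE {..<n} (\<lambda>_. space M))"
    by (simp add: space_PiM)
  have flatten: "flatten m n w \<in> PiE ({..<m} \<times> {..<n}) A \<longleftrightarrow> (\<forall>i<m. \<forall>j<n. w i j \<in> A (i, j))" for w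
    by (auto simp: flatten_def PiE_iff)
  have "A (i, j) \<subseteq> space M" if "i < m" "j < n" for i j
    using sets.sets_into_space[OF A_sets, of "(i, j)"] that by simp
  then show ?thesis
    unfolding set_eq_iff vimage_eq Int_iff space flatten by (simp add: PiE_iff) blast
qed

lemma distr_flatten:
  "distr (iid (iid M n) m) (PiM ({..<m} \<times> {..<n}) (\<lambda>_. M)) (flatten m n) =
      PiM ({..<m} \<times> {..<n}) (\<lambda>_. M)"
proof -
  interpret rows: prob_space "iid M n" by (rule prob_space_iid)
  interpret entries: product_sigma_finite "\<lambda>_::nat \<times> nat. M" ..
  interpret row: product_sigma_finite "\<lambda>_::nat. M" ..
  interpret sample: product_sigma_finite "\<lambda>_::nat. iid M n" ..
  let ?distr = "distr (iid (iid M n) m) (PiM ({..<m} \<times> {..<n}) (\<lambda>_. M)) (flatten m n)"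
  show ?thesis
  proof (rule entries.PiM_eqI)
    fix A assume A_sets: "\<And>p. p \<in> {..<m} \<times> {..<n} \<Longrightarrow> A p \<in> sets M"
    then have row_sets: "PiE {..<n} (\<lambda>j. A (i, j)) \<in> sets (iid M n)" if "i < m" for i
      using that by (intro sets_PiM_I_finite) auto
    have "emeasure ?distr (PiE ({..<m} \<times> {..<n}) A) =
        emeasure (iid (iid M n) m) (PiE {..<m} (\<lambda>i. PiE {..<n} (\<lambda>j. A (i, j))))"
      using A_sets by (subst emeasure_distr[OF measurable_flatten])
        (auto simp: flatten_vimage_PiE intro!: sets_PiM_I_finite)
    also have "\<dots> = (\<Prod>i<m. \<Prod>j<n. emeasure M (A (i, j)))"
      using A_sets row_sets by (subst sample.emeasure_PiM) (auto intro!: prod.cong row.emeasure_PiM)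
    also have "\<dots> = (\<Prod>p\<in>{..<m} \<times> {..<n}. emeasure M (A p))" by (simp add: prod.cartesian_product)
    finally show "emeasure ?distr (PiE ({..<m} \<times> {..<n}) A) =
        (\<Prod>p\<in>{..<m} \<times> {..<n}. emeasure M (A p))" .
  qed simp_all
qed

lemma prob_countable_Ball_ge:
  assumes countable: "countable T" and A_events: "\<And>H. H \<in> T \<Longrightarrow> A H \<in> events"
    and finite_ge: "\<And>F. finite F \<Longrightarrow> F \<noteq> {} \<Longrightarrow> F \<subseteq> T \<Longrightarrow> q \<le> prob {w \<in> space M. \<forall>H\<in>F. w \<in> A H}"
    and "q \<le> 1"
  shows "q \<le> prob {w \<in> space M. \<forall>H\<in>T. w \<in> A H}"
proof (cases "T = {}")
  case True
  then show ?thesis using \<open>q \<le> 1\<close> by (simp add: prob_space)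
next
  case False
  define B where "B = (\<lambda>k. {w \<in> space M. \<forall>H\<in>from_nat_into T ` {..k::nat}. w \<in> A H})"
  have in_T: "from_nat_into T k \<in> T" for k using False by (rule from_nat_into)
  have "B k \<in> events" for k
    unfolding B_def using A_events in_T
    by (intro sets.sets_Collect_finite_All) (auto simp: Int_def[symmetric] intro!: sets.Int)
  moreover have "decseq B" unfolding B_def decseq_def by auto
  ultimately have lim: "(\<lambda>k. prob (B k)) \<longlonglongrightarrow> prob (\<Inter>k. B k)"
    by (intro finite_Lim_measure_decseq) auto
  have "q \<le> prob (B k)" for k unfolding B_def using in_T by (intro finite_ge) auto
  then have "q \<le> prob (\<Inter>k. B k)" by (intro LIMSEQ_le_const[OF lim]) auto
  also have "(\<Inter>k. B k) = {w \<in> space M. \<forall>H\<in>T. w \<in> A H}"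
  proof -
    have "\<forall>H\<in>T. \<exists>k. H = from_nat_into T k" using from_nat_into_surj[OF countable] by metis
    then show ?thesis using in_T unfolding B_def by blast
  qed
  finally show ?thesis .
qed

end

definition trunc_sum :: "nat \<Rightarrow> nat \<Rightarrow> real \<Rightarrow> (nat \<Rightarrow> nat \<Rightarrow> real) \<Rightarrow> (nat \<times> nat \<Rightarrow> real) \<Rightarrow> real" where
  "trunc_sum m n b H a = (\<Sum>i<m. min \<bar>quad_form n H (\<lambda>j. a (i, j))\<bar> b)"

lemma trunc_sum_flatten: "trunc_sum m n b H (flatten m n w) = (\<Sum>i<m. min \<bar>quad_form n H (w i)\<bar> b)"
  unfolding trunc_sum_def
proof (intro sum.cong refl)
  fix i assume "i \<in> {..<m}"
  then have "quad_form n H (\<lambda>j. flatten m n w (i, j)) = quad_form n H (w i)"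
    by (intro quad_form_cong) (simp add: flatten_def)
  then show "min \<bar>quad_form n H (\<lambda>j. flatten m n w (i, j))\<bar> b = min \<bar>quad_form n H (w i)\<bar> b" by simp
qed

lemma continuous_on_trunc_sum: "continuous_on UNIV (\<lambda>H. trunc_sum m n b H a)"
proof -
  have "continuous_on UNIV (\<lambda>H :: nat \<Rightarrow> nat \<Rightarrow> real. H i j)" for i j
    by (rule continuous_on_product_then_coordinatewise, rule continuous_on_product_coordinates)
  then show ?thesis unfolding trunc_sum_def quad_form_eq_sum dot_def by (intro continuous_intros)
qed

lemma measurable_trunc_sum:
  assumes "sets D = sets borel"
  shows "trunc_sum m n b H \<in> borel_measurable (sample_space D m n)"
proof -
  have "(\<lambda>a. a (i, j)) \<in> borel_measurable (sample_space D m n)" if "i < m" "j < n" for i j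
    unfolding sample_space_def
    using that measurable_component_singleton[of "(i, j)" "{..<m} \<times> {..<n}" "\<lambda>_. D"] assms
    by (auto cong: measurable_cong_sets)
  then have "(\<lambda>a. quad_form n H (\<lambda>j. a (i, j))) \<in> borel_measurable (sample_space D m n)"
    if "i < m" for i
    unfolding quad_form_eq_sum dot_def
    using that by (intro borel_measurable_sum borel_measurable_times) auto
  then show ?thesis
    unfolding trunc_sum_def[abs_def] by (intro borel_measurable_sum borel_measurable_min) auto
qed

lemma trunc_sum_le: "trunc_sum m n b H a \<le> (\<Sum>i<m. \<bar>quad_form n H (\<lambda>j. a (i, j))\<bar>)"
  unfolding trunc_sum_def by (intro sum_mono) simp

lemma sens_op_index:
  assumes "M \<in> carrier_mat n n" "i < m"
  shows "sens_op a m n M $ i = quad_form n (entries M) (\<lambda>j. a (i, j))"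
  using assms by (simp add: sens_op_def sens_vec_def scalar_prod_mult_mat_vec)

lemma residual_sum_le:
  assumes carrier: "S \<in> carrier_mat n n" "S' \<in> carrier_mat n n"
    and eta: "eta \<in> carrier_vec m" "l1_norm eta \<le> eps"
    and residual: "l1_norm (sens_op a m n S + eta - sens_op a m n S') \<le> eps"
  shows "(\<Sum>i<m. \<bar>quad_form n (\<lambda>i j. S' $$ (i, j) - S $$ (i, j)) (\<lambda>j. a (i, j))\<bar>) \<le> 2 * eps"
proof -
  have dim: "dim_vec (sens_op a m n M) = m" for M by (simp add: sens_op_def)
  have "(\<Sum>i<m. \<bar>quad_form n (\<lambda>i j. S' $$ (i, j) - S $$ (i, j)) (\<lambda>j. a (i, j))\<bar>) \<le>
      (\<Sum>i<m. \<bar>sens_op a m n S $ i + eta $ i - sens_op a m n S' $ i\<bar> + \<bar>eta $ i\<bar>)"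
    using carrier by (intro sum_mono) (simp add: quad_form_diff_matrix sens_op_index)
  also have "\<dots> = l1_norm (sens_op a m n S + eta - sens_op a m n S') + l1_norm eta"
    using eta dim by (simp add: l1_norm_def sum.distrib)
  finally show ?thesis using residual eta by linarith
qed

lemma minimizer_mtrace_le:
  assumes minimizer: "is_minimizer a m n (sens_op a m n S + eta) eps S'"
    and psd: "psd_mat n S" and eta: "eta \<in> carrier_vec m" "l1_norm eta \<le> eps"
  shows "mtrace S' \<le> mtrace S"
proof -
  have "sens_op a m n S + eta - sens_op a m n S = eta"
    using eta by (intro eq_vecI) (auto simp: sens_op_def)
  then show ?thesis using minimizer psd eta(2) by (simp add: is_minimizer_def)
qed

context sensing_law
begin

definition nondegeneracy :: real where
  "nondegeneracy = min 1 excess"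

definition trunc_level :: real where
  "trunc_level = sqrt hypercontractive_const"

definition decay_rate :: real where
  "decay_rate = 1 / (32 * trunc_level ^ 4)"

definition recovery_const :: real where
  "recovery_const = 8 * trunc_level / sqrt nondegeneracy"

definition sample_const :: real where
  "sample_const = max 1 ((45056 * trunc_level * K\<^sup>2 / sqrt nondegeneracy)\<^sup>2)"

definition class_radius :: "nat \<Rightarrow> real" where
  "class_radius r = 4 * sqrt (real r) / sqrt nondegeneracy"

definition normalized_class :: "nat \<Rightarrow> real \<Rightarrow> (nat \<Rightarrow> nat \<Rightarrow> real) set" where
  "normalized_class n \<kappa> =
    {H. symm_on n H \<and> (\<integral>x. (quad_form n H x)\<^sup>2 \<partial>iid D n) = 1 \<and> nuclear_bounded n \<kappa> H}"

definition lower_bounded ::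
  "nat \<Rightarrow> nat \<Rightarrow> (nat \<Rightarrow> nat \<Rightarrow> real) set \<Rightarrow> (nat \<times> nat \<Rightarrow> real) \<Rightarrow> bool" where
  "lower_bounded m n F a \<longleftrightarrow> (\<forall>H\<in>F. real m / (4 * trunc_level) \<le> trunc_sum m n trunc_level H a)"

definition sufficient_sample :: "nat \<Rightarrow> nat \<Rightarrow> real \<Rightarrow> bool" where
  "sufficient_sample m n \<kappa> \<longleftrightarrow> n \<le> m \<and> 0 \<le> \<kappa> \<and>
    1408 * K\<^sup>2 * \<kappa> * sqrt (real n * real m) \<le> real m / (8 * trunc_level)"

lemma nondegeneracy_pos: "0 < nondegeneracy"
  using excess_pos by (simp add: nondegeneracy_def)

lemma trunc_level_ge_1: "1 \<le> trunc_level"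
  using hypercontractive_const_bounds(2) by (simp add: trunc_level_def)

lemma normalized_class_dim_pos: "H \<in> normalized_class n \<kappa> \<Longrightarrow> 0 < n"
  by (rule ccontr) (simp add: normalized_class_def quad_form_def dot_def)

lemma sets_lower_bounded:
  assumes "countable F"
  shows "{a \<in> space (sample_space D m n). lower_bounded m n F a} \<in> sets (sample_space D m n)"
  unfolding lower_bounded_def using measurable_trunc_sum[OF sets_eq_borel]
  by (intro sets.sets_Collect_countable_All'[OF _ assms] borel_measurable_le) auto

lemma vimage_flatten_lower_bounded:
  "flatten m n -` {a \<in> space (sample_space D m n). lower_bounded m n F a} \<inter>
      space (iid (iid D n) m) = {w \<in> space (iid (iid D n) m). lower_bounded m n F (flatten m n w)}"
  using measurable_space[OF measurable_flatten] by (auto simp: sample_space_def)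

lemma finite_class_lower_bounded:
  assumes finite: "finite F" "F \<noteq> {}" and in_class: "F \<subseteq> normalized_class n \<kappa>"
    and size: "sufficient_sample m n \<kappa>"
  shows "1 - exp (- decay_rate * real m) \<le> measure (iid (iid D n) m)
    {w \<in> space (iid (iid D n) m). lower_bounded m n F (flatten m n w)}" (is "_ \<le> measure _ ?good")
proof -
  let ?b = trunc_level and ?t = "1 / (8 * trunc_level)"
    and ?rc = "rademacher_complexity (iid D n) m (quad_form n) F"
  interpret P: prob_space "iid D n" by (rule prob_space_iid)
  interpret W: prob_space "iid (iid D n) m" by (rule P.prob_space_iid)
  have H_class: "symm_on n H" "(\<integral>x. (quad_form n H x)\<^sup>2 \<partial>iid D n) = 1" "nuclear_bounded n \<kappa> H"
    if "H \<in> F" for H using in_class that by (auto simp: normalized_class_def)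
  have n_pos: "0 < n" using finite in_class normalized_class_dim_pos by blast
  have "?rc \<le> 704 * K\<^sup>2 * \<kappa> * sqrt (real n * real m)"
    using size unfolding sufficient_sample_def
    by (intro rademacher_complexity_nuclear_le n_pos finite H_class(3)) auto
  then have complexity: "2 * ?rc \<le> real m / (8 * ?b)"
    using size by (simp add: sufficient_sample_def)
  have mean: "real m * (1 / (2 * ?b)) \<le> real m * (\<integral>x. min \<bar>quad_form n H x\<bar> ?b \<partial>iid D n)"
    if "H \<in> F" for H
    using quad_form_small_ball[OF H_class(1,2)[OF that]]
    by (intro mult_left_mono) (auto simp: trunc_level_def)
  have "real m * (1 / (2 * ?b)) = real m / (8 * ?b) + ?t * real m + real m / (4 * ?b)"
    using trunc_level_ge_1 by (simp add: field_simps)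
  then have level: "real m / (4 * ?b) \<le>
      real m * (\<integral>x. min \<bar>quad_form n H x\<bar> ?b \<partial>iid D n) - 2 * ?rc - ?t * real m"
    if "H \<in> F" for H using mean[OF that] complexity by linarith
  have "exp (- decay_rate * real m) = exp (- 2 * ?t\<^sup>2 * real m / ?b\<^sup>2)"
    using trunc_level_ge_1 by (simp add: decay_rate_def field_simps power2_eq_square power4_eq_xxxx)
  then have "1 - exp (- decay_rate * real m) \<le> W.prob {w \<in> space (iid (iid D n) m). \<forall>H\<in>F.
      real m * (\<integral>x. min \<bar>quad_form n H x\<bar> ?b \<partial>iid D n) - 2 * ?rc - ?t * real m \<le>
      (\<Sum>i<m. min \<bar>quad_form n H (w i)\<bar> ?b)}"
    using trunc_level_ge_1 finite_moments_integrable[OF finite_moments_quad_form]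
      P.uniform_lower_deviation[OF finite, of "quad_form n" "\<lambda>t. min \<bar>t\<bar> ?b" ?b ?t m] by auto
  also have "\<dots> \<le> W.prob ?good"
  proof (rule W.finite_measure_mono)
    have "flatten m n \<in> iid (iid D n) m \<rightarrow>\<^sub>M sample_space D m n"
      unfolding sample_space_def by (rule measurable_flatten)
    from measurable_sets[OF this sets_lower_bounded[OF countable_finite[OF finite(1)]]]
    show "?good \<in> W.events" unfolding vimage_flatten_lower_bounded .
  qed (use level in \<open>fastforce simp: lower_bounded_def trunc_sum_flatten\<close>)
  finally show ?thesis .
qed

lemma finite_class_event:
  assumes finite: "finite F" "F \<noteq> {}" and "F \<subseteq> normalized_class n \<kappa>" "sufficient_sample m n \<kappa>"
  shows "1 - exp (- decay_rate * real m) \<le>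
    measure (sample_space D m n) {a \<in> space (sample_space D m n). lower_bounded m n F a}"
    (is "_ \<le> measure ?S ?good")
proof -
  have flatten: "flatten m n \<in> iid (iid D n) m \<rightarrow>\<^sub>M ?S"
    and distr: "distr (iid (iid D n) m) ?S (flatten m n) = ?S"
    unfolding sample_space_def by (rule measurable_flatten distr_flatten)+
  have "1 - exp (- decay_rate * real m) \<le>
      measure (iid (iid D n) m) (flatten m n -` ?good \<inter> space (iid (iid D n) m))"
    unfolding vimage_flatten_lower_bounded by (rule finite_class_lower_bounded[OF assms])
  also have "\<dots> = measure (distr (iid (iid D n) m) ?S (flatten m n)) ?good"
    using flatten sets_lower_bounded finite by (simp add: measure_distr countable_finite)
  finally show ?thesis unfolding distr .
qed

text \<open>The lower bound passes from a countable dense subset to the whole class because \<open>trunc_sum\<close> is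
  continuous in the matrix.\<close>
lemma uniform_lower_bound_event:
  assumes size: "sufficient_sample m n \<kappa>"
  obtains E where "E \<in> sets (sample_space D m n)"
    "1 - exp (- decay_rate * real m) \<le> measure (sample_space D m n) E"
    "\<And>a. a \<in> E \<Longrightarrow> lower_bounded m n (normalized_class n \<kappa>) a"
proof -
  let ?S = "sample_space D m n" and ?C = "normalized_class n \<kappa>"
  interpret S: prob_space ?S unfolding sample_space_def by (intro prob_space_PiM prob_space_axioms)
  obtain T where T_countable: "countable T" and T_dense: "T \<subseteq> ?C" "?C \<subseteq> closure T"
    by (rule separable)
  define good where "good = (\<lambda>F. {a \<in> space ?S. lower_bounded m n F a})"
  have good_iff: "good F = {a \<in> space ?S. \<forall>H\<in>F. a \<in> good {H}}" for F
    by (auto simp: good_def lower_bounded_def)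
  show thesis
  proof (rule that)
    show "good T \<in> S.events" unfolding good_def by (rule sets_lower_bounded[OF T_countable])
    show "1 - exp (- decay_rate * real m) \<le> S.prob (good T)"
      unfolding good_iff[of T]
    proof (rule S.prob_countable_Ball_ge[OF T_countable])
      fix F assume "finite F" "F \<noteq> {}" "F \<subseteq> T"
      then have "1 - exp (- decay_rate * real m) \<le> S.prob (good F)"
        unfolding good_def using T_dense(1) by (intro finite_class_event[OF _ _ _ size]) auto
      then show "1 - exp (- decay_rate * real m) \<le> S.prob {a \<in> space ?S. \<forall>H\<in>F. a \<in> good {H}}"
        by (subst (asm) good_iff)
    qed (auto simp: good_def sets_lower_bounded)
    fix a assume "a \<in> good T"
    let ?L = "{H. real m / (4 * trunc_level) \<le> trunc_sum m n trunc_level H a}"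
    have "closed ?L" by (intro closed_Collect_le continuous_on_const continuous_on_trunc_sum)
    moreover have "T \<subseteq> ?L" using \<open>a \<in> good T\<close> by (auto simp: good_def lower_bounded_def)
    ultimately show "lower_bounded m n ?C a"
      using closure_minimal T_dense(2) unfolding lower_bounded_def by blast
  qed
qed

lemma frob_le_sum_quad_form:
  assumes symm: "symm_on n H" and nuclear: "nuclear_bounded n (\<kappa> * h) H"
    and frob: "h = sqrt (frob_inner n H H)" and "0 < h" "0 \<le> \<kappa>"
    and lower: "lower_bounded m n (normalized_class n (\<kappa> / sqrt nondegeneracy)) a"
  shows "real m / (4 * trunc_level) * (sqrt nondegeneracy * h) \<le>
      (\<Sum>i<m. \<bar>quad_form n H (\<lambda>j. a (i, j))\<bar>)"
proof -
  let ?\<gamma> = "sqrt nondegeneracy"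
  define \<sigma> where "\<sigma> = sqrt (\<integral>x. (quad_form n H x)\<^sup>2 \<partial>iid D n)"
  let ?H = "\<lambda>i j. 1 / \<sigma> * H i j"
  have \<sigma>_ge: "?\<gamma> * h \<le> \<sigma>"
    using real_sqrt_le_mono[OF frob_inner_le_quad_form_second_moment[OF symm]]
    by (simp add: \<sigma>_def frob nondegeneracy_def real_sqrt_mult)
  moreover have "0 < ?\<gamma> * h" using nondegeneracy_pos \<open>0 < h\<close> by simp
  ultimately have \<sigma>_pos: "0 < \<sigma>" by linarith
  have "?H \<in> normalized_class n (\<kappa> / ?\<gamma>)"
    unfolding normalized_class_def
  proof (intro CollectI conjI)
    show "symm_on n ?H" using symm by (simp add: symm_on_def)
    have "(\<integral>x. (quad_form n H x)\<^sup>2 \<partial>iid D n) = \<sigma>\<^sup>2" by (simp add: \<sigma>_def)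
    then show "(\<integral>x. (quad_form n ?H x)\<^sup>2 \<partial>iid D n) = 1"
      unfolding quad_form_scale_matrix using \<sigma>_pos by (simp add: power_divide)
    have "1 / \<sigma> * (\<kappa> * h) \<le> \<kappa> / ?\<gamma>"
      using mult_left_mono[OF \<sigma>_ge \<open>0 \<le> \<kappa>\<close>] \<sigma>_pos nondegeneracy_pos by (simp add: field_simps)
    moreover have "nuclear_bounded n (1 / \<sigma> * (\<kappa> * h)) ?H"
      using nuclear \<sigma>_pos by (intro nuclear_bounded_scale) auto
    ultimately show "nuclear_bounded n (\<kappa> / ?\<gamma>) ?H" by (rule nuclear_bounded_mono[rotated])
  qed
  then have "real m / (4 * trunc_level) \<le> trunc_sum m n trunc_level ?H a"
    using lower by (simp add: lower_bounded_def)
  also have "\<dots> \<le> (\<Sum>i<m. \<bar>quad_form n ?H (\<lambda>j. a (i, j))\<bar>)" by (rule trunc_sum_le)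
  also have "\<dots> = 1 / \<sigma> * (\<Sum>i<m. \<bar>quad_form n H (\<lambda>j. a (i, j))\<bar>)"
    unfolding quad_form_scale_matrix using \<sigma>_pos by (simp add: abs_mult sum_divide_distrib)
  finally have "real m / (4 * trunc_level) * \<sigma> \<le> (\<Sum>i<m. \<bar>quad_form n H (\<lambda>j. a (i, j))\<bar>)"
    using \<sigma>_pos by (simp add: field_simps)
  moreover have "real m / (4 * trunc_level) * (?\<gamma> * h) \<le> real m / (4 * trunc_level) * \<sigma>"
    using \<sigma>_ge trunc_level_ge_1 by (intro mult_left_mono) auto
  ultimately show ?thesis by linarith
qed

text \<open>Either the approximation error \<open>N\<close> already dominates \<open>h\<close>, or \<open>H\<close> lies in a nuclear ball of radius
  proportional to \<open>h\<close>, where the measurements of \<open>H\<close> control \<open>h\<close>.\<close>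
lemma frob_error_le:
  assumes symm: "symm_on n H" and nuclear: "nuclear_bounded n (3 * sqrt (real r) * h + 2 * N) H"
    and frob: "h = sqrt (frob_inner n H H)" and "0 \<le> N" "0 \<le> eps" "1 \<le> r" "0 < m"
    and lower: "lower_bounded m n (normalized_class n (class_radius r)) a"
    and residual: "(\<Sum>i<m. \<bar>quad_form n H (\<lambda>j. a (i, j))\<bar>) \<le> 2 * eps"
  shows "h \<le> 2 * N / sqrt (real r) + recovery_const * eps / real m"
proof -
  have const_pos: "0 < sqrt (real r)" "0 < sqrt nondegeneracy" "0 < trunc_level"
    using \<open>1 \<le> r\<close> nondegeneracy_pos trunc_level_ge_1 by auto
  show ?thesis
  proof (cases "h \<le> 2 * N / sqrt (real r)")
    case True
    then show ?thesis
      using const_pos \<open>0 \<le> eps\<close> by (intro add_increasing2) (auto simp: recovery_const_def)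
  next
    case False
    then have "2 * N < sqrt (real r) * h" using const_pos by (simp add: field_simps)
    then have "nuclear_bounded n (4 * sqrt (real r) * h) H"
      by (intro nuclear_bounded_mono[OF nuclear]) (simp add: mult_ac)
    moreover have "0 < h"
      using False \<open>0 \<le> N\<close> const_pos by (auto simp: not_le intro: le_less_trans[rotated])
    ultimately have "real m / (4 * trunc_level) * (sqrt nondegeneracy * h) \<le> 2 * eps"
      using lower unfolding class_radius_def
      by (intro order_trans[OF frob_le_sum_quad_form residual] symm frob) auto
    then have "h \<le> recovery_const * eps / real m"
      using \<open>0 < m\<close> const_pos by (simp add: recovery_const_def field_simps)
    then show ?thesis using \<open>0 \<le> N\<close> const_pos by (intro add_increasing) auto
  qed
qed

theorem recovery_of_lower_bound:
  assumes "1 \<le> r" "0 < m" and lower: "lower_bounded m n (normalized_class n (class_radius r)) a"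
  shows "a \<in> recovery_event m n r 2 recovery_const"
  unfolding recovery_event_def
proof (intro CollectI allI impI)
  fix S eps eta S' R
  assume psd_S: "psd_mat n S" and "0 \<le> eps" and eta: "eta \<in> carrier_vec m" "l1_norm eta \<le> eps"
    and minimizer: "is_minimizer a m n (sens_op a m n S + eta) eps S'"
    and best: "best_rank_approx r S R"
  have psd_S': "psd_mat n S'"
    and residual: "l1_norm (sens_op a m n S + eta - sens_op a m n S') \<le> eps"
    using minimizer by (auto simp: is_minimizer_def)
  have carrier: "S \<in> carrier_mat n n" "S' \<in> carrier_mat n n"
    using psd_S psd_S' by (auto simp: psd_mat_def)
  have low_rank: "R \<in> carrier_mat n n" "mat_rank R \<le> r"
    using best carrier by (auto simp: best_rank_approx_def)
  let ?H = "\<lambda>i j. S' $$ (i, j) - S $$ (i, j)"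
  show "frob_norm (S' - S) \<le> 2 * nuc_norm (S - R) / sqrt (real r) + recovery_const * eps / real m"
  proof (rule frob_error_le)
    show "symm_on n ?H" using psd_S psd_S' by (simp add: psd_mat_iff_psd_on psd_on_def symm_on_def)
    show "nuclear_bounded n (3 * sqrt (real r) * frob_norm (S' - S) + 2 * nuc_norm (S - R)) ?H"
      by (intro minimizer_error_nuclear_bounded psd_S psd_S' low_rank
          minimizer_mtrace_le[OF minimizer psd_S eta])
    show "frob_norm (S' - S) = sqrt (frob_inner n ?H ?H)" by (rule frob_norm_diff[OF carrier(2,1)])
    show "0 \<le> nuc_norm (S - R)" using carrier low_rank by (intro nuc_norm_nonneg) auto
    show "(\<Sum>i<m. \<bar>quad_form n ?H (\<lambda>j. a (i, j))\<bar>) \<le> 2 * eps"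
      by (rule residual_sum_le[OF carrier eta residual])
  qed fact+
qed

lemma sample_size_sufficient:
  assumes "1 \<le> r" and size: "sample_const * real n * real r < real m"
  shows "0 < m" and "sufficient_sample m n (class_radius r)"
proof -
  define q where "q = 45056 * trunc_level * K\<^sup>2 / sqrt nondegeneracy"
  have "0 \<le> q" using trunc_level_ge_1 nondegeneracy_pos by (simp add: q_def)
  have const_ge: "1 \<le> sample_const" "q\<^sup>2 \<le> sample_const" by (auto simp: sample_const_def q_def)
  have less_m: "c * (real n * real r) < real m" if "c \<le> sample_const" for c
    using mult_right_mono[OF that, of "real n * real r"] size by (simp add: mult.assoc)
  show "0 < m" using less_m[of 0] const_ge by simp
  have "real n * 1 \<le> real n * real r" using \<open>1 \<le> r\<close> by (intro mult_left_mono) auto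
  then have "n \<le> m" using less_m[OF const_ge(1)] by simp
  have "sqrt (q\<^sup>2 * (real n * real r)) \<le> sqrt (real m)"
    using less_m[OF const_ge(2)] by (intro real_sqrt_le_mono) simp
  then have "q * sqrt (real n * real r) \<le> sqrt (real m)" using \<open>0 \<le> q\<close> by (simp add: real_sqrt_mult)
  then have "(q * sqrt (real n * real r)) * sqrt (real m) \<le> sqrt (real m) * sqrt (real m)"
    by (rule mult_right_mono) simp
  also have "\<dots> = real m" by simp
  finally have "1408 * K\<^sup>2 * class_radius r * sqrt (real n * real m) \<le> real m / (8 * trunc_level)"
    using trunc_level_ge_1 by (simp add: q_def class_radius_def real_sqrt_mult field_simps)
  then show "sufficient_sample m n (class_radius r)"
    using \<open>n \<le> m\<close> nondegeneracy_pos by (simp add: sufficient_sample_def class_radius_def)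
qed

theorem recovery_with_high_probability:
  assumes "1 \<le> r" "sample_const * real n * real r < real m"
  shows "\<exists>E \<in> sets (sample_space D m n). E \<subseteq> recovery_event m n r 2 recovery_const \<and>
    1 - exp (- decay_rate * real m) \<le> measure (sample_space D m n) E"
proof -
  note size = sample_size_sufficient[OF assms]
  obtain E where event: "E \<in> sets (sample_space D m n)"
      "1 - exp (- decay_rate * real m) \<le> measure (sample_space D m n) E"
    and lower: "\<And>a. a \<in> E \<Longrightarrow> lower_bounded m n (normalized_class n (class_radius r)) a"
    by (rule uniform_lower_bound_event[OF size(2)]) (use that in blast)
  have "E \<subseteq> recovery_event m n r 2 recovery_const"
    using recovery_of_lower_bound[OF assms(1) size(1) lower] by blast
  then show ?thesis using event by blast
qed

end

lemma entry_distribution_imp_sensing_law: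
  assumes "entry_distribution D"
  obtains K where "sensing_law D K"
proof -
  obtain K where "0 < K" "(\<integral>\<^sup>+x. ennreal (exp (x\<^sup>2 / K\<^sup>2)) \<partial>D) \<le> 2"
    using assms by (auto simp: entry_distribution_def sub_gaussian_def)
  then have "sensing_law D K"
    using assms unfolding sensing_law_def sensing_law_axioms_def centred_subgaussian_def
      centred_subgaussian_axioms_def entry_distribution_def by auto
  then show thesis by (rule that)
qed

theorem theorem1:
  fixes D :: "real measure"
  assumes "entry_distribution D"
  shows "\<exists>c0>0. \<exists>c1>0. \<exists>C0>0. \<exists>C1>0. \<exists>C2>0.
    \<forall>n m r :: nat. 1 \<le> r \<longrightarrow> real m > c1 * real n * real r \<longrightarrow>
      (\<exists>E \<in> sets (sample_space D m n). E \<subseteq> recovery_event m n r C1 C2 \<and>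
         measure (sample_space D m n) E \<ge> 1 - C0 * exp (- c0 * real m))"
proof -
  obtain K where "sensing_law D K" using assms by (rule entry_distribution_imp_sensing_law)
  then interpret sensing_law D K .
  show ?thesis
  proof (intro exI conjI)
    show "0 < decay_rate" "0 < sample_const" "0 < (1::real)" "0 < (2::real)" "0 < recovery_const"
      using trunc_level_ge_1 nondegeneracy_pos
      by (simp_all add: decay_rate_def sample_const_def recovery_const_def)
    show "\<forall>n m r :: nat. 1 \<le> r \<longrightarrow> real m > sample_const * real n * real r \<longrightarrow>
        (\<exists>E \<in> sets (sample_space D m n). E \<subseteq> recovery_event m n r 2 recovery_const \<and>
           measure (sample_space D m n) E \<ge> 1 - 1 * exp (- decay_rate * real m))"
      using recovery_with_high_probability by simp
  qed
qed

end
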